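(* A finite-dimensional Hopf algebra $H$ over an algebraically closed field $\Bbbk$ with the Chevalley property is of finite representation type if and only if $H$ is a Nakayama algebra.
   Context: A finite-dimensional Hopf algebra $H$ has the Chevalley property if its (Jacobson) radical $\mathrm{Rad}(H)$ is a Hopf ideal. A finite-dimensional algebra $A$ is of finite representation type if there are only finitely many isomorphism classes of (finite-dimensional) indecomposable $A$-modules. A finite-dimensional algebra is Nakayama if each indecomposable projective left module and each indecomposable projective right module has a unique composition series. *)

theory Defs
  imports
    "HOL-Computational_Algebra.Polynomial"
    "HOL-Library.Poly_Mapping"
begin

section \<open>Algebras over a field\<close>

locale k_algebra = vector_space scale
  for scale :: "'k::field \<Rightarrow> 'h::ring_1 \<Rightarrow> 'h" +
  assumes scale_mult_left: "scale c (x * y) = scale c x * y"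
    and scale_mult_right: "scale c (x * y) = x * scale c y"

definition finite_dimensional :: "('k::field \<Rightarrow> 'h::ab_group_add \<Rightarrow> 'h) \<Rightarrow> bool" where
  "finite_dimensional scale \<longleftrightarrow> (\<exists>B. finite_dimensional_vector_space scale B)"

definition left_ideal :: "'h::ring_1 set \<Rightarrow> bool" where
  "left_ideal I \<longleftrightarrow> 0 \<in> I \<and> (\<forall>x\<in>I. \<forall>y\<in>I. x + y \<in> I) \<and> (\<forall>r. \<forall>x\<in>I. r * x \<in> I)"

definition two_sided_ideal :: "'h::ring_1 set \<Rightarrow> bool" where
  "two_sided_ideal I \<longleftrightarrow> left_ideal I \<and> (\<forall>r. \<forall>x\<in>I. x * r \<in> I)"

definition maximal_left_ideal :: "'h::ring_1 set \<Rightarrow> bool" where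
  "maximal_left_ideal I \<longleftrightarrow>
     left_ideal I \<and> I \<noteq> UNIV \<and> (\<forall>J. left_ideal J \<and> I \<subseteq> J \<longrightarrow> J = I \<or> J = UNIV)"

definition jacobson_radical :: "'h::ring_1 set" where
  "jacobson_radical = \<Inter>{I. maximal_left_ideal I}"


section \<open>Tensor powers of an algebra\<close>

text \<open>The type \<open>'a \<Rightarrow>\<^sub>0 'k\<close> is the free vector space on \<open>'a\<close>, with basis
  \<open>single a 1\<close>. The tensor square of \<open>'h\<close> is the quotient of the free vector space on
  \<open>'h \<times> 'h\<close> by the bilinearity relations, so its elements are the classes of
  \<open>tensor2_rel scale\<close>, and \<open>single (a, b) 1\<close> represents \<open>a \<otimes> b\<close>.
  Likewise for the tensor cube, with triples.\<close>

definition free_scale :: "'k::field \<Rightarrow> ('a \<Rightarrow>\<^sub>0 'k) \<Rightarrow> ('a \<Rightarrow>\<^sub>0 'k)" where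
  "free_scale c p = Poly_Mapping.map ((*) c) p"

lemma lookup_free_scale [simp]:
  "Poly_Mapping.lookup (free_scale c p) x = c * Poly_Mapping.lookup p x"
  by (simp add: free_scale_def Poly_Mapping.map.rep_eq when_def)

lemma vector_space_free_scale: "vector_space free_scale"
  by standard (auto intro!: poly_mapping_eqI simp: lookup_add algebra_simps)

text \<open>Linear extension to the free vector space of a map given on its basis.\<close>

definition lin_ext :: "('k::field \<Rightarrow> 'v::ab_group_add \<Rightarrow> 'v) \<Rightarrow> ('a \<Rightarrow> 'v) \<Rightarrow> ('a \<Rightarrow>\<^sub>0 'k) \<Rightarrow> 'v" where
  "lin_ext s f p = (\<Sum>x\<in>Poly_Mapping.keys p. s (Poly_Mapping.lookup p x) (f x))"

definition tensor2_null :: "('k::field \<Rightarrow> 'h::ab_group_add \<Rightarrow> 'h) \<Rightarrow> (('h \<times> 'h) \<Rightarrow>\<^sub>0 'k) set" where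
  "tensor2_null scale = module.span free_scale
     (\<Union>a a' b c.
       {Poly_Mapping.single (a + a', b) 1 - Poly_Mapping.single (a, b) 1 - Poly_Mapping.single (a', b) 1,
        Poly_Mapping.single (b, a + a') 1 - Poly_Mapping.single (b, a) 1 - Poly_Mapping.single (b, a') 1,
        Poly_Mapping.single (scale c a, b) 1 - Poly_Mapping.single (a, b) c,
        Poly_Mapping.single (b, scale c a) 1 - Poly_Mapping.single (b, a) c})"

definition tensor3_null :: "('k::field \<Rightarrow> 'h::ab_group_add \<Rightarrow> 'h) \<Rightarrow> (('h \<times> 'h \<times> 'h) \<Rightarrow>\<^sub>0 'k) set" where
  "tensor3_null scale = module.span free_scale
     (\<Union>a a' b d c.
       {Poly_Mapping.single (a + a', b, d) 1 - Poly_Mapping.single (a, b, d) 1 - Poly_Mapping.single (a', b, d) 1,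
        Poly_Mapping.single (b, a + a', d) 1 - Poly_Mapping.single (b, a, d) 1 - Poly_Mapping.single (b, a', d) 1,
        Poly_Mapping.single (b, d, a + a') 1 - Poly_Mapping.single (b, d, a) 1 - Poly_Mapping.single (b, d, a') 1,
        Poly_Mapping.single (scale c a, b, d) 1 - Poly_Mapping.single (a, b, d) c,
        Poly_Mapping.single (b, scale c a, d) 1 - Poly_Mapping.single (b, a, d) c,
        Poly_Mapping.single (b, d, scale c a) 1 - Poly_Mapping.single (b, d, a) c})"

definition tensor2_rel :: "('k::field \<Rightarrow> 'h::ab_group_add \<Rightarrow> 'h) \<Rightarrow> (('h \<times> 'h) \<Rightarrow>\<^sub>0 'k) rel" where
  "tensor2_rel scale = {(p, q). p - q \<in> tensor2_null scale}"

definition tensor3_rel :: "('k::field \<Rightarrow> 'h::ab_group_add \<Rightarrow> 'h) \<Rightarrow> (('h \<times> 'h \<times> 'h) \<Rightarrow>\<^sub>0 'k) rel" where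
  "tensor3_rel scale = {(p, q). p - q \<in> tensor3_null scale}"

text \<open>On representatives, the product \<open>(a \<otimes> b) (c \<otimes> d) = a c \<otimes> b d\<close>.\<close>

definition tensor2_mult ::
  "(('h::ring_1 \<times> 'h) \<Rightarrow>\<^sub>0 'k::field) \<Rightarrow> (('h \<times> 'h) \<Rightarrow>\<^sub>0 'k) \<Rightarrow> (('h \<times> 'h) \<Rightarrow>\<^sub>0 'k)" where
  "tensor2_mult p q =
     lin_ext free_scale (\<lambda>(a, b).
       lin_ext free_scale (\<lambda>(c, d). Poly_Mapping.single (a * c, b * d) 1) q) p"


section \<open>Hopf algebras\<close>

text \<open>The comultiplication takes values in the tensor square: \<open>p \<in> \<Delta> x\<close> says that the formal sum
  \<open>p\<close> represents \<open>\<Delta> x\<close>. In \<open>coassoc\<close>, \<open>\<delta>\<close> is any choice of representatives of \<open>\<Delta>\<close>; its two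
  sides represent \<open>(\<Delta> \<otimes> id) (\<Delta> x)\<close> and \<open>(id \<otimes> \<Delta>) (\<Delta> x)\<close>.\<close>

locale hopf_algebra = k_algebra scale
  for scale :: "'k::field \<Rightarrow> 'h::ring_1 \<Rightarrow> 'h" +
  fixes \<Delta> :: "'h \<Rightarrow> (('h \<times> 'h) \<Rightarrow>\<^sub>0 'k) set"
    and \<epsilon> :: "'h \<Rightarrow> 'k"
    and S :: "'h \<Rightarrow> 'h"
  assumes comult_tensor: "\<Delta> x \<in> UNIV // tensor2_rel scale"
    and comult_add: "p \<in> \<Delta> x \<Longrightarrow> q \<in> \<Delta> y \<Longrightarrow> p + q \<in> \<Delta> (x + y)"
    and comult_scale: "p \<in> \<Delta> x \<Longrightarrow> free_scale c p \<in> \<Delta> (scale c x)"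
    and comult_one: "Poly_Mapping.single (1, 1) 1 \<in> \<Delta> 1"
    and comult_mult: "p \<in> \<Delta> x \<Longrightarrow> q \<in> \<Delta> y \<Longrightarrow> tensor2_mult p q \<in> \<Delta> (x * y)"
    and counit_linear: "Vector_Spaces.linear scale (*) \<epsilon>"
    and counit_one: "\<epsilon> 1 = 1"
    and counit_mult: "\<epsilon> (x * y) = \<epsilon> x * \<epsilon> y"
    and coassoc: "(\<And>y. \<delta> y \<in> \<Delta> y) \<Longrightarrow>
       (lin_ext free_scale (\<lambda>(a, b).
          lin_ext free_scale (\<lambda>(c, d). Poly_Mapping.single (c, d, b) 1) (\<delta> a)) (\<delta> x),
        lin_ext free_scale (\<lambda>(a, b).
          lin_ext free_scale (\<lambda>(c, d). Poly_Mapping.single (a, c, d) 1) (\<delta> b)) (\<delta> x))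
       \<in> tensor3_rel scale"
    and counit_left: "p \<in> \<Delta> x \<Longrightarrow> lin_ext scale (\<lambda>(a, b). scale (\<epsilon> a) b) p = x"
    and counit_right: "p \<in> \<Delta> x \<Longrightarrow> lin_ext scale (\<lambda>(a, b). scale (\<epsilon> b) a) p = x"
    and antipode_linear: "Vector_Spaces.linear scale scale S"
    and antipode_left: "p \<in> \<Delta> x \<Longrightarrow> lin_ext scale (\<lambda>(a, b). S a * b) p = scale (\<epsilon> x) 1"
    and antipode_right: "p \<in> \<Delta> x \<Longrightarrow> lin_ext scale (\<lambda>(a, b). a * S b) p = scale (\<epsilon> x) 1"

text \<open>\<open>\<Delta> x\<close> lies in \<open>I \<otimes> H + H \<otimes> I\<close> iff it has a representative all of whose terms \<open>a \<otimes> b\<close>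
  have \<open>a \<in> I\<close> or \<open>b \<in> I\<close>.\<close>

definition hopf_ideal ::
  "('h::ring_1 \<Rightarrow> (('h \<times> 'h) \<Rightarrow>\<^sub>0 'k::field) set) \<Rightarrow> ('h \<Rightarrow> 'k) \<Rightarrow> ('h \<Rightarrow> 'h) \<Rightarrow> 'h set \<Rightarrow> bool" where
  "hopf_ideal \<Delta> \<epsilon> S I \<longleftrightarrow>
     two_sided_ideal I \<and>
     (\<forall>x\<in>I. \<exists>p\<in>\<Delta> x. \<forall>(a, b)\<in>Poly_Mapping.keys p. a \<in> I \<or> b \<in> I) \<and>
     (\<forall>x\<in>I. \<epsilon> x = 0) \<and>
     (\<forall>x\<in>I. S x \<in> I)"

definition chevalley_property ::
  "('h::ring_1 \<Rightarrow> (('h \<times> 'h) \<Rightarrow>\<^sub>0 'k::field) set) \<Rightarrow> ('h \<Rightarrow> 'k) \<Rightarrow> ('h \<Rightarrow> 'h) \<Rightarrow> bool" where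
  "chevalley_property \<Delta> \<epsilon> S \<longleftrightarrow> hopf_ideal \<Delta> \<epsilon> S jacobson_radical"


section \<open>Modules\<close>

text \<open>The underlying abelian group of a module is a subgroup \<open>carr\<close> of an ambient group
  \<open>'m\<close>, whose addition it inherits; \<open>act\<close> is only relevant on \<open>carr\<close>. The multiplication of the
  acting ring is a parameter: a left module is a module for \<open>(*)\<close> and a right module is a module
  for the opposite multiplication \<open>\<lambda>x y. y * x\<close>.\<close>

record ('h, 'm) rep_module =
  carr :: "'m set"
  act :: "'h \<Rightarrow> 'm \<Rightarrow> 'm"

definition module_over ::
  "('h::ring_1 \<Rightarrow> 'h \<Rightarrow> 'h) \<Rightarrow> ('h, 'm::ab_group_add) rep_module \<Rightarrow> bool" where
  "module_over mul M \<longleftrightarrow>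
     0 \<in> carr M \<and>
     (\<forall>x\<in>carr M. \<forall>y\<in>carr M. x + y \<in> carr M) \<and>
     (\<forall>x\<in>carr M. - x \<in> carr M) \<and>
     (\<forall>r. \<forall>x\<in>carr M. act M r x \<in> carr M) \<and>
     (\<forall>r. \<forall>x\<in>carr M. \<forall>y\<in>carr M. act M r (x + y) = act M r x + act M r y) \<and>
     (\<forall>r s. \<forall>x\<in>carr M. act M (r + s) x = act M r x + act M s x) \<and>
     (\<forall>r s. \<forall>x\<in>carr M. act M (mul r s) x = act M r (act M s x)) \<and>
     (\<forall>x\<in>carr M. act M 1 x = x)"

text \<open>Finite-dimensionality over the ground field, which acts through \<open>c \<mapsto> c 1\<close>.\<close>

definition fd_module ::
  "('k::field \<Rightarrow> 'h::ring_1 \<Rightarrow> 'h) \<Rightarrow> ('h, 'm::ab_group_add) rep_module \<Rightarrow> bool" where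
  "fd_module scale M \<longleftrightarrow>
     (\<exists>B. finite B \<and> B \<subseteq> carr M \<and>
        (\<forall>x\<in>carr M. \<exists>c. x = (\<Sum>b\<in>B. act M (scale (c b) 1) b)))"

definition submodule :: "'m::ab_group_add set \<Rightarrow> ('h::ring_1, 'm) rep_module \<Rightarrow> bool" where
  "submodule N M \<longleftrightarrow>
     N \<subseteq> carr M \<and> 0 \<in> N \<and> (\<forall>x\<in>N. \<forall>y\<in>N. x + y \<in> N) \<and> (\<forall>r. \<forall>x\<in>N. act M r x \<in> N)"

definition module_hom ::
  "('h::ring_1, 'm::ab_group_add) rep_module \<Rightarrow> ('h, 'n::ab_group_add) rep_module \<Rightarrow> ('m \<Rightarrow> 'n) \<Rightarrow> bool" where
  "module_hom M N f \<longleftrightarrow>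
     f ` carr M \<subseteq> carr N \<and>
     (\<forall>x\<in>carr M. \<forall>y\<in>carr M. f (x + y) = f x + f y) \<and>
     (\<forall>r. \<forall>x\<in>carr M. f (act M r x) = act N r (f x))"

definition isomorphic ::
  "('h::ring_1, 'm::ab_group_add) rep_module \<Rightarrow> ('h, 'n::ab_group_add) rep_module \<Rightarrow> bool" where
  "isomorphic M N \<longleftrightarrow> (\<exists>f. module_hom M N f \<and> bij_betw f (carr M) (carr N))"

definition indecomposable :: "('h::ring_1, 'm::ab_group_add) rep_module \<Rightarrow> bool" where
  "indecomposable M \<longleftrightarrow>
     carr M \<noteq> {0} \<and>
     (\<forall>N L. submodule N M \<and> submodule L M \<and> N \<inter> L = {0} \<and> {x + y | x y. x \<in> N \<and> y \<in> L} = carr M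
        \<longrightarrow> N = {0} \<or> L = {0})"

text \<open>The lifting property, tested on all modules inside the ambient group \<open>'m\<close> of \<open>P\<close>. With
  \<open>'m = nat \<Rightarrow>\<^sub>0 'k\<close>, as below, these include all finite-dimensional modules.\<close>

definition projective ::
  "('h::ring_1 \<Rightarrow> 'h \<Rightarrow> 'h) \<Rightarrow> ('h, 'm::ab_group_add) rep_module \<Rightarrow> bool" where
  "projective mul P \<longleftrightarrow>
     (\<forall>(N :: ('h, 'm) rep_module) (L :: ('h, 'm) rep_module) g f.
        module_over mul N \<and> module_over mul L \<and>
        module_hom N L g \<and> g ` carr N = carr L \<and> module_hom P L f
        \<longrightarrow> (\<exists>h. module_hom P N h \<and> (\<forall>x\<in>carr P. g (h x) = f x)))"

text \<open>The list is \<open>0 = M\<^sub>0 \<subset> \<dots> \<subset> M\<^sub>n = M\<close>; simplicity of \<open>M\<^sub>i\<^sub>+\<^sub>1 / M\<^sub>i\<close> is expressed in terms of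
  the submodules between \<open>M\<^sub>i\<close> and \<open>M\<^sub>i\<^sub>+\<^sub>1\<close>.\<close>

definition composition_series ::
  "('h::ring_1, 'm::ab_group_add) rep_module \<Rightarrow> 'm set list \<Rightarrow> bool" where
  "composition_series M Ns \<longleftrightarrow>
     Ns \<noteq> [] \<and> hd Ns = {0} \<and> last Ns = carr M \<and> (\<forall>N\<in>set Ns. submodule N M) \<and>
     (\<forall>i. Suc i < length Ns \<longrightarrow>
        Ns ! i \<subset> Ns ! Suc i \<and>
        (\<forall>L. submodule L M \<and> Ns ! i \<subseteq> L \<and> L \<subseteq> Ns ! Suc i \<longrightarrow> L = Ns ! i \<or> L = Ns ! Suc i))"

text \<open>Up to isomorphism, every finite-dimensional module lives in the ambient group
  \<open>nat \<Rightarrow>\<^sub>0 'k\<close> (lemma \<open>fd_module_in_universe\<close>), so it suffices to consider modules there.\<close>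

definition fd_indecomposables ::
  "('k::field \<Rightarrow> 'h::ring_1 \<Rightarrow> 'h) \<Rightarrow> ('h, nat \<Rightarrow>\<^sub>0 'k) rep_module set" where
  "fd_indecomposables scale = {M. module_over (*) M \<and> fd_module scale M \<and> indecomposable M}"

definition finite_representation_type :: "('k::field \<Rightarrow> 'h::ring_1 \<Rightarrow> 'h) \<Rightarrow> bool" where
  "finite_representation_type scale \<longleftrightarrow>
     finite (fd_indecomposables scale //
       {(M, N) \<in> fd_indecomposables scale \<times> fd_indecomposables scale. isomorphic M N})"

definition nakayama_algebra :: "('k::field \<Rightarrow> 'h::ring_1 \<Rightarrow> 'h) \<Rightarrow> bool" where
  "nakayama_algebra scale \<longleftrightarrow>
     (\<forall>mul \<in> {(*), \<lambda>x y. y * x}. \<forall>P :: ('h, nat \<Rightarrow>\<^sub>0 'k) rep_module.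
        module_over mul P \<and> fd_module scale P \<and> projective mul P \<and> indecomposable P
        \<longrightarrow> (\<exists>!Ns. composition_series P Ns))"

lemma fd_module_in_universe:
  fixes scale :: "'k::field \<Rightarrow> 'h::ring_1 \<Rightarrow> 'h"
    and M :: "('h, 'm::ab_group_add) rep_module"
  assumes alg: "k_algebra scale" and mul: "mul \<in> {(*), \<lambda>x y. y * x}"
    and M: "module_over mul M" and fd: "fd_module scale M"
  obtains N :: "('h, nat \<Rightarrow>\<^sub>0 'k) rep_module"
  where "module_over mul N" "fd_module scale N" "isomorphic M N"
proof -
  interpret k_algebra scale by (rule alg)
  define s where "s c x = act M (scale c 1) x" for c x
  have M0: "0 \<in> carr M" and Madd: "x \<in> carr M \<Longrightarrow> y \<in> carr M \<Longrightarrow> x + y \<in> carr M"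
    and Mneg: "x \<in> carr M \<Longrightarrow> - x \<in> carr M"
    and Mact: "x \<in> carr M \<Longrightarrow> act M r x \<in> carr M"
    and act_add: "x \<in> carr M \<Longrightarrow> y \<in> carr M \<Longrightarrow> act M r (x + y) = act M r x + act M r y"
    and add_act: "x \<in> carr M \<Longrightarrow> act M (r + t) x = act M r x + act M t x"
    and act_act: "x \<in> carr M \<Longrightarrow> act M (mul r t) x = act M r (act M t x)"
    and act_one: "x \<in> carr M \<Longrightarrow> act M 1 x = x" for x y r t
    using M unfolding module_over_def by auto
  have Msum: "(\<And>i. i \<in> I \<Longrightarrow> f i \<in> carr M) \<Longrightarrow> sum f I \<in> carr M" for f and I :: "'i set"
    by (induction I rule: infinite_finite_induct) (auto simp: M0 Madd)
  have act_0: "act M r 0 = 0" for r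
    using act_add[of 0 0 r] M0 by simp
  have act_sum: "(\<And>i. i \<in> I \<Longrightarrow> f i \<in> carr M) \<Longrightarrow> act M r (sum f I) = (\<Sum>i\<in>I. act M r (f i))"
    for r f and I :: "'i set"
    by (induction I rule: infinite_finite_induct) (auto simp: act_0 act_add Msum)
  have sM: "x \<in> carr M \<Longrightarrow> s c x \<in> carr M" for c x
    by (simp add: s_def Mact)
  have s_add: "x \<in> carr M \<Longrightarrow> s (c + d) x = s c x + s d x" for c d x
    by (simp add: s_def scale_left_distrib add_act)
  have s_0: "x \<in> carr M \<Longrightarrow> s 0 x = 0" for x
    using s_add[of x 0 0] by simp
  have s_neg: "x \<in> carr M \<Longrightarrow> s (- c) x = - s c x" for c x
    using s_add[of x "- c" c] s_0[of x] by (simp add: eq_neg_iff_add_eq_0)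
  have s_diff: "x \<in> carr M \<Longrightarrow> s (c - d) x = s c x - s d x" for c d x
    using s_add[of x c "- d"] s_neg[of x d] by simp
  have mul_scale: "mul (scale c 1) (scale d 1) = scale (c * d) 1" for c d
  proof -
    have "scale c 1 * scale d 1 = scale (c * d) 1" for c d
      using scale_mult_left[of c 1 "scale d 1"] by simp
    then show ?thesis using mul by (auto simp: mult.commute)
  qed
  have s_s: "x \<in> carr M \<Longrightarrow> s c (s d x) = s (c * d) x" for c d x
    using act_act[of x "scale c 1" "scale d 1"] by (simp add: s_def mul_scale)
  have s_1: "x \<in> carr M \<Longrightarrow> s 1 x = x" for x
    by (simp add: s_def act_one)
  have s_sum: "(\<And>i. i \<in> I \<Longrightarrow> f i \<in> carr M) \<Longrightarrow> s c (sum f I) = (\<Sum>i\<in>I. s c (f i))"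
    for c f and I :: "'m set"
    by (simp add: s_def act_sum)

  define spans where "spans B \<longleftrightarrow> finite B \<and> B \<subseteq> carr M \<and>
    (\<forall>x\<in>carr M. \<exists>c. x = (\<Sum>b\<in>B. s (c b) b))" for B
  have "\<exists>B. spans B"
    using fd unfolding fd_module_def spans_def s_def by simp
  then obtain B where B: "spans B" and Bmin: "\<And>B'. spans B' \<Longrightarrow> card B \<le> card B'"
    using ex_has_least_nat[of spans _ card] by blast
  have finB: "finite B" and BM: "\<And>b. b \<in> B \<Longrightarrow> b \<in> carr M"
    and Bsp: "\<And>x. x \<in> carr M \<Longrightarrow> \<exists>c. x = (\<Sum>b\<in>B. s (c b) b)"
    using B unfolding spans_def by auto
  have indep: "c b = 0" if sum0: "(\<Sum>b\<in>B. s (c b) b) = 0" and b: "b \<in> B" for c b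
  proof (rule ccontr)
    assume nz: "c b \<noteq> 0"
    let ?B = "B - {b}"
    have B'M: "\<And>a. a \<in> ?B \<Longrightarrow> a \<in> carr M" using BM by auto
    have "s (c b) b + (\<Sum>a\<in>?B. s (c a) a) = 0"
      using sum0 sum.remove[OF finB b, of "\<lambda>b. s (c b) b"] by simp
    then have eq: "s (c b) b = - (\<Sum>a\<in>?B. s (c a) a)"
      by (simp add: eq_neg_iff_add_eq_0)
    have "b = s (inverse (c b)) (s (c b) b)"
      using nz BM[OF b] by (simp add: s_s s_1)
    also have "s (c b) b = (\<Sum>a\<in>?B. s (- c a) a)"
      unfolding eq by (simp add: sum_negf[symmetric] s_neg B'M)
    also have "s (inverse (c b)) \<dots> = (\<Sum>a\<in>?B. s (inverse (c b) * - c a) a)"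
      by (subst s_sum) (auto intro!: sum.cong simp: sM s_s BM simp del: mult_minus_right)
    finally have beq: "b = (\<Sum>a\<in>?B. s (inverse (c b) * - c a) a)" .
    have "spans ?B"
      unfolding spans_def
    proof (intro conjI ballI)
      fix x assume "x \<in> carr M"
      then obtain d where d: "x = (\<Sum>a\<in>B. s (d a) a)" using Bsp by blast
      have "x = s (d b) b + (\<Sum>a\<in>?B. s (d a) a)"
        unfolding d using sum.remove[OF finB b, of "\<lambda>b. s (d b) b"] by simp
      also have "s (d b) b = s (d b) (\<Sum>a\<in>?B. s (inverse (c b) * - c a) a)"
        using beq by simp
      also have "\<dots> = (\<Sum>a\<in>?B. s (d b * (inverse (c b) * - c a)) a)"
        by (subst s_sum) (auto intro!: sum.cong simp: sM s_s BM simp del: mult_minus_right)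
      also have "\<dots> + (\<Sum>a\<in>?B. s (d a) a) = (\<Sum>a\<in>?B. s (d b * (inverse (c b) * - c a) + d a) a)"
        unfolding sum.distrib[symmetric] by (rule sum.cong[OF refl], rule s_add[OF B'M, symmetric])
      finally show "\<exists>c. x = (\<Sum>b\<in>?B. s (c b) b)"
        by (intro exI[of _ "\<lambda>a. d b * (inverse (c b) * - c a) + d a"])
    qed (use finB BM in auto)
    then have "card B \<le> card ?B" by (rule Bmin)
    then show False using card_Diff1_less[OF finB b] by simp
  qed

  define n where "n = card B"
  obtain e where e: "bij_betw e {..<n} B"
    using ex_bij_betw_nat_finite[OF finB] by (auto simp: n_def atLeast0LessThan)
  have eM: "i < n \<Longrightarrow> e i \<in> carr M" for i
    using e BM by (auto simp: bij_betw_def)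
  define C where "C = {p :: nat \<Rightarrow>\<^sub>0 'k. Poly_Mapping.keys p \<subseteq> {..<n}}"
  define \<phi> where "\<phi> p = (\<Sum>i<n. s (Poly_Mapping.lookup p i) (e i))" for p :: "nat \<Rightarrow>\<^sub>0 'k"
  have \<phi>M: "\<phi> p \<in> carr M" for p
    unfolding \<phi>_def by (rule Msum) (auto simp: sM eM)
  have \<phi>_add: "\<phi> (p + q) = \<phi> p + \<phi> q" for p q
    by (simp add: \<phi>_def lookup_add s_add eM sum.distrib)
  have \<phi>_diff: "\<phi> (p - q) = \<phi> p - \<phi> q" for p q
    by (simp add: \<phi>_def lookup_minus s_diff eM sum_subtractf)
  have C0: "0 \<in> C" by (simp add: C_def)
  have Cadd: "p \<in> C \<Longrightarrow> q \<in> C \<Longrightarrow> p + q \<in> C" for p q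
    using keys_add[of p q] by (auto simp: C_def)
  have Cneg: "p \<in> C \<Longrightarrow> - p \<in> C" for p
    by (simp add: C_def)
  have Cdiff: "p \<in> C \<Longrightarrow> q \<in> C \<Longrightarrow> p - q \<in> C" for p q
    using Cadd[of p "- q"] Cneg[of q] by simp
  have \<phi>_ker: "p = 0" if "p \<in> C" "\<phi> p = 0" for p
  proof (rule poly_mapping_eqI)
    fix i
    let ?c = "\<lambda>b. Poly_Mapping.lookup p (inv_into {..<n} e b)"
    have inj: "inj_on e {..<n}" using e by (simp add: bij_betw_def)
    have "(\<Sum>b\<in>B. s (?c b) b) = \<phi> p"
      unfolding \<phi>_def
      by (subst sum.reindex_bij_betw[OF e, symmetric])
        (auto intro!: sum.cong simp: inv_into_f_f[OF inj])
    then have *: "b \<in> B \<Longrightarrow> ?c b = 0" for b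
      using indep[of ?c b] that by simp
    show "Poly_Mapping.lookup p i = Poly_Mapping.lookup 0 i"
    proof (cases "i < n")
      case True
      then show ?thesis using *[of "e i"] e by (auto simp: inv_into_f_f[OF inj] bij_betw_def)
    next
      case False
      then show ?thesis using that(1) by (auto simp: C_def in_keys_iff)
    qed
  qed
  have inj: "inj_on \<phi> C"
  proof (rule inj_onI)
    fix p q assume "p \<in> C" "q \<in> C" "\<phi> p = \<phi> q"
    then have "p - q = 0" by (intro \<phi>_ker) (auto simp: Cdiff \<phi>_diff)
    then show "p = q" by simp
  qed
  have surj: "\<phi> ` C = carr M"
  proof (intro equalityI subsetI)
    fix x assume "x \<in> carr M"
    then obtain c where c: "x = (\<Sum>b\<in>B. s (c b) b)" using Bsp by blast
    define p where "p = (\<Sum>i<n. Poly_Mapping.single i (c (e i)))"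
    have lp: "Poly_Mapping.lookup p i = (if i < n then c (e i) else 0)" for i
      by (simp add: p_def lookup_sum lookup_single when_def)
    have "p \<in> C" by (auto simp: C_def in_keys_iff lp split: if_splits)
    moreover have "\<phi> p = x"
      unfolding \<phi>_def c by (subst sum.reindex_bij_betw[OF e, symmetric]) (simp add: lp)
    ultimately show "x \<in> \<phi> ` C" by blast
  qed (use \<phi>M in auto)
  define \<psi> where "\<psi> = inv_into C \<phi>"
  have \<psi>C: "x \<in> carr M \<Longrightarrow> \<psi> x \<in> C" and \<phi>\<psi>: "x \<in> carr M \<Longrightarrow> \<phi> (\<psi> x) = x" for x
    unfolding \<psi>_def surj[symmetric] by (auto intro: inv_into_into f_inv_into_f)
  have \<psi>\<phi>: "p \<in> C \<Longrightarrow> \<psi> (\<phi> p) = p" for p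
    unfolding \<psi>_def by (rule inv_into_f_f[OF inj])
  have \<psi>_add: "\<psi> (x + y) = \<psi> x + \<psi> y" if "x \<in> carr M" "y \<in> carr M" for x y
    using that \<psi>\<phi>[of "\<psi> x + \<psi> y"] by (simp add: \<phi>_add \<phi>\<psi> Cadd \<psi>C)
  have \<psi>_0: "\<psi> 0 = 0"
    using \<psi>_add[OF M0 M0] by (metis add.right_neutral add_left_cancel)
  have \<psi>_sum: "(\<And>i. i \<in> I \<Longrightarrow> f i \<in> carr M) \<Longrightarrow> \<psi> (sum f I) = (\<Sum>i\<in>I. \<psi> (f i))"
    for f and I :: "'m set"
    by (induction I rule: infinite_finite_induct) (auto simp: \<psi>_0 \<psi>_add Msum)
  define N where "N = \<lparr>carr = C, act = (\<lambda>r p. \<psi> (act M r (\<phi> p)))\<rparr>"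
  have N: "module_over mul N"
    unfolding module_over_def N_def
    by (auto simp: C0 Cadd Cneg \<psi>C \<phi>\<psi> \<psi>\<phi> Mact \<phi>M \<phi>_add act_add add_act act_act act_one \<psi>_add)
  have "fd_module scale N"
    unfolding fd_module_def
  proof (intro exI[of _ "\<psi> ` B"] conjI ballI)
    fix p assume "p \<in> carr N"
    then have p: "p \<in> C" by (simp add: N_def)
    obtain c where c: "\<phi> p = (\<Sum>b\<in>B. s (c b) b)" using Bsp \<phi>M by blast
    have inj': "inj_on \<psi> B" by (rule inj_on_inverseI[of _ \<phi>]) (simp add: \<phi>\<psi> BM)
    have "p = \<psi> (\<phi> p)" using p by (simp add: \<psi>\<phi>)
    also have "\<dots> = (\<Sum>b\<in>B. \<psi> (s (c b) b))"
      unfolding c by (rule \<psi>_sum) (simp add: sM BM)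
    also have "\<dots> = (\<Sum>a\<in>\<psi> ` B. act N (scale (c (\<phi> a)) 1) a)"
      by (subst sum.reindex[OF inj']) (auto intro!: sum.cong simp: N_def \<phi>\<psi> BM s_def)
    finally show "\<exists>c. p = (\<Sum>a\<in>\<psi> ` B. act N (scale (c a) 1) a)"
      by (intro exI[of _ "\<lambda>a. c (\<phi> a)"])
  qed (use finB BM \<psi>C in \<open>auto simp: N_def\<close>)
  moreover have "isomorphic M N"
    unfolding isomorphic_def
  proof (intro exI[of _ \<psi>] conjI)
    show "module_hom M N \<psi>"
      unfolding module_hom_def N_def by (auto simp: \<psi>C \<psi>_add \<phi>\<psi>)
    show "bij_betw \<psi> (carr M) (carr N)"
      by (rule bij_betw_byWitness[where f' = \<phi>]) (auto simp: N_def \<phi>\<psi> \<psi>\<phi> \<psi>C \<phi>M)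
  qed
  ultimately show thesis using that N by blast
qed

end

theory Submission
  imports Defs "HOL-Library.Function_Algebras" "HOL-Library.FuncSet"
begin

text \<open>Let \<open>J\<close> be the radical of \<open>H\<close>, a Hopf ideal, and \<open>n\<close> the dimension of \<open>A = H / J\<close>. The
  comultiplication makes \<open>J / J\<^sup>2\<close> a Hopf module over \<open>A\<close>, so by the argument of the fundamental theorem of
  Hopf modules it is freely generated over \<open>A\<close> by a space of dimension \<open>m = dim J / J H\<^sup>+\<close>, where
  \<open>H\<^sup>+ = ker \<epsilon>\<close>; the same holds on the other side.

  If \<open>m \<le> 1\<close> on both sides, then \<open>J = v H = H v\<close> for one element \<open>v\<close>. The endomorphism ring of an
  indecomposable projective module \<open>P\<close> is local, hence \<open>P\<close> is cyclic with all proper submodules in \<open>J P\<close>, and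
  all its submodules are of the form \<open>v\<^sup>i P\<close>. So \<open>H\<close> is a Nakayama algebra.

  If \<open>m \<ge> 2\<close> on some side, then \<open>dim J / J\<^sup>2 \<ge> 2 n\<close>. A functional \<open>\<phi>\<close> on \<open>H\<close> that vanishes on \<open>J\<^sup>2\<close> generates a
  submodule of the dual of \<open>H\<close>, and isomorphic such modules only allow for a family of functionals on
  \<open>J / J\<^sup>2\<close> with \<open>2 n - 1\<close> parameters. As modules of bounded dimension are sums of boundedly many
  indecomposable ones, there are infinitely many of the latter.

  Conversely, over a Nakayama algebra an indecomposable module \<open>M\<close> is a quotient of some \<open>H e\<close> with \<open>e\<close> a
  primitive idempotent: take generators \<open>m\<^sub>i = e\<^sub>i m\<^sub>i\<close> of \<open>M\<close> with annihilators as large as possible. In a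
  nontrivial relation \<open>\<Sum> c\<^sub>i m\<^sub>i = 0\<close> with all \<open>c\<^sub>i\<close> in one \<open>f H\<close>, the right ideals \<open>c\<^sub>i H\<close> form a chain, so
  \<open>c\<^sub>i = c\<^sub>1 b\<^sub>i\<close> for a suitable numbering, and adding \<open>b\<^sub>i m\<^sub>i\<close> for all \<open>i \<noteq> 1\<close> to
  \<open>m\<^sub>1\<close> enlarges its annihilator.\<close>

section \<open>Polynomial maps and curves\<close>

text \<open>Why m = 2 is the threshold: an isomorphism relates two functionals on J / J^2 through
  coefficients \<beta>_j \<gamma>_l with j, l < n, that is through 2 n numbers, with \<beta> and
  \<gamma> free to be rescaled by c and 1 / c. The remaining 2 n - 1 parameters cannot fill 2 n
  dimensions, whereas m = 1 offers only n. In place of dimension theory for images of polynomial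
  maps, this is tested on one curve with very sparse exponents, where counting monomials suffices;
  its points come from the field being infinite. The quotients A and J / J^2 are never formed:
  statements about them are congruences in H, and the Hopf ideal condition becomes a test on
  bilinear maps. One argument serves both sides, since reversing product and coproduct together
  keeps S as antipode; likewise most lemmas on modules are proved for a multiplication that is the
  given one or its opposite. Modules occur in several ambient groups (the dual of H, free modules,
  \<open>nat \<Rightarrow>\<^sub>0 'k\<close>), so their size is measured by strictly monotone
  functions on submodules.\<close>

definition fun_scale :: "'k::field \<Rightarrow> ('a \<Rightarrow> 'k) \<Rightarrow> ('a \<Rightarrow> 'k)" where
  "fun_scale c f = (\<lambda>x. c * f x)"

lemma fun_scale_apply [simp]: "fun_scale c f x = c * f x"
  by (simp add: fun_scale_def)

interpretation fun_space: vector_space "fun_scale :: 'k::field \<Rightarrow> ('a \<Rightarrow> 'k) \<Rightarrow> ('a \<Rightarrow> 'k)"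
  by standard (auto simp: fun_eq_iff algebra_simps)

lemma sum_fun_apply: "(\<Sum>i\<in>I. f i) x = (\<Sum>i\<in>I. f i x)" for f :: "'i \<Rightarrow> 'a \<Rightarrow> 'b::comm_monoid_add"
  by (induction I rule: infinite_finite_induct) auto

text \<open>The index \<open>a\<close> ranges over sample points and \<open>w a\<close> is the point
  itself: polynomials are functions on samples, so that linear algebra of functions replaces formal
  polynomials. \<open>E\<close> bounds the exponent of each variable, not the total degree; this
  gives the count (E + 1)^|V|, and the bounds add under products.\<close>

definition monomials :: "'v set \<Rightarrow> ('a \<Rightarrow> 'v \<Rightarrow> 'k::field) \<Rightarrow> nat \<Rightarrow> ('a \<Rightarrow> 'k) set" where
  "monomials V w E = (\<lambda>f a. \<Prod>j\<in>V. w a j ^ f j) ` (V \<rightarrow>\<^sub>E {..E})"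

lemma monomials_memI:
  assumes "\<And>j. j \<in> V \<Longrightarrow> f j \<le> E"
  shows "(\<lambda>a. \<Prod>j\<in>V. w a j ^ f j) \<in> monomials V w E"
  unfolding monomials_def
  by (rule image_eqI[of _ _ "restrict f V"]) (use assms in \<open>auto intro!: prod.cong simp: fun_eq_iff\<close>)

lemma card_monomials:
  assumes "finite V"
  shows "finite (monomials V w E)" "card (monomials V w E) \<le> Suc E ^ card V"
proof -
  have fin: "finite (V \<rightarrow>\<^sub>E {..E})" using assms by (intro finite_PiE) auto
  then show "finite (monomials V w E)" unfolding monomials_def by simp
  have "card (V \<rightarrow>\<^sub>E {..E}) = Suc E ^ card V"
    using assms by (simp add: card_PiE)
  then show "card (monomials V w E) \<le> Suc E ^ card V"
    unfolding monomials_def using card_image_le[OF fin] by metis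
qed

definition polys :: "'v set \<Rightarrow> ('a \<Rightarrow> 'v \<Rightarrow> 'k::field) \<Rightarrow> nat \<Rightarrow> ('a \<Rightarrow> 'k) set" where
  "polys V w E = fun_space.span (monomials V w E)"

lemma monomials_mult:
  assumes "g \<in> monomials V w E" "h \<in> monomials V w E'"
  shows "(\<lambda>a. g a * h a) \<in> monomials V w (E + E')"
proof -
  obtain p q where p: "p \<in> V \<rightarrow>\<^sub>E {..E}" "g = (\<lambda>a. \<Prod>j\<in>V. w a j ^ p j)"
    and q: "q \<in> V \<rightarrow>\<^sub>E {..E'}" "h = (\<lambda>a. \<Prod>j\<in>V. w a j ^ q j)"
    using assms unfolding monomials_def by blast
  have "(\<lambda>a. \<Prod>j\<in>V. w a j ^ (p j + q j)) \<in> monomials V w (E + E')"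
    using p(1) q(1) by (intro monomials_memI) (auto simp: PiE_iff intro!: add_mono)
  then show ?thesis unfolding p q by (simp add: power_add prod.distrib)
qed

lemma polys_closed:
  shows polys_zero: "(\<lambda>a. 0) \<in> polys V w E"
    and polys_add: "g \<in> polys V w E \<Longrightarrow> h \<in> polys V w E \<Longrightarrow> (\<lambda>a. g a + h a) \<in> polys V w E"
    and polys_scale: "g \<in> polys V w E \<Longrightarrow> (\<lambda>a. c * g a) \<in> polys V w E"
  using fun_space.span_zero[of "monomials V w E"] fun_space.span_add[of g "monomials V w E" h]
    fun_space.span_scale[of g "monomials V w E" c]
  by (simp_all only: polys_def plus_fun_def zero_fun_def fun_scale_def)

lemma polys_sum: "(\<And>i. i \<in> I \<Longrightarrow> g i \<in> polys V w E) \<Longrightarrow> (\<lambda>a. \<Sum>i\<in>I. g i a) \<in> polys V w E"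
  by (induction I rule: infinite_finite_induct) (auto intro: polys_zero polys_add)

lemma polys_induct [consumes 1, case_names zero add scale monomial]:
  assumes "g \<in> polys V w E"
    and "P (\<lambda>a. 0)" "\<And>g h. P g \<Longrightarrow> P h \<Longrightarrow> P (\<lambda>a. g a + h a)" "\<And>c g. P g \<Longrightarrow> P (\<lambda>a. c * g a)"
    and "\<And>g. g \<in> monomials V w E \<Longrightarrow> P g"
  shows "P g"
  using assms(1) unfolding polys_def
  by (rule fun_space.span_induct)
    (use assms(2-) in \<open>simp_all only: fun_space.subspace_def plus_fun_def zero_fun_def fun_scale_def mem_Collect_eq, simp\<close>)

lemma polys_mult:
  assumes g: "g \<in> polys V w E" and h: "h \<in> polys V w E'"
  shows "(\<lambda>a. g a * h a) \<in> polys V w (E + E')"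
proof -
  have mono: "(\<lambda>a. g' a * h a) \<in> polys V w (E + E')" if g': "g' \<in> monomials V w E" for g'
    using h
  proof (induction rule: polys_induct)
    case (monomial f)
    then show ?case
      unfolding polys_def by (intro fun_space.span_base monomials_mult[OF g'])
  qed (auto simp: distrib_left mult.left_commute intro: polys_closed)
  show ?thesis
    using g
  proof (induction rule: polys_induct)
    case (monomial f)
    then show ?case by (rule mono)
  qed (auto simp: distrib_right mult.assoc intro: polys_closed)
qed

lemma polys_mono: "E \<le> E' \<Longrightarrow> polys V w E \<subseteq> polys V w E'"
  unfolding polys_def monomials_def by (intro fun_space.span_mono image_mono PiE_mono) auto

lemma polys_one: "(\<lambda>a. 1) \<in> polys V w 0"
  using monomials_memI[of V "\<lambda>_. 0" 0 w] unfolding polys_def by (auto intro: fun_space.span_base)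

lemma polys_power: "g \<in> polys V w E \<Longrightarrow> (\<lambda>a. g a ^ e) \<in> polys V w (e * E)"
  by (induction e) (auto simp: polys_one intro: polys_mult)

text \<open>Write r in base D with k digits: the digit at position i contributes at most the power D
  - 1 of \<tau>^(D^i), which has degree 1. The degrees add up to k (D - 1), although r may be almost
  D^k.\<close>

lemma power_polys:
  assumes Q: "\<And>i. i < N \<Longrightarrow> (\<lambda>a. \<tau> a ^ (D ^ i)) \<in> polys V w 1" and D: "D > 0"
  shows "k \<le> N \<Longrightarrow> r < D ^ k \<Longrightarrow> (\<lambda>a. \<tau> a ^ r) \<in> polys V w (k * (D - 1))"
proof (induction k arbitrary: r)
  case 0
  then show ?case by (simp add: polys_one)
next
  case (Suc k)
  let ?q = "r div D ^ k" and ?m = "r mod D ^ k"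
  have q: "?q \<le> D - 1"
  proof -
    have "?q < D" using Suc.prems D by (simp add: less_mult_imp_div_less)
    then show ?thesis by simp
  qed
  have "(\<lambda>a. (\<tau> a ^ (D ^ k)) ^ ?q) \<in> polys V w (?q * 1)"
    using Suc.prems by (intro polys_power Q) auto
  then have 1: "(\<lambda>a. (\<tau> a ^ (D ^ k)) ^ ?q) \<in> polys V w (D - 1)"
    using polys_mono q by fastforce
  have 2: "(\<lambda>a. \<tau> a ^ ?m) \<in> polys V w (k * (D - 1))"
    using Suc D by simp
  have "(\<lambda>a. (\<tau> a ^ (D ^ k)) ^ ?q * \<tau> a ^ ?m) \<in> polys V w (D - 1 + k * (D - 1))"
    by (rule polys_mult[OF 1 2])
  moreover have "(\<tau> a ^ (D ^ k)) ^ ?q * \<tau> a ^ ?m = \<tau> a ^ r" for a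
    by (simp add: power_mult[symmetric] power_add[symmetric])
  ultimately show ?case by simp
qed

text \<open>A linear relation is a polynomial with the infinitely many roots \<tau> a. Injectivity
  is recorded too, since the independent set could otherwise have fewer than R members.\<close>

lemma independent_powers:
  assumes "inj (\<tau> :: nat \<Rightarrow> 'k::field)"
  shows "fun_space.independent ((\<lambda>r a. \<tau> a ^ r) ` {..<R})" (is "fun_space.independent (?F ` _)")
    and "inj_on (\<lambda>r a. \<tau> a ^ r) {..<R}"
proof -
  have zero: "c r = 0" if "\<And>a. (\<Sum>r<R. c r * \<tau> a ^ r) = 0" and "r < R" for c r
  proof -
    define p where "p = (\<Sum>r<R. monom (c r) r)"
    have "poly p (\<tau> a) = 0" for a
      using that(1)[of a] by (simp add: p_def poly_sum poly_monom)
    then have "range \<tau> \<subseteq> {x. poly p x = 0}" by auto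
    moreover have "infinite (range \<tau>)" using assms by (simp add: range_inj_infinite)
    ultimately have "p = 0" using poly_roots_finite finite_subset by blast
    then have "coeff p r = 0" by simp
    moreover have "coeff p r = c r"
      using that(2) by (simp add: p_def coeff_sum)
    ultimately show ?thesis by simp
  qed
  show inj: "inj_on ?F {..<R}"
  proof (rule inj_onI, rule ccontr)
    fix r s assume rs: "r \<in> {..<R}" "s \<in> {..<R}" "?F r = ?F s" "r \<noteq> s"
    let ?c = "\<lambda>i. if i = r then 1 else if i = s then -1 else (0::'k)"
    have "(\<Sum>i<R. ?c i * \<tau> a ^ i) = 0" for a
    proof -
      have "(\<Sum>i<R. ?c i * \<tau> a ^ i) = (\<Sum>i\<in>{r,s}. ?c i * \<tau> a ^ i)"
        using rs by (intro sum.mono_neutral_right) auto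
      also have "\<dots> = 0" using rs fun_cong[OF rs(3), of a] by simp
      finally show ?thesis .
    qed
    from zero[OF this, of r] rs show False by simp
  qed
  show "fun_space.independent (?F ` {..<R})"
  proof (rule fun_space.independent_if_scalars_zero)
    fix f x assume s: "(\<Sum>x\<in>?F ` {..<R}. fun_scale (f x) x) = 0" and x: "x \<in> ?F ` {..<R}"
    have "(\<Sum>r<R. fun_scale (f (?F r)) (?F r)) = 0"
      using s by (simp add: sum.reindex[OF inj])
    then have "(\<Sum>r<R. f (?F r) * \<tau> a ^ r) = 0" for a
      by (auto simp: fun_eq_iff sum_fun_apply)
    from zero[OF this] x show "f x = 0" by auto
  qed simp
qed

text \<open>The numbers \<open>t ^ r\<close> with \<open>r < D ^ N\<close> are the values at \<open>t\<close> of the monomials with exponents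
  below \<open>D\<close> on the curve \<open>t \<mapsto> (t ^ (D ^ i))\<^sub>i\<close>; for large \<open>D\<close> there are more of them than monomials
  in fewer than \<open>N\<close> variables of the degrees in question. Hence no polynomial map from a space of
  dimension less than \<open>N\<close> covers infinitely many points of the curve.\<close>

theorem curve_not_covered:
  assumes "inj (\<tau> :: nat \<Rightarrow> 'k::field)" "finite V" "card V < N" "N ^ (N - 1) < D"
    and Q: "\<And>i. i < N \<Longrightarrow> (\<lambda>a. \<tau> a ^ (D ^ i)) \<in> polys V w 1"
  shows False
proof -
  have D: "D > 0" and N: "N > 0" using assms by auto
  let ?F = "\<lambda>r a. \<tau> a ^ r" and ?M = "monomials V w (N * (D - 1))"
  have "?F ` {..<D ^ N} \<subseteq> fun_space.span ?M"
    using power_polys[OF Q D, of N] by (auto simp: polys_def)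
  then have "card (?F ` {..<D ^ N}) \<le> card ?M"
    using fun_space.independent_span_bound card_monomials(1)[OF assms(2)] independent_powers(1)[OF assms(1)]
    by blast
  then have "D ^ N \<le> card ?M"
    using independent_powers(2)[OF assms(1)] by (simp add: card_image)
  also have "\<dots> \<le> Suc (N * (D - 1)) ^ card V"
    by (rule card_monomials(2)[OF assms(2)])
  also have "\<dots> \<le> Suc (N * (D - 1)) ^ (N - 1)"
    using assms(3) by (intro power_increasing) auto
  \<comment> \<open>As N (D - 1) + 1 \<le> N D, there are at most N^(N-1) D^(N-1) monomials; the
    assumption on D pushes this below D^N.\<close>
  also have "\<dots> \<le> (N * D) ^ (N - 1)"
    using N D by (intro power_mono) (cases D; auto)+
  also have "\<dots> = N ^ (N - 1) * D ^ (N - 1)" by (simp add: power_mult_distrib)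
  also have "\<dots> < D * D ^ (N - 1)" using assms(4) D by simp
  also have "\<dots> = D ^ N" using N by (simp add: power_eq_if)
  finally show False by simp
qed

section \<open>Sweedler sums\<close>

text \<open>\<open>cm x\<close> lists the terms of one representative of the comultiplication of x,
  with scalars absorbed. Only for bilinear \<open>f\<close> is the value independent of that choice,
  hence the linearity conditions in the axioms below.\<close>

definition sweedler_sum :: "('h \<Rightarrow> ('h \<times> 'h) list) \<Rightarrow> ('h \<Rightarrow> 'h \<Rightarrow> 'b::ab_group_add) \<Rightarrow> 'h \<Rightarrow> 'b" where
  "sweedler_sum cm f x = (\<Sum>(a, b)\<leftarrow>cm x. f a b)"

abbreviation linear_on :: "('k::field \<Rightarrow> 'h::ab_group_add \<Rightarrow> 'h) \<Rightarrow> ('h \<Rightarrow> 'h) \<Rightarrow> bool" where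
  "linear_on scale f \<equiv> Vector_Spaces.linear scale scale f"

abbreviation functional_on :: "('k::field \<Rightarrow> 'h::ab_group_add \<Rightarrow> 'h) \<Rightarrow> ('h \<Rightarrow> 'k) \<Rightarrow> bool" where
  "functional_on scale f \<equiv> Vector_Spaces.linear scale (*) f"

definition bilinear_on :: "('k::field \<Rightarrow> 'h::ab_group_add \<Rightarrow> 'h) \<Rightarrow> ('h \<Rightarrow> 'h \<Rightarrow> 'h) \<Rightarrow> bool" where
  "bilinear_on scale f \<longleftrightarrow> (\<forall>b. linear_on scale (\<lambda>a. f a b)) \<and> (\<forall>a. linear_on scale (\<lambda>b. f a b))"

definition trilinear_on :: "('k::field \<Rightarrow> 'h::ab_group_add \<Rightarrow> 'h) \<Rightarrow> ('h \<Rightarrow> 'h \<Rightarrow> 'h \<Rightarrow> 'h) \<Rightarrow> bool" where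
  "trilinear_on scale f \<longleftrightarrow> (\<forall>b c. linear_on scale (\<lambda>a. f a b c)) \<and>
     (\<forall>a c. linear_on scale (\<lambda>b. f a b c)) \<and> (\<forall>a b. linear_on scale (\<lambda>c. f a b c))"

lemma vector_space_field: "vector_space ((*) :: 'k::field \<Rightarrow> 'k \<Rightarrow> 'k)"
  by standard (auto simp: algebra_simps)

lemma functionalD:
  assumes "functional_on scale w"
  shows "w (x + y) = w x + w y" "w (scale c x) = c * w x" "w 0 = 0" "w (x - y) = w x - w y"
    "w (- x) = - w x" "w (sum h I) = (\<Sum>i\<in>I. w (h i))"
  using assms
  by (simp_all add: linear_iff_module_hom module_hom.add module_hom.scale module_hom.zero module_hom.diff
      module_hom.neg module_hom.sum)

lemma sweedler_sum_swap:
  "sweedler_sum cm (\<lambda>a b. sweedler_sum cm (\<lambda>c d. F a b c d) y) x =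
   sweedler_sum cm (\<lambda>c d. sweedler_sum cm (\<lambda>a b. F a b c d) x) y"
proof -
  have "(\<Sum>(a, b)\<leftarrow>xs. \<Sum>(c, d)\<leftarrow>ys. F a b c d) = (\<Sum>(c, d)\<leftarrow>ys. \<Sum>(a, b)\<leftarrow>xs. F a b c d)" for xs ys
    by (induction xs) (auto simp: sum_list_addf split_def)
  then show ?thesis by (simp add: sweedler_sum_def)
qed

lemma sweedler_sum_hom:
  assumes "T 0 = 0" "\<And>x y. T (x + y) = T x + T y"
  shows "T (sweedler_sum cm f x) = sweedler_sum cm (\<lambda>a b. T (f a b)) x"
proof -
  have "T (\<Sum>(a, b)\<leftarrow>xs. f a b) = (\<Sum>(a, b)\<leftarrow>xs. T (f a b))" for xs
    by (induction xs) (auto simp: assms)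
  then show ?thesis by (simp add: sweedler_sum_def)
qed

lemma sweedler_sum_add:
  "sweedler_sum cm (\<lambda>a b. f a b + g a b) x = sweedler_sum cm f x + sweedler_sum cm g x"
  by (simp add: sweedler_sum_def split_def sum_list_addf)

lemma sweedler_sum_diff:
  "sweedler_sum cm (\<lambda>a b. f a b - g a b) x = sweedler_sum cm f x - sweedler_sum cm g x"
  by (simp add: sweedler_sum_def split_def sum_list_subtractf)

lemma sweedler_sum_0 [simp]: "sweedler_sum cm (\<lambda>a b. 0) x = 0"
  by (simp add: sweedler_sum_def split_def)

lemma sweedler_sum_sum:
  "sweedler_sum cm (\<lambda>a b. \<Sum>i\<in>I. F i a b) x = (\<Sum>i\<in>I. sweedler_sum cm (F i) x)"
  by (induction I rule: infinite_finite_induct) (auto simp: sweedler_sum_add)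

text \<open>The axioms are symmetric under reversing both the multiplication and the comultiplication;
  this is why the multiplication is a parameter and \<open>cm\<close> only enters through
  \<open>sweedler_sum cm f x = \<Sum> f x\<^sub>1 x\<^sub>2\<close>. The family \<open>e\<close>, \<open>\<alpha>\<close> is a basis of \<open>H / J\<close> with its dual basis.\<close>

locale hopf_sweedler = vector_space scale
  for scale :: "'k::field \<Rightarrow> 'h::ring_1 \<Rightarrow> 'h" +
  fixes mul :: "'h \<Rightarrow> 'h \<Rightarrow> 'h" (infixl "\<odot>" 70)
    and cm :: "'h \<Rightarrow> ('h \<times> 'h) list"
    and \<epsilon> :: "'h \<Rightarrow> 'k"
    and S :: "'h \<Rightarrow> 'h"
    and J :: "'h set"
    and n :: nat
    and e :: "nat \<Rightarrow> 'h"
    and \<alpha> :: "nat \<Rightarrow> 'h \<Rightarrow> 'k"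
  assumes mul_assoc: "(x \<odot> y) \<odot> z = x \<odot> (y \<odot> z)"
    and mul_one: "1 \<odot> x = x" "x \<odot> 1 = x"
    and mul_linear: "linear_on scale (\<lambda>x. x \<odot> y)" "linear_on scale (\<lambda>x. y \<odot> x)"
    and comult_linear: "bilinear_on scale f \<Longrightarrow> linear_on scale (sweedler_sum cm f)"
    and comult_mul: "bilinear_on scale f \<Longrightarrow> sweedler_sum cm f (x \<odot> y) =
      sweedler_sum cm (\<lambda>a b. sweedler_sum cm (\<lambda>c d. f (a \<odot> c) (b \<odot> d)) y) x"
    and coassoc: "trilinear_on scale g \<Longrightarrow>
      sweedler_sum cm (\<lambda>a b. sweedler_sum cm (\<lambda>c d. g c d b) a) x =
      sweedler_sum cm (\<lambda>a b. sweedler_sum cm (\<lambda>c d. g a c d) b) x"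
    and counit_functional: "functional_on scale \<epsilon>"
    and counit_mul: "\<epsilon> (x \<odot> y) = \<epsilon> x * \<epsilon> y"
    and counit_one: "\<epsilon> 1 = 1"
    and counit: "sweedler_sum cm (\<lambda>a b. scale (\<epsilon> a) b) x = x" "sweedler_sum cm (\<lambda>a b. scale (\<epsilon> b) a) x = x"
    and antipode_linear: "linear_on scale S"
    and antipode: "sweedler_sum cm (\<lambda>a b. S a \<odot> b) x = scale (\<epsilon> x) 1"
      "sweedler_sum cm (\<lambda>a b. a \<odot> S b) x = scale (\<epsilon> x) 1"
    and J_subspace: "subspace J"
    and J_mul: "x \<in> J \<Longrightarrow> x \<odot> y \<in> J" "x \<in> J \<Longrightarrow> y \<odot> x \<in> J"
    and J_counit: "x \<in> J \<Longrightarrow> \<epsilon> x = 0"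
    and J_antipode: "x \<in> J \<Longrightarrow> S x \<in> J"
    and J_comult: "x \<in> J \<Longrightarrow> bilinear_on scale f \<Longrightarrow> subspace U \<Longrightarrow> (\<And>a b. a \<in> J \<Longrightarrow> f a b \<in> U) \<Longrightarrow>
      (\<And>a b. b \<in> J \<Longrightarrow> f a b \<in> U) \<Longrightarrow> sweedler_sum cm f x \<in> U"
    and \<alpha>_functional: "functional_on scale (\<alpha> j)"
    and \<alpha>_J: "x \<in> J \<Longrightarrow> \<alpha> j x = 0"
    and \<alpha>_e: "i < n \<Longrightarrow> j < n \<Longrightarrow> \<alpha> i (e j) = (if i = j then 1 else 0)"
    and e_span: "x - (\<Sum>j<n. scale (\<alpha> j x) (e j)) \<in> J"
begin

abbreviation "sw \<equiv> sweedler_sum cm"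
abbreviation "lin \<equiv> linear_on scale"

lemma linD: "lin f \<Longrightarrow> f (x + y) = f x + f y" "lin f \<Longrightarrow> f (scale c x) = scale c (f x)" "lin f \<Longrightarrow> f 0 = 0"
  "lin f \<Longrightarrow> f (x - y) = f x - f y" "lin f \<Longrightarrow> f (sum h I) = (\<Sum>i\<in>I. f (h i))"
  by (simp_all add: linear_iff_module_hom module_hom.add module_hom.scale module_hom.zero
      module_hom.diff module_hom.sum)

lemma linI: "(\<And>x y. f (x + y) = f x + f y) \<Longrightarrow> (\<And>c x. f (scale c x) = scale c (f x)) \<Longrightarrow> lin f"
  by (simp add: Vector_Spaces.linear_iff vector_space_axioms)

lemma lin_id: "lin (\<lambda>x. x)" by (rule linI) auto
lemma lin_mul1: "lin f \<Longrightarrow> lin (\<lambda>x. f x \<odot> c)"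
  by (rule linI) (auto simp: linD linD[OF mul_linear(1)])
lemma lin_mul2: "lin f \<Longrightarrow> lin (\<lambda>x. c \<odot> f x)"
  by (rule linI) (auto simp: linD linD[OF mul_linear(2)])
lemma lin_S: "lin f \<Longrightarrow> lin (\<lambda>x. S (f x))"
  by (rule linI) (auto simp: linD linD[OF antipode_linear])
lemma lin_scale: "lin f \<Longrightarrow> lin (\<lambda>x. scale c (f x))"
  by (rule linI) (auto simp: linD scale_right_distrib mult.commute)
lemma lin_functional: "functional_on scale w \<Longrightarrow> lin f \<Longrightarrow> lin (\<lambda>x. scale (w (f x)) z)"
  by (rule linI) (auto simp: linD functionalD scale_left_distrib)
lemma lin_diff: "lin f \<Longrightarrow> lin g \<Longrightarrow> lin (\<lambda>x. f x - g x)"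
  by (rule linI) (auto simp: linD scale_right_diff_distrib)
lemma lin_sum: "(\<And>i. lin (\<lambda>x. f i x)) \<Longrightarrow> lin (\<lambda>x. \<Sum>i\<in>I. f i x)"
  by (rule linI) (auto simp: linD sum.distrib scale_sum_right)
lemma lin_sw: assumes "\<And>a b. lin (\<lambda>x. F x a b)" shows "lin (\<lambda>x. sw (F x) y)"
proof (rule linI)
  fix x x' show "sw (F (x + x')) y = sw (F x) y + sw (F x') y"
  proof -
    have "F (x + x') = (\<lambda>a b. F x a b + F x' a b)"
      by (auto simp: fun_eq_iff linD(1)[OF assms])
    then show ?thesis by (simp add: sweedler_sum_add)
  qed
next
  fix c x
  have "sw (\<lambda>a b. scale c (F x a b)) y = scale c (sw (F x) y)"
    by (rule sweedler_sum_hom[symmetric]) (auto simp: scale_right_distrib)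
  moreover have "F (scale c x) = (\<lambda>a b. scale c (F x a b))"
    by (auto simp: fun_eq_iff linD(2)[OF assms])
  ultimately show "sw (F (scale c x)) y = scale c (sw (F x) y)" by simp
qed
lemma lin_sw_arg: "bilinear_on scale f \<Longrightarrow> lin g \<Longrightarrow> lin (\<lambda>x. sw f (g x))"
  by (rule linI) (auto simp: linD linD[OF comult_linear])

lemmas bilI = bilinear_on_def[THEN iffD2, OF conjI, OF allI allI]
lemmas triI = trilinear_on_def[THEN iffD2, OF conjI, OF _ conjI, OF allI[OF allI] allI[OF allI] allI[OF allI]]

lemmas lin_intros = lin_id lin_mul1 lin_mul2 lin_S lin_functional[OF counit_functional]
  lin_functional[OF \<alpha>_functional] lin_scale lin_diff lin_sum lin_sw lin_sw_arg bilI triI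

lemma sw_hom: "lin T \<Longrightarrow> sw (\<lambda>a b. T (f a b)) x = T (sw f x)"
  by (rule sweedler_sum_hom[symmetric]) (auto simp: linD)

lemma sw_mem: assumes "subspace U" "\<And>a b. f a b \<in> U" shows "sw f x \<in> U"
proof -
  have "(\<Sum>(a, b)\<leftarrow>xs. f a b) \<in> U" for xs
    by (induction xs) (auto simp: assms subspace_0 subspace_add)
  then show ?thesis by (simp add: sweedler_sum_def)
qed

text \<open>S(x y) and S(y) S(x) are both convolution inverse to the multiplication H (x) H -> H.
  \<open>?L\<close> is the triple product S(x1 y1) x2 y2 S(y3) S(x3), evaluated by bracketing it in
  the two possible ways.\<close>

lemma S_mul: "S (x \<odot> y) = S y \<odot> S x"
proof -
  let ?L = "sw (\<lambda>a b. sw (\<lambda>c d. sw (\<lambda>p q. sw (\<lambda>r t. S (a \<odot> c) \<odot> ((p \<odot> r) \<odot> (S t \<odot> S q))) d) b) y) x"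
  have 1: "sw (\<lambda>r t. S u \<odot> ((p \<odot> r) \<odot> (S t \<odot> S q))) d = scale (\<epsilon> d) (S u \<odot> (p \<odot> S q))" for u p q d
    using sw_hom[of "\<lambda>z. S u \<odot> (p \<odot> (z \<odot> S q))" "\<lambda>r t. r \<odot> S t" d]
    by (simp add: lin_intros antipode mul_assoc mul_one linD[OF mul_linear(1)] linD[OF mul_linear(2)])
  have 2: "sw (\<lambda>p q. scale k (S u \<odot> (p \<odot> S q))) b = scale k (scale (\<epsilon> b) (S u))" for k u b
    using sw_hom[of "\<lambda>z. scale k (S u \<odot> z)" "\<lambda>r t. r \<odot> S t" b]
    by (simp add: lin_intros antipode mul_assoc mul_one linD[OF mul_linear(2)])
  have 3: "sw (\<lambda>c d. scale (\<epsilon> d) (scale k (S (a \<odot> c)))) y = scale k (S (a \<odot> y))" for k a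
    using sw_hom[of "\<lambda>z. scale k (S (a \<odot> z))" "\<lambda>c d. scale (\<epsilon> d) c" y]
    by (simp add: lin_intros counit linD[OF mul_linear(2)] linD[OF antipode_linear] scale_left_commute mult.commute)
  have 4: "sw (\<lambda>a b. scale (\<epsilon> b) (S (a \<odot> y))) x = S (x \<odot> y)"
    using sw_hom[of "\<lambda>z. S (z \<odot> y)" "\<lambda>c d. scale (\<epsilon> d) c" x]
    by (simp add: lin_intros counit linD[OF mul_linear(1)] linD[OF antipode_linear])
  have "?L = S (x \<odot> y)"
    by (simp only: 1 2 3 4)
  moreover have "?L = S y \<odot> S x"
  proof -
    \<comment> \<open>Coassociativity, used for y and then for x, brings S(x1 y1) and x2 y2
      together; by \<open>comult_mul\<close> they form the convolution of S and the identity at x y,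
      which is \<epsilon>(x) \<epsilon>(y).\<close>
    have "?L = sw (\<lambda>a b. sw (\<lambda>p q. sw (\<lambda>c d. sw (\<lambda>r t. S (a \<odot> c) \<odot> ((p \<odot> r) \<odot> (S t \<odot> S q))) d) y) b) x"
      by (subst sweedler_sum_swap) (rule refl)
    also have "\<dots> = sw (\<lambda>a b. sw (\<lambda>p q. sw (\<lambda>c d. sw (\<lambda>r t. S (a \<odot> r) \<odot> ((p \<odot> t) \<odot> (S d \<odot> S q))) c) y) b) x"
      by (subst coassoc[of "\<lambda>c r t. S (_ \<odot> c) \<odot> ((_ \<odot> r) \<odot> (S t \<odot> S _))", symmetric])
        (intro lin_intros, rule refl)
    also have "\<dots> = sw (\<lambda>a b. sw (\<lambda>p q. sw (\<lambda>c d. sw (\<lambda>r t. S (p \<odot> r) \<odot> ((q \<odot> t) \<odot> (S d \<odot> S b))) c) y) a) x"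
      by (rule coassoc[of "\<lambda>a p q. sw (\<lambda>c d. sw (\<lambda>r t. S (a \<odot> r) \<odot> ((p \<odot> t) \<odot> (S d \<odot> S q))) c) y", symmetric])
        (intro lin_intros)
    also have "\<dots> = sw (\<lambda>a b. sw (\<lambda>c d. sw (\<lambda>p q. sw (\<lambda>r t. S (p \<odot> r) \<odot> ((q \<odot> t) \<odot> (S d \<odot> S b))) c) a) y) x"
      by (subst (2) sweedler_sum_swap) (rule refl)
    also have "\<dots> = sw (\<lambda>a b. sw (\<lambda>c d. scale (\<epsilon> a * \<epsilon> c) (S d \<odot> S b)) y) x"
    proof -
      have "sw (\<lambda>p q. sw (\<lambda>r t. S (p \<odot> r) \<odot> ((q \<odot> t) \<odot> z)) c) a = scale (\<epsilon> a * \<epsilon> c) z" for a c z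
      proof -
        have "sw (\<lambda>p q. sw (\<lambda>r t. S (p \<odot> r) \<odot> ((q \<odot> t) \<odot> z)) c) a = sw (\<lambda>u v. S u \<odot> (v \<odot> z)) (a \<odot> c)"
          by (rule comult_mul[symmetric]) (intro lin_intros)
        also have "\<dots> = sw (\<lambda>u v. S u \<odot> v) (a \<odot> c) \<odot> z"
          using sw_hom[of "\<lambda>w. w \<odot> z" "\<lambda>u v. S u \<odot> v"] by (simp add: lin_intros mul_assoc)
        finally show ?thesis
          by (simp add: antipode counit_mul linD[OF mul_linear(1)] mul_one)
      qed
      then show ?thesis by simp
    qed
    also have "\<dots> = sw (\<lambda>a b. scale (\<epsilon> a) (S y \<odot> S b)) x"
    proof -
      have "sw (\<lambda>c d. scale (k * \<epsilon> c) (S d \<odot> z)) y = scale k (S y \<odot> z)" for k z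
        using sw_hom[of "\<lambda>w. scale k (S w \<odot> z)" "\<lambda>c d. scale (\<epsilon> c) d" y]
        by (simp add: lin_intros counit linD[OF mul_linear(1)] linD[OF antipode_linear])
      then show ?thesis by simp
    qed
    also have "\<dots> = S y \<odot> S x"
      using sw_hom[of "\<lambda>w. S y \<odot> S w" "\<lambda>c d. scale (\<epsilon> c) d" x]
      by (simp add: lin_intros counit linD[OF mul_linear(2)] linD[OF antipode_linear])
    finally show ?thesis .
  qed
  ultimately show ?thesis by simp
qed
end

section \<open>The radical of a Hopf algebra modulo its square\<close>

context hopf_sweedler begin

definition J_square where "J_square = span {x \<odot> y | x y. x \<in> J \<and> y \<in> J}"
definition J_aug where "J_aug = span {x \<odot> h | x h. x \<in> J \<and> \<epsilon> h = 0}"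
definition sec where "sec x = (\<Sum>j<n. scale (\<alpha> j x) (e j))"
definition coinv where "coinv x = sw (\<lambda>a b. a \<odot> S (sec b)) x"
text \<open>The usual action x1 w(x2) of the dual algebra. For w = \<alpha> j it extracts the j-th
  coefficient of the coaction of A on J / J^2.\<close>

definition hit where "hit w x = sw (\<lambda>a b. scale (w b) a) x"

text \<open>On \<open>J / J\<^sup>2\<close>, \<open>coinv\<close> is the projection \<open>x \<mapsto> x\<^sub>0 S(x\<^sub>1)\<close> of a Hopf module onto its coinvariants. The
  coaction of \<open>J / J\<^sup>2\<close> sees the second tensor factor only modulo \<open>J\<close>, which is the role of \<open>sec\<close>; without it,
  the sum would be \<open>\<epsilon> x\<close>.\<close>

lemma lin_sec: "lin f \<Longrightarrow> lin (\<lambda>x. sec (f x))"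
  unfolding sec_def by (intro lin_intros)

lemma lin_coinv: "lin f \<Longrightarrow> lin (\<lambda>x. coinv (f x))"
  unfolding coinv_def by (intro lin_intros lin_sec)

lemma lin_hit: "functional_on scale w \<Longrightarrow> lin f \<Longrightarrow> lin (\<lambda>x. hit w (f x))"
  unfolding hit_def by (intro lin_intros lin_functional[of w])

lemmas lin_intros' = lin_intros lin_sec lin_coinv

lemma sec_J: "x \<in> J \<Longrightarrow> sec x = 0"
  by (simp add: sec_def \<alpha>_J)

lemma sub_sec: "x - sec x \<in> J" "S x - S (sec x) \<in> J"
  using e_span[of x] J_antipode[of "x - sec x"] by (simp_all add: sec_def linD[OF antipode_linear])

lemma J_square_subspace: "subspace J_square" and J_aug_subspace: "subspace J_aug"
  by (simp_all add: J_square_def J_aug_def subspace_span)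

lemma J_squareI: "x \<in> J \<Longrightarrow> y \<in> J \<Longrightarrow> x \<odot> y \<in> J_square"
  unfolding J_square_def by (rule span_base) blast

lemma J_augI: "x \<in> J \<Longrightarrow> \<epsilon> y = 0 \<Longrightarrow> x \<odot> y \<in> J_aug"
  unfolding J_aug_def by (rule span_base) blast

lemma lin_span_mem:
  assumes "lin f" "subspace U" "z \<in> span B" "\<And>x. x \<in> B \<Longrightarrow> f x \<in> U"
  shows "f z \<in> U"
  using assms(3)
proof (induction rule: span_induct_alt)
  case base
  then show ?case by (simp add: linD[OF assms(1)] subspace_0[OF assms(2)])
next
  case (step c x y)
  then show ?case
    by (simp add: linD[OF assms(1)] subspace_add[OF assms(2)] subspace_scale[OF assms(2)] assms(4))
qed

lemma J_square_mul: "z \<in> J_square \<Longrightarrow> z \<odot> y \<in> J_square"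
proof (rule lin_span_mem[of "\<lambda>z. z \<odot> y", OF _ J_square_subspace])
  show "lin (\<lambda>z. z \<odot> y)" by (intro lin_intros)
  fix z assume "z \<in> {x \<odot> y | x y. x \<in> J \<and> y \<in> J}"
  then show "z \<odot> y \<in> J_square" using J_squareI J_mul(1) mul_assoc by auto
qed (simp add: J_square_def)

text \<open>\<open>J_comult\<close> is the inclusion of the comultiplication of J in J (x) H + H (x)
  J, used as a test: terms with left factor in J stay in J, and those with right factor in J are
  killed by w.\<close>

lemma hit_J: "functional_on scale w \<Longrightarrow> (\<And>x. x \<in> J \<Longrightarrow> w x = 0) \<Longrightarrow> x \<in> J \<Longrightarrow> hit w x \<in> J"
  unfolding hit_def
proof (rule J_comult[OF _ _ J_subspace])
  assume w: "functional_on scale w"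
  show "bilinear_on scale (\<lambda>a b. scale (w b) a)" by (intro lin_intros lin_functional[OF w])
qed (simp_all add: subspace_scale[OF J_subspace] subspace_0[OF J_subspace])

lemma coinv_J: "x \<in> J \<Longrightarrow> coinv x \<in> J"
  unfolding coinv_def
proof (rule J_comult[OF _ _ J_subspace])
  show "bilinear_on scale (\<lambda>a b. a \<odot> S (sec b))" by (intro lin_intros')
qed (simp_all add: sec_J J_mul(1) linD[OF antipode_linear] linD[OF mul_linear(2)] subspace_0[OF J_subspace])

lemma coinv_expand: "sw (\<lambda>a b. coinv a \<odot> sec b) x = (\<Sum>j<n. coinv (hit (\<alpha> j) x) \<odot> e j)"
proof -
  have "sw (\<lambda>a b. coinv a \<odot> sec b) x = (\<Sum>j<n. sw (\<lambda>a b. coinv (scale (\<alpha> j b) a) \<odot> e j) x)"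
    unfolding sec_def
    by (simp add: sweedler_sum_sum[symmetric] linD[OF mul_linear(2)] linD[OF mul_linear(1)]
        linD[OF lin_coinv[OF lin_id]])
  also have "\<dots> = (\<Sum>j<n. coinv (hit (\<alpha> j) x) \<odot> e j)"
    unfolding hit_def using sw_hom[of "\<lambda>z. coinv z \<odot> e _"] by (simp add: lin_intros')
  finally show ?thesis .
qed

text \<open>In a Hopf module x = x0 S(x1) x2. Here the last two legs pass through
  \<open>sec\<close>, and the error consists of terms a (\<epsilon>(b) 1 - g(b)) whose bracket lies
  in J: they are in J^2 if a is in J, and zero if b is in J.\<close>

lemma coinvariant_decomposition:
  assumes x: "x \<in> J"
  shows "x - (\<Sum>j<n. coinv (hit (\<alpha> j) x) \<odot> e j) \<in> J_square"
proof -
  let ?g = "\<lambda>b. sw (\<lambda>c d. S (sec c) \<odot> sec d) b"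
  let ?f = "\<lambda>a b. scale (\<epsilon> b) a - a \<odot> ?g b"
  have g_J: "?g b = 0" if "b \<in> J" for b
  proof -
    have "?g b \<in> {0}"
      by (rule J_comult[OF that])
        (auto intro!: lin_intros' subspace_single_0 simp: sec_J linD[OF antipode_linear]
          linD[OF mul_linear(1)] linD[OF mul_linear(2)])
    then show ?thesis by simp
  qed
  have g: "scale (\<epsilon> b) 1 - ?g b \<in> J" for b
  proof -
    have "S c \<odot> d - S (sec c) \<odot> sec d \<in> J" for c d
    proof -
      have "S c \<odot> d - S (sec c) \<odot> sec d = (S c - S (sec c)) \<odot> d + S (sec c) \<odot> (d - sec d)"
        by (simp add: linD[OF mul_linear(1)] linD[OF mul_linear(2)])
      then show ?thesis
        using subspace_add[OF J_subspace J_mul(1)[OF sub_sec(2), of c d] J_mul(2)[OF sub_sec(1), of "S (sec c)" d]]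
        by simp
    qed
    then have "sw (\<lambda>c d. S c \<odot> d - S (sec c) \<odot> sec d) b \<in> J"
      by (rule sw_mem[OF J_subspace])
    then show ?thesis by (simp add: sweedler_sum_diff antipode)
  qed
  have "sw ?f x \<in> J_square"
  proof (rule J_comult[OF x _ J_square_subspace])
    show "bilinear_on scale ?f" by (intro lin_intros')
  next
    fix a b assume "a \<in> J"
    moreover have "?f a b = a \<odot> (scale (\<epsilon> b) 1 - ?g b)"
      by (simp add: linD[OF mul_linear(2)] mul_one)
    ultimately show "?f a b \<in> J_square" using g J_squareI by simp
  next
    fix a b assume "b \<in> J"
    then show "?f a b \<in> J_square"
      by (simp add: J_counit g_J linD[OF mul_linear(2)] subspace_0[OF J_square_subspace])
  qed
  also have "sw ?f x = x - sw (\<lambda>a b. a \<odot> ?g b) x"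
    by (simp add: sweedler_sum_diff counit)
  also have "sw (\<lambda>a b. a \<odot> ?g b) x = sw (\<lambda>a b. sw (\<lambda>c d. a \<odot> (S (sec c) \<odot> sec d)) b) x"
    using sw_hom[of "\<lambda>z. _ \<odot> z" "\<lambda>c d. S (sec c) \<odot> sec d"] by (simp add: lin_intros')
  also have "\<dots> = sw (\<lambda>a b. sw (\<lambda>c d. c \<odot> (S (sec d) \<odot> sec b)) a) x"
    by (rule coassoc[symmetric]) (intro lin_intros')
  also have "\<dots> = sw (\<lambda>a b. coinv a \<odot> sec b) x"
    unfolding coinv_def using sw_hom[of "\<lambda>z. z \<odot> sec _" "\<lambda>c d. c \<odot> S (sec d)"]
    by (simp add: lin_intros' mul_assoc)
  finally show ?thesis by (simp only: coinv_expand)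
qed

text \<open>As S is antimultiplicative, coinv(x h) = x1 h1 S(h2) S(x2) = \<epsilon>(h) coinv(x) up
  to J^2. So \<open>coinv\<close> depends only on the class in J / J H^+.\<close>

lemma coinv_J_aug: "z \<in> J_aug \<Longrightarrow> coinv z \<in> J_square"
proof (rule lin_span_mem[of coinv, OF _ J_square_subspace])
  show "lin coinv" using lin_coinv[OF lin_id] .
  fix z assume "z \<in> {x \<odot> h | x h. x \<in> J \<and> \<epsilon> h = 0}"
  then obtain x h where z: "z = x \<odot> h" and x: "x \<in> J" and h: "\<epsilon> h = 0" by blast
  let ?f = "\<lambda>a b. sw (\<lambda>c d. (a \<odot> c) \<odot> S (sec (b \<odot> d))) h"
  have "coinv z = sw ?f x"
    unfolding coinv_def z by (rule comult_mul) (intro lin_intros')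
  also have "sw ?f x \<in> J_square"
  proof (rule J_comult[OF x _ J_square_subspace])
    show "bilinear_on scale ?f" by (intro lin_intros')
  next
    fix a b assume a: "a \<in> J"
    have "sw (\<lambda>c d. (a \<odot> c) \<odot> S (b \<odot> d) - (a \<odot> c) \<odot> S (sec (b \<odot> d))) h \<in> J_square"
    proof (rule sw_mem[OF J_square_subspace])
      fix c d
      show "(a \<odot> c) \<odot> S (b \<odot> d) - (a \<odot> c) \<odot> S (sec (b \<odot> d)) \<in> J_square"
        using J_squareI[OF J_mul(1)[OF a, of c] sub_sec(2)[of "b \<odot> d"]] by (simp add: linD[OF mul_linear(2)])
    qed
    moreover have "sw (\<lambda>c d. (a \<odot> c) \<odot> S (b \<odot> d)) h = 0"
      using sw_hom[of "\<lambda>z. a \<odot> (z \<odot> S b)" "\<lambda>c d. c \<odot> S d" h]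
      by (simp add: lin_intros' S_mul mul_assoc antipode h linD[OF mul_linear(1)] linD[OF mul_linear(2)])
    ultimately have "- ?f a b \<in> J_square" by (simp add: sweedler_sum_diff)
    then show "?f a b \<in> J_square" using subspace_neg[OF J_square_subspace] by fastforce
  next
    fix a b assume "b \<in> J"
    then show "?f a b \<in> J_square"
      by (simp add: J_mul sec_J linD[OF antipode_linear] linD[OF mul_linear(2)] subspace_0[OF J_square_subspace])
  qed
  finally show "coinv z \<in> J_square" .
qed (auto simp: J_aug_def)

text \<open>Modulo J H^+ all coefficients \<open>hit (\<alpha> j) x\<close> are multiples c_j v.
  Hence \<open>coinv\<close> sends them to c_j coinv(v), and the decomposition of x collapses to
  coinv(v) times the sum of the c_j e_j.\<close>

lemma J_one_generator:
  assumes v: "v \<in> J" and gen: "\<And>x. x \<in> J \<Longrightarrow> \<exists>c. x - scale c v \<in> J_aug" and x: "x \<in> J"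
  shows "\<exists>h. x - coinv v \<odot> h \<in> J_square"
proof -
  have "\<forall>j. \<exists>c. hit (\<alpha> j) x - scale c v \<in> J_aug"
    using gen hit_J[OF \<alpha>_functional \<alpha>_J x] by blast
  then obtain c where c: "hit (\<alpha> j) x - scale (c j) v \<in> J_aug" for j by metis
  let ?h = "\<Sum>j<n. scale (c j) (e j)"
  have "coinv (hit (\<alpha> j) x) - scale (c j) (coinv v) \<in> J_square" for j
    using coinv_J_aug[OF c[of j]] by (simp add: linD[OF lin_coinv[OF lin_id]])
  then have "(coinv (hit (\<alpha> j) x) - scale (c j) (coinv v)) \<odot> e j \<in> J_square" for j
    by (rule J_square_mul)
  then have "(\<Sum>j<n. (coinv (hit (\<alpha> j) x) - scale (c j) (coinv v)) \<odot> e j) \<in> J_square"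
    by (intro subspace_sum[OF J_square_subspace]) auto
  moreover have "(\<Sum>j<n. (coinv (hit (\<alpha> j) x) - scale (c j) (coinv v)) \<odot> e j) =
      (\<Sum>j<n. coinv (hit (\<alpha> j) x) \<odot> e j) - coinv v \<odot> ?h"
    by (simp add: linD[OF mul_linear(1)] linD[OF mul_linear(2)] sum_subtractf)
  ultimately have "(x - (\<Sum>j<n. coinv (hit (\<alpha> j) x) \<odot> e j)) + ((\<Sum>j<n. coinv (hit (\<alpha> j) x) \<odot> e j) - coinv v \<odot> ?h) \<in> J_square"
    using coinvariant_decomposition[OF x] by (intro subspace_add[OF J_square_subspace]) simp_all
  then show ?thesis by (intro exI[of _ ?h]) simp
qed

text \<open>Expanding gives z1 a1 w(z2 a2). For z1 in J, the factor a1 may be replaced by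
  \<epsilon>(a1) modulo J H^+, and the counit axiom recombines a; for z2 in J both sides vanish,
  because w kills J.\<close>

lemma hit_mul:
  assumes w: "functional_on scale w" and wJ: "\<And>x. x \<in> J \<Longrightarrow> w x = 0" and z: "z \<in> J"
  shows "hit w (z \<odot> a) - sw (\<lambda>p q. scale (w (q \<odot> a)) p) z \<in> J_aug"
proof -
  let ?f = "\<lambda>p q. sw (\<lambda>c d. scale (w (q \<odot> d)) (p \<odot> c)) a - scale (w (q \<odot> a)) p"
  have "sw ?f z \<in> J_aug"
  proof (rule J_comult[OF z _ J_aug_subspace])
    show "bilinear_on scale ?f" by (intro lin_intros' lin_functional[OF w])
  next
    fix p q assume p: "p \<in> J"
    have "scale (w (q \<odot> a)) p = sw (\<lambda>c d. scale (w (q \<odot> d)) (scale (\<epsilon> c) p)) a"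
      using sw_hom[of "\<lambda>d. scale (w (q \<odot> d)) p" "\<lambda>c d. scale (\<epsilon> c) d" a]
      by (simp add: lin_intros' lin_functional[OF w] counit linD[OF mul_linear(2)] functionalD[OF w] mult.commute)
    then have "?f p q = sw (\<lambda>c d. scale (w (q \<odot> d)) (p \<odot> (c - scale (\<epsilon> c) 1))) a"
      by (simp add: sweedler_sum_diff[symmetric] linD[OF mul_linear(2)] mul_one scale_right_diff_distrib)
    also have "\<dots> \<in> J_aug"
      by (rule sw_mem[OF J_aug_subspace])
        (auto intro!: subspace_scale[OF J_aug_subspace] J_augI p
          simp: functionalD[OF counit_functional] counit_one)
    finally show "?f p q \<in> J_aug" .
  next
    fix p q assume "q \<in> J"
    then show "?f p q \<in> J_aug" by (simp add: wJ J_mul subspace_0[OF J_aug_subspace])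
  qed
  also have "sw ?f z = hit w (z \<odot> a) - sw (\<lambda>p q. scale (w (q \<odot> a)) p) z"
    unfolding hit_def sweedler_sum_diff
    by (subst comult_mul) (intro lin_intros' lin_functional[OF w], rule refl)
  finally show ?thesis .
qed

lemma hit_J_square:
  assumes w: "functional_on scale w" and wJ: "\<And>x. x \<in> J \<Longrightarrow> w x = 0" and z: "z \<in> J_square"
  shows "hit w z \<in> J_aug"
proof (rule lin_span_mem[of "hit w", OF _ J_aug_subspace])
  show "lin (hit w)" using lin_hit[OF w lin_id] .
  show "z \<in> span {x \<odot> y | x y. x \<in> J \<and> y \<in> J}" using z by (simp add: J_square_def)
  fix z assume "z \<in> {x \<odot> y | x y. x \<in> J \<and> y \<in> J}"
  then obtain x y where z: "z = x \<odot> y" "x \<in> J" "y \<in> J" by blast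
  then have "w (q \<odot> y) = 0" for q by (auto intro: wJ J_mul)
  then show "hit w z \<in> J_aug" using hit_mul[OF w wJ z(2), of y] z by simp
qed

text \<open>As coinv(x) a = x1 S(x2) a, contraction with w gives x1 w(x2 S(x3) a) = w(a) x. So the
  map from (J / J H^+) (x) A to J / J^2 given by coinv(x) a is injective, which yields the lower
  bound on dim J / J^2.\<close>

lemma hit_dual:
  assumes w: "functional_on scale w" and wJ: "\<And>x. x \<in> J \<Longrightarrow> w x = 0" and x: "x \<in> J"
  shows "hit w (coinv x \<odot> a) - scale (w a) x \<in> J_aug"
proof -
  let ?z = "\<lambda>j. hit (\<alpha> j) x" and ?b = "\<lambda>j. S (e j) \<odot> a"
  let ?g = "\<lambda>p q r. scale (w (q \<odot> (S (sec r) \<odot> a))) p"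
  have "coinv x = (\<Sum>j<n. ?z j \<odot> S (e j))"
  proof -
    have "coinv x = (\<Sum>j<n. sw (\<lambda>p q. scale (\<alpha> j q) p \<odot> S (e j)) x)"
      unfolding coinv_def sec_def
      by (simp add: sweedler_sum_sum[symmetric] linD[OF mul_linear(2)] linD[OF mul_linear(1)]
          linD[OF antipode_linear])
    also have "\<dots> = (\<Sum>j<n. ?z j \<odot> S (e j))"
      unfolding hit_def using sw_hom[of "\<lambda>z. z \<odot> S (e _)"] by (simp add: lin_intros')
    finally show ?thesis .
  qed
  then have Px: "coinv x \<odot> a = (\<Sum>j<n. ?z j \<odot> ?b j)"
    by (simp add: linD[OF mul_linear(1)] mul_assoc)
  have "(\<Sum>j<n. hit w (?z j \<odot> ?b j) - sw (\<lambda>p q. scale (w (q \<odot> ?b j)) p) (?z j)) \<in> J_aug"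
    by (intro subspace_sum[OF J_aug_subspace] hit_mul w wJ hit_J \<alpha>_functional \<alpha>_J x)
  moreover have "(\<Sum>j<n. sw (\<lambda>u v. scale (w (v \<odot> ?b j)) u) (?z j)) = scale (w a) x"
  proof -
    have "(\<Sum>j<n. sw (\<lambda>u v. scale (w (v \<odot> ?b j)) u) (?z j)) =
        (\<Sum>j<n. sw (\<lambda>p q. sw (\<lambda>u v. scale (w (v \<odot> ?b j)) u) (scale (\<alpha> j q) p)) x)"
      unfolding hit_def
      by (intro sum.cong refl sw_hom[of "sw (\<lambda>u v. scale (w (v \<odot> ?b _)) u)", symmetric]
          lin_intros' lin_functional[OF w])
    also have "\<dots> = sw (\<lambda>p q. sw (\<lambda>u v. ?g u v q) p) x"
    proof -
      have "(\<Sum>j<n. sw (\<lambda>u v. scale (w (v \<odot> ?b j)) u) (scale (\<alpha> j q) p)) = sw (\<lambda>u v. ?g u v q) p" for p q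
      proof -
        have "lin (sw (\<lambda>u v. scale (w (v \<odot> ?b j)) u))" for j
          using lin_sw_arg[OF _ lin_id] by (intro lin_intros' lin_functional[OF w])
        then have "(\<Sum>j<n. sw (\<lambda>u v. scale (w (v \<odot> ?b j)) u) (scale (\<alpha> j q) p)) =
            (\<Sum>j<n. scale (\<alpha> j q) (sw (\<lambda>u v. scale (w (v \<odot> ?b j)) u) p))"
          by (simp add: linD)
        also have "\<dots> = (\<Sum>j<n. sw (\<lambda>u v. scale (w (v \<odot> (S (scale (\<alpha> j q) (e j)) \<odot> a))) u) p)"
          using sw_hom[OF lin_scale[OF lin_id]]
          by (simp add: linD[OF antipode_linear] linD[OF mul_linear(1)] linD[OF mul_linear(2)]
              functionalD[OF w] sw_hom[OF lin_scale[OF lin_id], symmetric])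
        also have "\<dots> = sw (\<lambda>u v. \<Sum>j<n. scale (w (v \<odot> (S (scale (\<alpha> j q) (e j)) \<odot> a))) u) p"
          by (simp add: sweedler_sum_sum)
        also have "\<dots> = sw (\<lambda>u v. ?g u v q) p"
        proof -
          have "lin (\<lambda>t. scale (w (v \<odot> (S t \<odot> a))) u)" for u v
            by (intro lin_intros' lin_functional[OF w])
          then have "(\<Sum>j<n. scale (w (v \<odot> (S (scale (\<alpha> j q) (e j)) \<odot> a))) u) = ?g u v q" for u v
            unfolding sec_def by (rule linD(5)[symmetric])
          then show ?thesis by simp
        qed
        finally show ?thesis .
      qed
      then show ?thesis by (simp add: sweedler_sum_sum[symmetric])
    qed
    also have "\<dots> = sw (\<lambda>p q. sw (\<lambda>u v. ?g p u v) q) x"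
      by (rule coassoc) (intro lin_intros' lin_functional[OF w])
    also have "\<dots> = sw (\<lambda>p q. scale (w a) (scale (\<epsilon> q) p)) x"
    proof -
      have "sw (\<lambda>u v. ?g p u v) q = scale (w a) (scale (\<epsilon> q) p)" for p q
      proof -
        \<comment> \<open>\<open>w\<close> factors through H / J, so \<open>sec\<close> may be
          dropped before the antipode axiom is applied.\<close>
        have "sw (\<lambda>u v. u \<odot> (S v \<odot> a) - u \<odot> (S (sec v) \<odot> a)) q \<in> J"
        proof (rule sw_mem[OF J_subspace])
          fix u v
          show "u \<odot> (S v \<odot> a) - u \<odot> (S (sec v) \<odot> a) \<in> J"
            using J_mul(2)[OF J_mul(1)[OF sub_sec(2)]]
            by (simp add: linD[OF mul_linear(1)] linD[OF mul_linear(2)])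
        qed
        from wJ[OF this] have "w (sw (\<lambda>u v. u \<odot> (S (sec v) \<odot> a)) q) = w (sw (\<lambda>u v. u \<odot> (S v \<odot> a)) q)"
          by (simp add: sweedler_sum_diff functionalD(4)[OF w])
        also have "sw (\<lambda>u v. u \<odot> (S v \<odot> a)) q = scale (\<epsilon> q) a"
          using sw_hom[of "\<lambda>z. z \<odot> a" "\<lambda>u v. u \<odot> S v" q]
          by (simp add: lin_intros' mul_assoc antipode linD[OF mul_linear(1)] mul_one)
        finally show ?thesis
          using sw_hom[of "\<lambda>z. scale (w z) p" "\<lambda>u v. u \<odot> (S (sec v) \<odot> a)" q]
          by (simp add: lin_intros' lin_functional[OF w] functionalD[OF w] mult.commute)
      qed
      then show ?thesis by simp
    qed
    also have "\<dots> = scale (w a) x"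
      using sw_hom[of "scale (w a)" "\<lambda>p q. scale (\<epsilon> q) p" x]
      by (simp only: lin_scale[OF lin_id] counit)
    finally show ?thesis .
  qed
  ultimately show ?thesis
    using Px by (simp add: sum_subtractf linD[OF lin_hit[OF w lin_id]])
qed

text \<open>The alternatives are m \<le> 1 and m \<ge> 2. The second is expressed by functionals
  dual to 2 n elements, the form in which the size of J / J^2 is used later.\<close>

theorem radical_dichotomy:
  "(\<exists>v\<in>J. \<forall>x\<in>J. \<exists>h. x - v \<odot> h \<in> J_square) \<or>
   (\<exists>\<phi> y. \<forall>i<2 * n. functional_on scale (\<phi> i) \<and> y i \<in> J \<and> (\<forall>x\<in>J_square. \<phi> i x = 0) \<and>
      (\<forall>j<2 * n. \<phi> i (y j) = (if i = j then 1 else 0)))"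
proof (cases "\<exists>v\<in>J. \<forall>x\<in>J. \<exists>c. x - scale c v \<in> J_aug")
  case True
  then obtain v where v: "v \<in> J" "\<And>x. x \<in> J \<Longrightarrow> \<exists>c. x - scale c v \<in> J_aug" by blast
  then show ?thesis using J_one_generator[OF v] coinv_J[OF v(1)] by blast
next
  case False
  have no_gen: "\<exists>x\<in>J. \<forall>c. x - scale c v \<notin> J_aug" if "v \<in> J" for v
    using False that by blast
  \<comment> \<open>That neither 0 nor then x1 generates J modulo J H^+ yields two elements
    independent there.\<close>
  obtain x1 where x1: "x1 \<in> J" "x1 \<notin> J_aug"
    using no_gen[OF subspace_0[OF J_subspace]] by auto
  obtain x2 where x2: "x2 \<in> J" and "\<forall>c. x2 - scale c x1 \<notin> J_aug"
    using no_gen[OF x1(1)] by (rule bexE)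
  then have x2_aug: "x2 - scale c x1 \<notin> J_aug" for c by simp
  obtain B where B: "B \<subseteq> J_aug" "independent B" "J_aug \<subseteq> span B"
    by (rule basis_exists)
  have spanB: "span B = J_aug"
    by (intro equalityI B(3) span_minimal[OF B(1) J_aug_subspace])
  have i1: "independent (insert x1 B)"
    using x1(2) spanB by (intro independent_insertI[OF _ B(2)]) simp
  have "x2 \<notin> span (insert x1 B)"
    using x2_aug spanB by (simp add: span_insert)
  then have i2: "independent (insert x2 (insert x1 B))"
    using i1 by (rule independent_insertI)
  interpret k: vector_space_pair scale "(*) :: 'k \<Rightarrow> 'k \<Rightarrow> 'k"
    unfolding vector_space_pair_def using vector_space_axioms vector_space_field by blast
  have x12: "x1 \<noteq> x2" "x1 \<notin> B" "x2 \<notin> B"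
    using x1 x2_aug[of 1] x2_aug[of 0] B(1) subspace_0[OF J_aug_subspace] by auto
  obtain w1 where w1: "functional_on scale w1" "\<forall>x\<in>insert x2 (insert x1 B). w1 x = (if x = x1 then 1 else 0)"
    using k.linear_independent_extend[OF i2, of "\<lambda>x. if x = x1 then 1 else 0"] by blast
  obtain w2 where w2: "functional_on scale w2" "\<forall>x\<in>insert x2 (insert x1 B). w2 x = (if x = x2 then 1 else 0)"
    using k.linear_independent_extend[OF i2, of "\<lambda>x. if x = x2 then 1 else 0"] by blast
  have vanish: "w x = 0" if "functional_on scale w" "\<And>b. b \<in> B \<Longrightarrow> w b = 0" "x \<in> J_aug" for w x
  proof -
    have "x \<in> span B" using that(3) spanB by simp
    then show ?thesis
      by (induction rule: span_induct_alt) (simp_all add: functionalD[OF that(1)] that(2))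
  qed
  have w1_aug: "w1 x = 0" if "x \<in> J_aug" for x by (rule vanish[OF w1(1) _ that]) (use w1(2) x12 in auto)
  have w2_aug: "w2 x = 0" if "x \<in> J_aug" for x by (rule vanish[OF w2(1) _ that]) (use w2(2) x12 in auto)
  \<comment> \<open>An index i < 2 n encodes a pair: whether i < n selects one of the two
    independent elements, and i mod n selects a basis element of A. By \<open>hit_dual\<close>, w
    applied to \<open>hit (\<alpha> j)\<close> takes the value \<alpha>_j(a) w(x) at coinv(x)
    a.\<close>
  define \<phi> where "\<phi> i = (\<lambda>x. (if i < n then w1 else w2) (hit (\<alpha> (i mod n)) x))" for i
  define y where "y i = coinv (if i < n then x1 else x2) \<odot> e (i mod n)" for i
  have comp: "functional_on scale (\<lambda>x. w (hit (\<alpha> j) x))" if "functional_on scale w" for w j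
    using Vector_Spaces.linear_compose[OF lin_hit[OF \<alpha>_functional lin_id] that] by (simp add: comp_def)
  have val: "w (hit (\<alpha> j) (coinv x \<odot> a)) = \<alpha> j a * w x"
    if "functional_on scale w" "\<And>x. x \<in> J_aug \<Longrightarrow> w x = 0" "x \<in> J" for w j x a
    using that(2)[OF hit_dual[OF \<alpha>_functional \<alpha>_J that(3), of j a]] by (simp add: functionalD[OF that(1)])
  have "\<phi> i (y j) = (if i = j then 1 else 0)" if "i < 2 * n" "j < 2 * n" for i j
  proof -
    have "i mod n < n" "j mod n < n" using that by auto
    then have *: "\<alpha> (i mod n) (e (j mod n)) = (if i mod n = j mod n then 1 else 0)" by (rule \<alpha>_e)
    have "(if i < n then w1 else w2) (if j < n then x1 else x2) = (if i < n \<longleftrightarrow> j < n then 1 else 0)"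
      using w1(2) w2(2) x12 by auto
    moreover have "i = j \<longleftrightarrow> (i mod n = j mod n \<and> (i < n \<longleftrightarrow> j < n))"
    proof -
      have "k mod n = (if k < n then k else k - n)" if "k < 2 * n" for k
        using that by (simp add: le_mod_geq)
      then show ?thesis using that by auto
    qed
    ultimately show ?thesis
      using val[of "if i < n then w1 else w2" "if j < n then x1 else x2" "i mod n" "e (j mod n)"]
        w1(1) w2(1) w1_aug w2_aug x1(1) x2
      by (simp add: \<phi>_def y_def * split: if_splits)
  qed
  moreover have "functional_on scale (\<phi> i)" for i
    using comp[OF w1(1)] comp[OF w2(1)] by (auto simp: \<phi>_def)
  moreover have "y i \<in> J" for i
    using x1 x2 by (auto simp: y_def intro: J_mul coinv_J)
  moreover have "\<phi> i x = 0" if "x \<in> J_square" for i x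
    using hit_J_square[OF \<alpha>_functional \<alpha>_J that] w1_aug w2_aug by (simp add: \<phi>_def)
  ultimately show ?thesis by blast
qed

end

section \<open>Sweedler sums in a Hopf algebra\<close>

lemma lin_ext_superset:
  assumes "vector_space s" "finite A" "Poly_Mapping.keys p \<subseteq> A"
  shows "lin_ext s f p = (\<Sum>x\<in>A. s (Poly_Mapping.lookup p x) (f x))"
proof -
  interpret vector_space s by (rule assms(1))
  show ?thesis unfolding lin_ext_def
    by (rule sum.mono_neutral_left) (use assms in \<open>auto simp: in_keys_iff\<close>)
qed

lemma lin_ext_linear:
  fixes s :: "'a::field \<Rightarrow> 'b::ab_group_add \<Rightarrow> 'b" and f :: "'c \<Rightarrow> 'b"
  assumes "vector_space s"
  shows "Vector_Spaces.linear free_scale s (lin_ext s f)"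
proof -
  interpret vector_space s by (rule assms)
  show ?thesis
  proof (unfold Vector_Spaces.linear_iff, intro conjI allI)
    show "vector_space (free_scale :: 'a \<Rightarrow> ('c \<Rightarrow>\<^sub>0 'a) \<Rightarrow> _)" by (rule vector_space_free_scale)
    fix p q :: "'c \<Rightarrow>\<^sub>0 'a"
    let ?A = "Poly_Mapping.keys p \<union> Poly_Mapping.keys q"
    show "lin_ext s f (p + q) = lin_ext s f p + lin_ext s f q"
      using keys_add[of p q]
      by (subst (1 2 3) lin_ext_superset[OF assms, of ?A])
        (auto simp: lookup_add scale_left_distrib sum.distrib)
  next
    fix c and p :: "'c \<Rightarrow>\<^sub>0 'a"
    have "Poly_Mapping.keys (free_scale c p) \<subseteq> Poly_Mapping.keys p" by (auto simp: in_keys_iff)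
    then show "lin_ext s f (free_scale c p) = s c (lin_ext s f p)"
      by (subst (1 2) lin_ext_superset[OF assms, of "Poly_Mapping.keys p"]) (auto simp: scale_sum_right)
  qed (rule assms)
qed

lemma lin_ext_simps:
  assumes "vector_space s"
  shows "lin_ext s f (p + q) = lin_ext s f p + lin_ext s f q"
    and "lin_ext s f (p - q) = lin_ext s f p - lin_ext s f q"
    and "lin_ext s f (free_scale c p) = s c (lin_ext s f p)"
  using lin_ext_linear[OF assms, of f]
  by (simp_all add: linear_iff_module_hom module_hom.add module_hom.diff module_hom.scale)

lemma lin_ext_single:
  assumes "vector_space s"
  shows "lin_ext s f (Poly_Mapping.single x c) = s c (f x)"
proof -
  interpret vector_space s by (rule assms)
  show ?thesis by (simp add: lin_ext_superset[OF assms, of "{x}"])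
qed

lemma lin_ext_hom:
  assumes "Vector_Spaces.linear s t T"
  shows "T (lin_ext s f p) = lin_ext t (\<lambda>x. T (f x)) p"
  using assms by (simp add: lin_ext_def linear_iff_module_hom module_hom.sum module_hom.scale)

text \<open>Bilinear maps factor through the tensor square: each defining relation is sent to
  0.\<close>

lemma lin_ext_tensor2_null:
  fixes scale :: "'k::field \<Rightarrow> 'h::ab_group_add \<Rightarrow> 'h"
  assumes "vector_space scale" "bilinear_on scale f" "p \<in> tensor2_null scale"
  shows "lin_ext scale (\<lambda>(a, b). f a b) p = 0"
proof -
  interpret vector_space scale by (rule assms(1))
  interpret free: vector_space "free_scale :: 'k \<Rightarrow> ('h \<times> 'h \<Rightarrow>\<^sub>0 'k) \<Rightarrow> _" by (rule vector_space_free_scale)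
  note simps = lin_ext_simps[OF assms(1)] lin_ext_single[OF assms(1)]
  have f: "f (x + y) b = f x b + f y b" "f b (x + y) = f b x + f b y"
    "f (scale c x) b = scale c (f x b)" "f b (scale c x) = scale c (f b x)" for x y b c
    using assms(2) by (simp_all add: bilinear_on_def Vector_Spaces.linear_iff)
  have "tensor2_null scale \<subseteq> {p. lin_ext scale (\<lambda>(a, b). f a b) p = 0}"
    unfolding tensor2_null_def
    by (rule free.span_minimal) (auto simp: simps f free.subspace_def lin_ext_def[of _ _ 0])
  then show ?thesis using assms(3) by blast
qed

lemma lin_ext_tensor3_null:
  fixes scale :: "'k::field \<Rightarrow> 'h::ab_group_add \<Rightarrow> 'h"
  assumes "vector_space scale" "trilinear_on scale f" "p \<in> tensor3_null scale"
  shows "lin_ext scale (\<lambda>(a, b, c). f a b c) p = 0"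
proof -
  interpret vector_space scale by (rule assms(1))
  interpret free: vector_space "free_scale :: 'k \<Rightarrow> ('h \<times> 'h \<times> 'h \<Rightarrow>\<^sub>0 'k) \<Rightarrow> _" by (rule vector_space_free_scale)
  note simps = lin_ext_simps[OF assms(1)] lin_ext_single[OF assms(1)]
  have f: "f (x + y) b d = f x b d + f y b d" "f b (x + y) d = f b x d + f b y d" "f b d (x + y) = f b d x + f b d y"
    "f (scale c x) b d = scale c (f x b d)" "f b (scale c x) d = scale c (f b x d)"
    "f b d (scale c x) = scale c (f b d x)" for x y b c d
    using assms(2) by (simp_all add: trilinear_on_def Vector_Spaces.linear_iff)
  have "tensor3_null scale \<subseteq> {p. lin_ext scale (\<lambda>(a, b, c). f a b c) p = 0}"
    unfolding tensor3_null_def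
    by (rule free.span_minimal) (auto simp: simps f free.subspace_def lin_ext_def[of _ _ 0])
  then show ?thesis using assms(3) by blast
qed

lemma sweedler_sum_cop:
  "sweedler_sum (\<lambda>x. map prod.swap (cm x)) f x = sweedler_sum cm (\<lambda>a b. f b a) x"
  by (simp add: sweedler_sum_def comp_def split_def)

lemma bilinear_on_cop: "bilinear_on scale f \<Longrightarrow> bilinear_on scale (\<lambda>a b. f b a)"
  by (simp add: bilinear_on_def)

lemma trilinear_on_rev: "trilinear_on scale f \<Longrightarrow> trilinear_on scale (\<lambda>a b c. f c b a)"
  by (simp add: trilinear_on_def)

context hopf_sweedler begin

text \<open>Reversing both structures exchanges the two antipode axioms, so the same S serves;
  reversing only one would call for its inverse. This transfers all results of the locale to the
  other side.\<close>

lemma op_cop: "hopf_sweedler scale (\<lambda>x y. y \<odot> x) (\<lambda>x. map prod.swap (cm x)) \<epsilon> S J n e \<alpha>"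
proof (intro hopf_sweedler.intro hopf_sweedler_axioms.intro vector_space_axioms, goal_cases)
  case (6 f)
  from comult_linear[OF bilinear_on_cop[OF this]] show ?case
    by (simp add: sweedler_sum_cop[abs_def])
next
  case (7 f x y)
  from comult_mul[OF bilinear_on_cop[OF this], of y x] show ?case
    by (simp add: sweedler_sum_cop sweedler_sum_swap[of _ _ y x])
next
  case (8 g x)
  from coassoc[OF trilinear_on_rev[OF this], of x] show ?case
    by (simp add: sweedler_sum_cop)
next
  case (22 x f U)
  from J_comult[OF this(1) bilinear_on_cop[OF this(2)] this(3)] this(4,5) show ?case
    by (simp add: sweedler_sum_cop)
qed (simp_all add: sweedler_sum_cop mul_assoc mul_one mul_linear counit_functional counit_mul counit_one
    counit antipode_linear antipode J_subspace J_mul J_counit J_antipode \<alpha>_functional \<alpha>_J \<alpha>_e e_span)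

end

section \<open>From the tensor-valued comultiplication to Sweedler sums\<close>

context hopf_algebra begin

definition comult_rep :: "'h \<Rightarrow> ('h \<times> 'h) \<Rightarrow>\<^sub>0 'k" where
  "comult_rep x = (SOME p. p \<in> \<Delta> x)"

text \<open>The scalar of each term is moved into its left factor, so that a list of pairs suffices;
  by \<open>lin_ext_comult\<close> the choices made here do not affect bilinear sums.\<close>

definition comult_list :: "'h \<Rightarrow> ('h \<times> 'h) list" where
  "comult_list x = map (\<lambda>(a, b). (scale (Poly_Mapping.lookup (comult_rep x) (a, b)) a, b))
     (SOME xs. distinct xs \<and> set xs = Poly_Mapping.keys (comult_rep x))"

lemma equiv_tensor2_rel: "equiv UNIV (tensor2_rel scale)"
proof -
  interpret free: vector_space "free_scale :: 'k \<Rightarrow> ('h \<times> 'h \<Rightarrow>\<^sub>0 'k) \<Rightarrow> _" by (rule vector_space_free_scale)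
  have sub: "free.subspace (tensor2_null scale)" by (simp add: tensor2_null_def)
  show ?thesis
  proof (intro equivI)
    show "refl_on UNIV (tensor2_rel scale)"
      by (simp add: refl_on_def tensor2_rel_def free.subspace_0[OF sub])
    show "sym (tensor2_rel scale)"
      using free.subspace_neg[OF sub] by (fastforce simp: sym_def tensor2_rel_def)
    show "trans (tensor2_rel scale)"
    proof (rule transI)
      fix x y z assume "(x, y) \<in> tensor2_rel scale" "(y, z) \<in> tensor2_rel scale"
      then show "(x, z) \<in> tensor2_rel scale"
        using free.subspace_add[OF sub, of "x - y" "y - z"] by (simp add: tensor2_rel_def)
    qed
  qed simp
qed

lemma comult_rep: "comult_rep x \<in> \<Delta> x"
  unfolding comult_rep_def
  using in_quotient_imp_non_empty[OF equiv_tensor2_rel comult_tensor[of x]] by (simp add: some_in_eq)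

lemma lin_ext_comult:
  assumes f: "bilinear_on scale f" and p: "p \<in> \<Delta> x"
  shows "lin_ext scale (\<lambda>(a, b). f a b) p = sweedler_sum comult_list f x"
proof -
  have "(p, comult_rep x) \<in> tensor2_rel scale"
    using quotient_eq_iff[OF equiv_tensor2_rel comult_tensor comult_tensor p comult_rep[of x]] by simp
  then have "p - comult_rep x \<in> tensor2_null scale" by (simp add: tensor2_rel_def)
  from lin_ext_tensor2_null[OF vector_space_axioms f this]
  have "lin_ext scale (\<lambda>(a, b). f a b) p = lin_ext scale (\<lambda>(a, b). f a b) (comult_rep x)"
    by (simp add: lin_ext_simps[OF vector_space_axioms])
  also have "\<dots> = sweedler_sum comult_list f x"
  proof -
    let ?xs = "SOME xs. distinct xs \<and> set xs = Poly_Mapping.keys (comult_rep x)"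
    have xs: "distinct ?xs \<and> set ?xs = Poly_Mapping.keys (comult_rep x)"
      using finite_distinct_list[of "Poly_Mapping.keys (comult_rep x)"]
      by (intro someI_ex[of "\<lambda>xs. distinct xs \<and> set xs = Poly_Mapping.keys (comult_rep x)"]) auto
    have "f (scale c a) b = scale c (f a b)" for a b c
      using f by (simp add: bilinear_on_def Vector_Spaces.linear_iff)
    then show ?thesis
      using xs by (simp add: lin_ext_def sweedler_sum_def comult_list_def split_def comp_def
          sum_list_distinct_conv_sum_set)
  qed
  finally show ?thesis .
qed

lemma linear_sweedler_sum_param:
  assumes "\<And>a b. linear_on scale (\<lambda>x. F x a b)"
  shows "linear_on scale (\<lambda>x. sweedler_sum cm (F x) y)"
proof -
  have F: "F (x + x') a b = F x a b + F x' a b" "F (scale c x) a b = scale c (F x a b)" for x x' a b c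
    using assms[of a b] by (simp_all add: Vector_Spaces.linear_iff)
  have *: "F (x + x') = (\<lambda>a b. F x a b + F x' a b)" "F (scale c x) = (\<lambda>a b. scale c (F x a b))" for x x' c
    by (auto simp: F fun_eq_iff)
  have "sweedler_sum cm (\<lambda>a b. scale c (f a b)) y = scale c (sweedler_sum cm f y)" for c f
    by (rule sweedler_sum_hom[symmetric]) (auto simp: scale_right_distrib)
  then show ?thesis
    by (simp add: Vector_Spaces.linear_iff vector_space_axioms * sweedler_sum_add)
qed

lemma linear_sweedler_sum:
  assumes f: "bilinear_on scale f"
  shows "linear_on scale (sweedler_sum comult_list f)"
proof (unfold Vector_Spaces.linear_iff, intro conjI allI)
  fix x y
  show "sweedler_sum comult_list f (x + y) = sweedler_sum comult_list f x + sweedler_sum comult_list f y"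
    using lin_ext_comult[OF f comult_add[OF comult_rep comult_rep, of x y]]
    by (simp add: lin_ext_simps[OF vector_space_axioms] lin_ext_comult[OF f comult_rep])
next
  fix c x
  show "sweedler_sum comult_list f (scale c x) = scale c (sweedler_sum comult_list f x)"
    using lin_ext_comult[OF f comult_scale[OF comult_rep, of c x]]
    by (simp add: lin_ext_simps[OF vector_space_axioms] lin_ext_comult[OF f comult_rep])
qed (rule vector_space_axioms)+

lemma sweedler_sum_mult:
  assumes f: "bilinear_on scale f"
  shows "sweedler_sum comult_list f (x * y) =
    sweedler_sum comult_list (\<lambda>a b. sweedler_sum comult_list (\<lambda>c d. f (a * c) (b * d)) y) x"
proof -
  have f': "linear_on scale (\<lambda>a. f a b)" "linear_on scale (\<lambda>b. f a b)" for a b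
    using f by (simp_all add: bilinear_on_def)
  have mul: "linear_on scale (\<lambda>a. a * b)" "linear_on scale (\<lambda>a. b * a)" for b
    by (simp_all add: Vector_Spaces.linear_iff vector_space_axioms distrib_left distrib_right
        flip: scale_mult_left scale_mult_right)
  have b1: "bilinear_on scale (\<lambda>c d. f (a * c) (b * d))" for a b
    using Vector_Spaces.linear_compose[OF mul(2) f'(1)] Vector_Spaces.linear_compose[OF mul(2) f'(2)]
    by (simp add: bilinear_on_def comp_def)
  have b2: "bilinear_on scale (\<lambda>a b. sweedler_sum comult_list (\<lambda>c d. f (a * c) (b * d)) y)"
    unfolding bilinear_on_def
    using Vector_Spaces.linear_compose[OF mul(1) f'(1)] Vector_Spaces.linear_compose[OF mul(1) f'(2)]
    by (auto simp: comp_def intro!: linear_sweedler_sum_param)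
  let ?p = "comult_rep x" and ?q = "comult_rep y"
  have "sweedler_sum comult_list f (x * y) = lin_ext scale (\<lambda>(a, b). f a b) (tensor2_mult ?p ?q)"
    by (rule lin_ext_comult[OF f, symmetric]) (intro comult_mult comult_rep)
  also have "\<dots> = lin_ext scale (\<lambda>(a, b). lin_ext scale (\<lambda>(c, d). f (a * c) (b * d)) ?q) ?p"
    unfolding tensor2_mult_def
    by (simp add: lin_ext_hom[OF lin_ext_linear] vector_space_axioms split_def
        lin_ext_single[OF vector_space_axioms])
  also have "\<dots> = lin_ext scale (\<lambda>(a, b). sweedler_sum comult_list (\<lambda>c d. f (a * c) (b * d)) y) ?p"
    by (simp add: lin_ext_comult[OF b1 comult_rep])
  also have "\<dots> = sweedler_sum comult_list (\<lambda>a b. sweedler_sum comult_list (\<lambda>c d. f (a * c) (b * d)) y) x"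
    by (rule lin_ext_comult[OF b2 comult_rep])
  finally show ?thesis .
qed

lemma sweedler_sum_coassoc:
  assumes g: "trilinear_on scale g"
  shows "sweedler_sum comult_list (\<lambda>a b. sweedler_sum comult_list (\<lambda>c d. g c d b) a) x =
      sweedler_sum comult_list (\<lambda>a b. sweedler_sum comult_list (\<lambda>c d. g a c d) b) x"
proof -
  have b: "bilinear_on scale (\<lambda>c d. g c d b)" "bilinear_on scale (\<lambda>c d. g b c d)" for b
    using g by (simp_all add: trilinear_on_def bilinear_on_def)
  have b1: "bilinear_on scale (\<lambda>a b. sweedler_sum comult_list (\<lambda>c d. g c d b) a)"
    using g linear_sweedler_sum[OF b(1)]
    by (auto simp: bilinear_on_def trilinear_on_def intro!: linear_sweedler_sum_param)
  have b2: "bilinear_on scale (\<lambda>a b. sweedler_sum comult_list (\<lambda>c d. g a c d) b)"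
    using g linear_sweedler_sum[OF b(2)]
    by (auto simp: bilinear_on_def trilinear_on_def intro!: linear_sweedler_sum_param)
  note simps = lin_ext_hom[OF lin_ext_linear] vector_space_axioms split_def
        lin_ext_single[OF vector_space_axioms]
  from coassoc[of comult_rep x, OF comult_rep]
  have "lin_ext scale (\<lambda>(a, b, c). g a b c)
      (lin_ext free_scale (\<lambda>(a, b). lin_ext free_scale (\<lambda>(c, d). Poly_Mapping.single (c, d, b) 1) (comult_rep a)) (comult_rep x)
       - lin_ext free_scale (\<lambda>(a, b). lin_ext free_scale (\<lambda>(c, d). Poly_Mapping.single (a, c, d) 1) (comult_rep b)) (comult_rep x)) = 0"
    by (intro lin_ext_tensor3_null vector_space_axioms g) (simp add: tensor3_rel_def)
  then have "lin_ext scale (\<lambda>(a, b). lin_ext scale (\<lambda>(c, d). g c d b) (comult_rep a)) (comult_rep x) =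
     lin_ext scale (\<lambda>(a, b). lin_ext scale (\<lambda>(c, d). g a c d) (comult_rep b)) (comult_rep x)"
    by (simp add: lin_ext_simps[OF vector_space_axioms] simps)
  then show ?thesis
    by (simp only: lin_ext_comult[OF b(1) comult_rep] lin_ext_comult[OF b(2) comult_rep]
        lin_ext_comult[OF b1 comult_rep] lin_ext_comult[OF b2 comult_rep])
qed

lemma hopf_sweedler_comult_list:
  assumes J: "hopf_ideal \<Delta> \<epsilon> S J"
    and \<alpha>: "\<And>j. functional_on scale (\<alpha> j)" "\<And>x j. x \<in> J \<Longrightarrow> \<alpha> j x = 0"
      "\<And>i j. i < n \<Longrightarrow> j < n \<Longrightarrow> \<alpha> i (e j) = (if i = j then 1 else 0)"
      "\<And>x. x - (\<Sum>j<n. scale (\<alpha> j x) (e j)) \<in> J"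
  shows "hopf_sweedler scale (*) comult_list \<epsilon> S J n e \<alpha>"
proof -
  have J': "0 \<in> J" "\<And>x y. x \<in> J \<Longrightarrow> y \<in> J \<Longrightarrow> x + y \<in> J" "\<And>r x. x \<in> J \<Longrightarrow> r * x \<in> J" "\<And>r x. x \<in> J \<Longrightarrow> x * r \<in> J"
    "\<And>x. x \<in> J \<Longrightarrow> \<epsilon> x = 0" "\<And>x. x \<in> J \<Longrightarrow> S x \<in> J"
    using J by (auto simp: hopf_ideal_def two_sided_ideal_def left_ideal_def)
  have Js: "scale c x \<in> J" if "x \<in> J" for c x
    using J'(3)[OF that, of "scale c 1"] scale_mult_left[of c 1 x] by simp
  have mul: "linear_on scale (\<lambda>a. a * b)" "linear_on scale (\<lambda>a. b * a)" for b
    by (simp_all add: Vector_Spaces.linear_iff vector_space_axioms distrib_left distrib_right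
        flip: scale_mult_left scale_mult_right)
  have \<epsilon>: "\<epsilon> (x + y) = \<epsilon> x + \<epsilon> y" "\<epsilon> (scale c x) = c * \<epsilon> x"
    and S: "S (x + y) = S x + S y" "S (scale c x) = scale c (S x)" for x y c
    using counit_linear antipode_linear by (simp_all add: Vector_Spaces.linear_iff)
  have bil: "bilinear_on scale (\<lambda>a b. scale (\<epsilon> a) b)" "bilinear_on scale (\<lambda>a b. scale (\<epsilon> b) a)"
    "bilinear_on scale (\<lambda>a b. S a * b)" "bilinear_on scale (\<lambda>a b. a * S b)"
    by (simp_all add: bilinear_on_def Vector_Spaces.linear_iff vector_space_axioms \<epsilon> S algebra_simps
        scale_left_distrib scale_right_distrib mult.commute flip: scale_mult_left scale_mult_right)
  show ?thesis
  proof (intro hopf_sweedler.intro hopf_sweedler_axioms.intro vector_space_axioms, goal_cases)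
    case (22 x f U)
    \<comment> \<open>This is \<open>J_comult\<close>: f is evaluated on the representative that the
      Hopf ideal provides, all of whose terms have a factor in J.\<close>
    from J 22(1) obtain p where p: "p \<in> \<Delta> x" "\<And>a b. (a, b) \<in> Poly_Mapping.keys p \<Longrightarrow> a \<in> J \<or> b \<in> J"
      unfolding hopf_ideal_def by blast
    have "f a b \<in> U" if "(a, b) \<in> Poly_Mapping.keys p" for a b
      using p(2)[OF that] 22(4)[of a b] 22(5)[of b a] by blast
    then have "lin_ext scale (\<lambda>(a, b). f a b) p \<in> U"
      unfolding lin_ext_def by (intro subspace_sum[OF 22(3)]) (auto intro!: subspace_scale[OF 22(3)])
    then show ?case by (simp add: lin_ext_comult[OF 22(2) p(1)])
  qed (use J' Js \<alpha> mul counit_left[OF comult_rep] counit_right[OF comult_rep] antipode_left[OF comult_rep]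
      antipode_right[OF comult_rep]
      in \<open>simp_all add: mult.assoc linear_sweedler_sum sweedler_sum_mult sweedler_sum_coassoc counit_linear
        counit_one counit_mult antipode_linear subspace_def lin_ext_comult[OF bil(1) comult_rep]
        lin_ext_comult[OF bil(2) comult_rep] lin_ext_comult[OF bil(3) comult_rep] lin_ext_comult[OF bil(4) comult_rep]\<close>)
qed
end

section \<open>The Jacobson radical\<close>

text \<open>For a finite-dimensional algebra this is the Jacobson radical, by
  \<open>jacobson_radical_eq\<close>. Unlike maximal left ideals, this form is symmetric in left and
  right, by \<open>nilpotent_swap\<close>.\<close>

definition nil_radical :: "'h::ring_1 set" where
  "nil_radical = {y. \<forall>h. \<exists>k. (h * y) ^ k = 0}"

lemma power_mult_swap: "(x * y) ^ Suc k = x * (y * x) ^ k * y" for x y :: "'h::monoid_mult"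
proof (induction k)
  case (Suc k)
  have "(x * y) ^ Suc (Suc k) = x * y * (x * (y * x) ^ k * y)" using Suc by simp
  then show ?case by (simp add: mult.assoc)
qed simp

lemma nilpotent_swap: "(\<exists>k. (x * y) ^ k = 0) \<longleftrightarrow> (\<exists>k. (y * x) ^ k = 0)" for x y :: "'h::ring_1"
proof -
  have "\<exists>k. (x * y) ^ k = 0" if "(y * x) ^ k = 0" for x y :: 'h and k
    using that power_mult_swap[of x y k] by (intro exI[of _ "Suc k"]) simp
  then show ?thesis by blast
qed

lemma nil_radical_mult_left: "y \<in> nil_radical \<Longrightarrow> r * y \<in> nil_radical"
  by (auto simp: nil_radical_def mult.assoc[symmetric])

lemma nil_radical_mult_right: "y \<in> nil_radical \<Longrightarrow> y * r \<in> nil_radical"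
proof -
  assume y: "y \<in> nil_radical"
  have "\<exists>k. (h * (y * r)) ^ k = 0" for h
    using y nilpotent_swap[of "h * y" r] by (simp add: nil_radical_def mult.assoc[symmetric])
  then show ?thesis by (simp add: nil_radical_def)
qed

lemma nilpotent_one_minus:
  fixes z :: "'h::ring_1"
  assumes "z ^ k = 0"
  obtains u where "u * (1 - z) = 1" "(1 - z) * u = 1"
proof
  have "(\<Sum>i<k. z ^ i) * (1 - z) = 1 - z ^ k"
  proof (induction k)
    case (Suc k)
    have "(\<Sum>i<Suc k. z ^ i) * (1 - z) = (1 - z ^ k) + z ^ k * (1 - z)"
      by (simp only: sum.lessThan_Suc distrib_right Suc)
    then show ?case by (simp add: right_diff_distrib power_commutes)
  qed simp
  moreover have "(1 - z) * (\<Sum>i<k. z ^ i) = 1 - z ^ k"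
  proof (induction k)
    case (Suc k)
    have "(1 - z) * (\<Sum>i<Suc k. z ^ i) = (1 - z ^ k) + (1 - z) * z ^ k"
      by (simp only: sum.lessThan_Suc distrib_left Suc)
    then show ?case by (simp add: left_diff_distrib)
  qed simp
  ultimately show "(\<Sum>i<k. z ^ i) * (1 - z) = 1" "(1 - z) * (\<Sum>i<k. z ^ i) = 1"
    using assms by simp_all
qed

text \<open>\<open>mul\<close> is the product or its opposite, so each lemma holds for left and for
  right modules; 1, powers of one element and \<open>nil_radical\<close> are the same for
  both.\<close>

locale fd_algebra = k_algebra scale + finite_dimensional_vector_space scale Basis
  for scale :: "'k::field \<Rightarrow> 'h::ring_1 \<Rightarrow> 'h" and Basis :: "'h set" +
  fixes mul :: "'h \<Rightarrow> 'h \<Rightarrow> 'h" (infixl "\<odot>" 70)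
  assumes mul: "mul \<in> {(*), \<lambda>x y. y * x}"
begin

lemma mul_assoc: "(x \<odot> y) \<odot> z = x \<odot> (y \<odot> z)"
  and mul_one [simp]: "1 \<odot> x = x" "x \<odot> 1 = x"
  and mul_0 [simp]: "0 \<odot> x = 0" "x \<odot> 0 = 0"
  and mul_add: "x \<odot> (y + z) = x \<odot> y + x \<odot> z" "(x + y) \<odot> z = x \<odot> z + y \<odot> z"
  and mul_diff: "x \<odot> (y - z) = x \<odot> y - x \<odot> z" "(x - y) \<odot> z = x \<odot> z - y \<odot> z"
  and mul_minus: "x \<odot> (- y) = - (x \<odot> y)" "(- x) \<odot> y = - (x \<odot> y)"
  and mul_scale: "scale c x \<odot> y = scale c (x \<odot> y)" "x \<odot> scale c y = scale c (x \<odot> y)"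
  and mul_power: "x \<odot> x ^ k = x ^ Suc k" "x ^ k \<odot> x = x ^ Suc k"
  using mul by (auto simp: algebra_simps power_commutes scale_mult_left[symmetric] scale_mult_right[symmetric])

lemma mul_sum: "x \<odot> sum f I = (\<Sum>i\<in>I. x \<odot> f i)" "sum f I \<odot> x = (\<Sum>i\<in>I. f i \<odot> x)"
  by (induction I rule: infinite_finite_induct) (auto simp: mul_add)

lemma op: "fd_algebra scale Basis (\<lambda>x y. y \<odot> x)"
  by unfold_locales (use mul in auto)

lemma linear_mul: "linear_on scale (\<lambda>x. x \<odot> y)" "linear_on scale (\<lambda>x. y \<odot> x)"
  by (simp_all add: Vector_Spaces.linear_iff vector_space_axioms mul_add mul_scale)

lemma nil_radical_mul:
  "y \<in> nil_radical \<Longrightarrow> r \<odot> y \<in> nil_radical" "y \<in> nil_radical \<Longrightarrow> y \<odot> r \<in> nil_radical"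
  using mul nil_radical_mult_left nil_radical_mult_right by auto

lemma nil_radical_iff: "y \<in> nil_radical \<longleftrightarrow> (\<forall>h. \<exists>k. (h \<odot> y) ^ k = 0)"
  using mul
proof
  assume "mul \<in> {\<lambda>x y. y * x}"
  then show ?thesis using nilpotent_swap[of y] by (simp add: nil_radical_def)
qed (simp add: nil_radical_def)

definition mul_ideal :: "'h set \<Rightarrow> bool" where
  "mul_ideal I \<longleftrightarrow> 0 \<in> I \<and> (\<forall>x\<in>I. \<forall>y\<in>I. x + y \<in> I) \<and> (\<forall>r. \<forall>x\<in>I. r \<odot> x \<in> I)"

lemma mul_idealD:
  assumes "mul_ideal I"
  shows "0 \<in> I" "x \<in> I \<Longrightarrow> y \<in> I \<Longrightarrow> x + y \<in> I" "x \<in> I \<Longrightarrow> r \<odot> x \<in> I"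
    "x \<in> I \<Longrightarrow> - x \<in> I" "x \<in> I \<Longrightarrow> y \<in> I \<Longrightarrow> x - y \<in> I"
proof -
  show 1: "0 \<in> I" "x \<in> I \<Longrightarrow> y \<in> I \<Longrightarrow> x + y \<in> I" "x \<in> I \<Longrightarrow> r \<odot> x \<in> I" for x y r
    using assms by (auto simp: mul_ideal_def)
  show 2: "x \<in> I \<Longrightarrow> - x \<in> I" for x using 1(3)[of x "- 1"] by (simp add: mul_minus)
  show "x \<in> I \<Longrightarrow> y \<in> I \<Longrightarrow> x - y \<in> I" using 1(2)[of x "- y"] 2[of y] by simp
qed

lemma mul_ideal_subspace: "mul_ideal I \<Longrightarrow> subspace I"
  using mul_idealD(3)[of I _ "scale _ 1"] by (auto simp: subspace_def mul_ideal_def mul_scale)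

lemma mul_ideal_eqI: "mul_ideal I \<Longrightarrow> mul_ideal I' \<Longrightarrow> I \<subseteq> I' \<Longrightarrow> dim I' \<le> dim I \<Longrightarrow> I = I'"
  using subspace_dim_equal mul_ideal_subspace by blast

lemma mul_ideal_add_generator:
  assumes "mul_ideal I"
  shows "mul_ideal {i + h \<odot> y | i h. i \<in> I}" "I \<subseteq> {i + h \<odot> y | i h. i \<in> I}" "y \<in> {i + h \<odot> y | i h. i \<in> I}"
proof -
  note I = mul_idealD[OF assms]
  show "mul_ideal {i + h \<odot> y | i h. i \<in> I}"
    unfolding mul_ideal_def
  proof (intro conjI ballI allI)
    have "0 = 0 + 0 \<odot> y" by simp
    then show "0 \<in> {i + h \<odot> y | i h. i \<in> I}" using I(1) by blast
  next
    fix x z assume "x \<in> {i + h \<odot> y | i h. i \<in> I}" "z \<in> {i + h \<odot> y | i h. i \<in> I}"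
    then obtain i h i' h' where "x = i + h \<odot> y" "z = i' + h' \<odot> y" "i \<in> I" "i' \<in> I" by blast
    then have "x + z = (i + i') + (h + h') \<odot> y" "i + i' \<in> I" using I by (auto simp: mul_add)
    then show "x + z \<in> {i + h \<odot> y | i h. i \<in> I}" by blast
  next
    fix r x assume "x \<in> {i + h \<odot> y | i h. i \<in> I}"
    then obtain i h where "x = i + h \<odot> y" "i \<in> I" by blast
    then have "r \<odot> x = r \<odot> i + (r \<odot> h) \<odot> y" "r \<odot> i \<in> I" using I by (auto simp: mul_add mul_assoc)
    then show "r \<odot> x \<in> {i + h \<odot> y | i h. i \<in> I}" by blast
  qed
  have "i = i + 0 \<odot> y" for i by simp
  then show "I \<subseteq> {i + h \<odot> y | i h. i \<in> I}" by blast
  have "y = 0 + 1 \<odot> y" by simp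
  then show "y \<in> {i + h \<odot> y | i h. i \<in> I}" using I(1) by blast
qed

lemma mul_ideal_range: "mul_ideal (range (\<lambda>a. a \<odot> v))"
  unfolding mul_ideal_def
proof (intro conjI ballI allI)
  show "0 \<in> range (\<lambda>a. a \<odot> v)" by (rule range_eqI[of _ _ 0]) simp
  fix x r assume "x \<in> range (\<lambda>a. a \<odot> v)"
  then obtain a where a: "x = a \<odot> v" by blast
  show "r \<odot> x \<in> range (\<lambda>a. a \<odot> v)" by (rule range_eqI[of _ _ "r \<odot> a"]) (simp add: a mul_assoc)
  fix y assume "y \<in> range (\<lambda>a. a \<odot> v)"
  then obtain b where b: "y = b \<odot> v" by blast
  show "x + y \<in> range (\<lambda>a. a \<odot> v)" by (rule range_eqI[of _ _ "a + b"]) (simp add: a b mul_add)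
qed

lemma maximal_mul_ideal_exists:
  assumes "mul_ideal I" "mul_ideal J" "I \<subset> J"
  obtains N where "mul_ideal N" "I \<subseteq> N" "N \<subset> J"
    "\<And>N'. mul_ideal N' \<Longrightarrow> N \<subset> N' \<Longrightarrow> N' \<subseteq> J \<Longrightarrow> N' = J"
proof -
  let ?P = "\<lambda>N. mul_ideal N \<and> I \<subseteq> N \<and> N \<subset> J"
  have "?P I" using assms by blast
  moreover have "\<forall>N. ?P N \<longrightarrow> dim N < Suc dimension"
    using dim_subset_UNIV by (simp add: less_Suc_eq_le)
  ultimately obtain N where N: "?P N" "\<forall>N'. ?P N' \<longrightarrow> dim N' \<le> dim N"
    using ex_has_greatest_nat[of ?P I dim "Suc dimension"] by blast
  have "N' = J" if N': "mul_ideal N'" "N \<subset> N'" "N' \<subseteq> J" for N'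
  proof (rule ccontr)
    assume "N' \<noteq> J"
    then have "?P N'" using N(1) N' by blast
    then have "dim N' \<le> dim N" using N(2) by blast
    then have "N = N'" using mul_ideal_eqI N(1) N' by blast
    then show False using N' by blast
  qed
  then show thesis using that N(1) by blast
qed

end

locale fd_algebra_left = fd_algebra scale Basis "(*)"
  for scale :: "'k::field \<Rightarrow> 'h::ring_1 \<Rightarrow> 'h" and Basis :: "'h set"
begin

lemma mul_ideal_left_ideal: "mul_ideal I \<longleftrightarrow> left_ideal I"
  by (simp add: mul_ideal_def left_ideal_def)

text \<open>Otherwise H (1 - x) lies in a maximal left ideal, which also contains x and hence
  1.\<close>

lemma one_minus_jacobson_left_invertible:
  fixes x :: 'h
  assumes "x \<in> jacobson_radical"
  shows "\<exists>u. u * (1 - x) = 1"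
proof -
  let ?L = "range (\<lambda>a. a * (1 - x))"
  have "?L = UNIV"
  proof (rule ccontr)
    assume "?L \<noteq> UNIV"
    then have "?L \<subset> UNIV" by blast
    moreover have "mul_ideal ?L" by (rule mul_ideal_range)
    moreover have "mul_ideal UNIV" by (simp add: mul_ideal_def)
    ultimately obtain N where N: "mul_ideal N" "?L \<subseteq> N" "N \<subset> UNIV"
      "\<And>N'. mul_ideal N' \<Longrightarrow> N \<subset> N' \<Longrightarrow> N' \<subseteq> UNIV \<Longrightarrow> N' = UNIV"
      using maximal_mul_ideal_exists by metis
    have "maximal_left_ideal N"
      unfolding maximal_left_ideal_def mul_ideal_left_ideal[symmetric] using N by blast
    then have "x \<in> N" using assms by (simp add: jacobson_radical_def)
    moreover have "1 - x \<in> N" using N(2) by (metis mult_1 rangeI subsetD)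
    ultimately have "1 \<in> N" using mul_idealD(2)[OF N(1), of "1 - x" x] by simp
    then have "r \<in> N" for r using mul_idealD(3)[OF N(1), of 1 r] by simp
    then show False using N(3) by blast
  qed
  then show ?thesis by (metis UNIV_I imageE)
qed

lemma left_ideal_jacobson_radical: "left_ideal (jacobson_radical :: 'h set)"
  by (auto simp: jacobson_radical_def left_ideal_def maximal_left_ideal_def)

text \<open>For z = h y in the Jacobson radical, the left ideals H z^i stabilise, so z^i = a
  z^(i+1), and (1 - a z) z^i = 0 with 1 - a z left invertible. Conversely, if a maximal left ideal
  misses y, it contains some i = 1 - h y, which is invertible by nilpotence of h y.\<close>

lemma jacobson_radical_eq: "jacobson_radical = (nil_radical :: 'h set)"
proof (intro equalityI subsetI)
  fix y :: 'h assume y: "y \<in> jacobson_radical"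
  have "\<exists>k. (h * y) ^ k = 0" for h
  proof -
    let ?z = "h * y" and ?W = "\<lambda>i. range (\<lambda>a. a * (h * y) ^ i)"
    obtain i where i: "\<forall>j. dim (?W i) \<le> dim (?W j)"
      using ex_has_least_nat[of "\<lambda>_. True" 0 "\<lambda>i. dim (?W i)"] by blast
    have "?W (Suc i) \<subseteq> ?W i"
      by (auto simp: mult.assoc[symmetric])
    then have "?W (Suc i) = ?W i"
      using mul_ideal_eqI[OF mul_ideal_range mul_ideal_range] i by blast
    moreover have "?z ^ i \<in> ?W i" by (rule range_eqI[of _ _ 1]) simp
    ultimately obtain a where a: "?z ^ i = a * ?z ^ Suc i" by (metis imageE)
    have "a * ?z \<in> jacobson_radical"
      using y left_ideal_jacobson_radical unfolding left_ideal_def by blast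
    then obtain u where u: "u * (1 - a * ?z) = 1" using one_minus_jacobson_left_invertible by blast
    have "(1 - a * ?z) * ?z ^ i = 0" using a by (simp add: algebra_simps)
    then have "?z ^ i = 0" using u by (metis mult.assoc mult_1 mult_zero_right)
    then show ?thesis by blast
  qed
  then show "y \<in> nil_radical" by (simp add: nil_radical_def)
next
  fix y :: 'h assume y: "y \<in> nil_radical"
  show "y \<in> jacobson_radical"
    unfolding jacobson_radical_def
  proof (intro InterI, rule ccontr)
    fix I assume "I \<in> {I. maximal_left_ideal I}" and yI: "y \<notin> I"
    then have I: "mul_ideal I" "I \<noteq> UNIV" "\<And>J. mul_ideal J \<Longrightarrow> I \<subseteq> J \<Longrightarrow> J = I \<or> J = UNIV"
      by (simp_all add: maximal_left_ideal_def mul_ideal_left_ideal)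
    have "{i + h * y | i h. i \<in> I} = UNIV"
      using I(3)[OF mul_ideal_add_generator(1,2)[OF I(1), of y]] mul_ideal_add_generator(3)[OF I(1), of y] yI
      by blast
    then obtain i h where ih: "1 = i + h * y" "i \<in> I" by blast
    obtain k where "(h * y) ^ k = 0" using y by (auto simp: nil_radical_def)
    then obtain u where "u * (1 - h * y) = 1" by (rule nilpotent_one_minus)
    moreover have "1 - h * y = i" using ih(1) by (simp add: diff_eq_eq)
    ultimately have "u * i = 1" by simp
    then have "1 \<in> I" using mul_idealD(3)[OF I(1) ih(2), of u] by simp
    then have "r \<in> I" for r using mul_idealD(3)[OF I(1), of 1 r] by simp
    then show False using I(2) by blast
  qed
qed

end

section \<open>Nakayama's lemma for the radical, and coordinates on a quotient\<close>

context fd_algebra begin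

text \<open>Closure under addition is not visible from nilpotence; it is borrowed from the Jacobson
  radical, an intersection of left ideals.\<close>

lemma mul_ideal_nil_radical: "mul_ideal nil_radical"
proof -
  interpret L: fd_algebra_left scale Basis by unfold_locales simp
  have "left_ideal (nil_radical :: 'h set)"
    using L.left_ideal_jacobson_radical unfolding L.jacobson_radical_eq .
  then show ?thesis
    using nil_radical_mul(1) by (simp add: left_ideal_def mul_ideal_def)
qed

text \<open>Take N maximal among the ideals that contain U and lie properly in the radical J. If y x
  with x, y in J were outside N, then x = i + h y x for some i in N, and invertibility of 1 - h y
  would put x into N. So N contains J^2, and then J.\<close>

lemma nakayama_lemma:
  assumes U: "mul_ideal U" "U \<subseteq> nil_radical"
    and gen: "\<And>x. x \<in> nil_radical \<Longrightarrow> \<exists>u\<in>U. x - u \<in> span {x \<odot> y | x y. x \<in> nil_radical \<and> y \<in> nil_radical}"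
  shows "U = nil_radical"
proof (rule ccontr)
  assume "U \<noteq> nil_radical"
  then obtain N where N: "mul_ideal N" "U \<subseteq> N" "N \<subset> nil_radical"
    "\<And>N'. mul_ideal N' \<Longrightarrow> N \<subset> N' \<Longrightarrow> N' \<subseteq> nil_radical \<Longrightarrow> N' = nil_radical"
    using maximal_mul_ideal_exists[OF U(1) mul_ideal_nil_radical] U(2) by blast
  have "y \<odot> x \<in> N" if x: "x \<in> nil_radical" and y: "y \<in> nil_radical" for x y
  proof (rule ccontr)
    assume yx: "y \<odot> x \<notin> N"
    let ?N' = "{i + h \<odot> (y \<odot> x) | i h. i \<in> N}"
    have "?N' \<subseteq> nil_radical"
    proof (rule subsetI, elim CollectE exE conjE)
      fix z i h assume "z = i + h \<odot> (y \<odot> x)" "i \<in> N"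
      then show "z \<in> nil_radical"
        using N(3) mul_idealD(2)[OF mul_ideal_nil_radical] nil_radical_mul(1)[OF nil_radical_mul(1)[OF x]] by auto
    qed
    moreover have "N \<subset> ?N'"
      using mul_ideal_add_generator(2,3)[OF N(1), of "y \<odot> x"] yx by auto
    ultimately have "?N' = nil_radical"
      by (intro N(4) mul_ideal_add_generator(1)[OF N(1)])
    then obtain i h where ih: "x = i + h \<odot> (y \<odot> x)" "i \<in> N" using x by blast
    have "\<exists>k. (h \<odot> y) ^ k = 0" using y by (simp add: nil_radical_iff)
    then obtain u where "u * (1 - h \<odot> y) = 1" "(1 - h \<odot> y) * u = 1" using nilpotent_one_minus by metis
    then have u: "u \<odot> (1 - h \<odot> y) = 1" using mul by auto
    have "i = (1 - h \<odot> y) \<odot> x" using ih(1) by (simp add: mul_diff mul_assoc eq_diff_eq)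
    then have "u \<odot> i = x" using u by (simp add: mul_assoc[symmetric])
    then have "x \<in> N" using mul_idealD(3)[OF N(1) ih(2), of u] by simp
    then show False using yx mul_idealD(3)[OF N(1)] by blast
  qed
  then have "span {x \<odot> y | x y. x \<in> nil_radical \<and> y \<in> nil_radical} \<subseteq> N"
    by (intro span_minimal mul_ideal_subspace N(1)) blast
  moreover have "x \<in> N" if "x - u \<in> N" "u \<in> U" for x u
    using mul_idealD(2)[OF N(1) that(1), of u] that(2) N(2) by auto
  ultimately have "x \<in> N" if "x \<in> nil_radical" for x
    using gen[OF that] by auto
  then show False using N(3) by auto
qed

lemma nil_radical_generator:
  assumes v: "v \<in> nil_radical"
    and gen: "\<And>x. x \<in> nil_radical \<Longrightarrow> \<exists>h. x - h \<odot> v \<in> span {x \<odot> y | x y. x \<in> nil_radical \<and> y \<in> nil_radical}"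
  shows "range (\<lambda>a. a \<odot> v) = nil_radical"
  by (rule nakayama_lemma[OF mul_ideal_range]) (use v gen nil_radical_mul(1) in blast)+

lemma quotient_dual_basis:
  assumes J: "subspace J"
  obtains n e \<alpha> where "\<And>j. functional_on scale (\<alpha> j)" "\<And>x j. x \<in> J \<Longrightarrow> \<alpha> j x = 0"
      "\<And>i j. i < n \<Longrightarrow> j < n \<Longrightarrow> \<alpha> i (e j) = (if i = j then 1 else 0)"
      "\<And>x. x - (\<Sum>j<(n::nat). scale (\<alpha> j x) (e j)) \<in> J"
proof -
  obtain B where B: "B \<subseteq> J" "independent B" "J \<subseteq> span B"
    by (rule basis_exists)
  obtain A where A: "B \<subseteq> A" "independent A" "UNIV \<subseteq> span A"
    by (rule maximal_independent_subset_extend[OF subset_UNIV B(2)])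
  have fin: "finite A" using A(2) by (rule finiteI_independent)
  have spanA: "span A = UNIV" using A(3) by blast
  obtain e where e: "bij_betw e {..<card (A - B)} (A - B)"
    using ex_bij_betw_nat_finite[of "A - B"] fin by (auto simp: atLeast0LessThan)
  \<comment> \<open>Coordinates at the basis vectors of H outside the basis \<open>B\<close> of J;
    the default 0 makes \<open>\<alpha> j\<close> a functional vanishing on J for every j.\<close>
  define \<alpha> where "\<alpha> j x = (if j < card (A - B) then representation A x (e j) else 0)" for j x
  have eA: "e j \<in> A - B" if "j < card (A - B)" for j
    using e that by (auto simp: bij_betw_def)
  have "functional_on scale (\<alpha> j)" for j
    using A(2) spanA
    by (auto simp: \<alpha>_def Vector_Spaces.linear_iff vector_space_axioms vector_space_field
        representation_add representation_scale)
  moreover have "\<alpha> j x = 0" if "x \<in> J" for x j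
  proof (cases "j < card (A - B)")
    case True
    have "representation A x = representation B x"
      using A B that by (intro representation_extend) auto
    moreover have "representation B x (e j) = 0"
      using representation_ne_zero[of B x "e j"] eA[OF True] by blast
    ultimately show ?thesis by (simp add: \<alpha>_def)
  qed (simp add: \<alpha>_def)
  moreover have "\<alpha> i (e j) = (if i = j then 1 else 0)" if "i < card (A - B)" "j < card (A - B)" for i j
  proof -
    have "e i = e j \<longleftrightarrow> i = j" using e that by (auto simp: bij_betw_def inj_on_def)
    then show ?thesis
      using that eA[of j] by (simp add: \<alpha>_def representation_basis[OF A(2)])
  qed
  moreover have "x - (\<Sum>j<card (A - B). scale (\<alpha> j x) (e j)) \<in> J" for x
  proof -
    have "x = (\<Sum>b\<in>A. scale (representation A x b) b)"
      using sum_representation_eq[OF A(2) _ fin, of x] spanA by simp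
    also have "\<dots> = (\<Sum>b\<in>B. scale (representation A x b) b) + (\<Sum>b\<in>A - B. scale (representation A x b) b)"
      by (simp add: sum.subset_diff[OF A(1) fin])
    also have "(\<Sum>b\<in>A - B. scale (representation A x b) b) = (\<Sum>j<card (A - B). scale (\<alpha> j x) (e j))"
      by (subst sum.reindex_bij_betw[OF e, symmetric]) (simp add: \<alpha>_def)
    finally have "x - (\<Sum>j<card (A - B). scale (\<alpha> j x) (e j)) = (\<Sum>b\<in>B. scale (representation A x b) b)"
      by (rule iffD2[OF diff_eq_eq])
    also have "\<dots> \<in> J" using B(1) by (intro subspace_sum subspace_scale J) auto
    finally show ?thesis .
  qed
  ultimately show thesis by (rule that)
qed

end

theorem hopf_radical_cases:
  fixes scale :: "'k::field \<Rightarrow> 'h::ring_1 \<Rightarrow> 'h"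
  assumes hopf: "hopf_algebra scale \<Delta> \<epsilon> S" and fd: "finite_dimensional_vector_space scale Basis"
    and chev: "chevalley_property \<Delta> \<epsilon> S"
  shows "(\<exists>v::'h. range (\<lambda>a. a * v) = nil_radical \<and> range (\<lambda>a. v * a) = nil_radical) \<or>
    (\<exists>(n::nat) e \<phi> y. n > 0 \<and> (\<forall>x::'h. \<exists>c. x - (\<Sum>j<n. scale (c j) (e j)) \<in> nil_radical) \<and>
      (\<forall>i<2 * n. functional_on scale (\<phi> i) \<and> y i \<in> nil_radical \<and>
        (\<forall>a\<in>nil_radical. \<forall>b\<in>nil_radical. \<phi> i (a * b) = 0) \<and>
        (\<forall>j<2 * n. \<phi> i (y j) = (if i = j then 1 else 0))))"
proof -
  interpret hopf_algebra scale \<Delta> \<epsilon> S by (rule hopf)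
  interpret fd: finite_dimensional_vector_space scale Basis by (rule fd)
  interpret L: fd_algebra_left scale Basis by unfold_locales simp
  interpret R: fd_algebra scale Basis "\<lambda>x y. y * x" by (rule L.op)
  let ?J = "nil_radical :: 'h set"
  have J: "hopf_ideal \<Delta> \<epsilon> S ?J"
    using chev by (simp add: chevalley_property_def L.jacobson_radical_eq)
  obtain \<alpha> n e where \<alpha>: "\<And>j. functional_on scale (\<alpha> j)" "\<And>x j. x \<in> ?J \<Longrightarrow> \<alpha> j x = 0"
      "\<And>i j. i < n \<Longrightarrow> j < n \<Longrightarrow> \<alpha> i (e j) = (if i = j then 1 else 0)"
      "\<And>x. x - (\<Sum>j<(n::nat). scale (\<alpha> j x) (e j)) \<in> ?J"
    by (rule L.quotient_dual_basis[OF L.mul_ideal_subspace[OF L.mul_ideal_nil_radical]], rule that)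
  interpret l: hopf_sweedler scale "(*)" comult_list \<epsilon> S ?J n e \<alpha>
    by (rule hopf_sweedler_comult_list[OF J \<alpha>])
  interpret r: hopf_sweedler scale "\<lambda>x y. y * x" "\<lambda>x. map prod.swap (comult_list x)" \<epsilon> S ?J n e \<alpha>
    by (rule l.op_cop)
  \<comment> \<open>1 is not in J, since \<epsilon> vanishes on J but not at 1; so H / J is
    nonzero.\<close>
  have "n > 0"
  proof (rule ccontr)
    assume "\<not> n > 0"
    then have "1 \<in> ?J" using \<alpha>(4)[of 1] by simp
    then show False using l.J_counit[of 1] counit_one by simp
  qed
  \<comment> \<open>\<open>l\<close> yields J = v H + J^2, a statement on right ideals and thus one
    for the opposite algebra \<open>R\<close>, and vice versa. The squares are therefore rewritten
    with their factors exchanged.\<close>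
  have J2: "l.J_square = span {y * x | x y. x \<in> ?J \<and> y \<in> ?J}" "r.J_square = span {x * y | x y. x \<in> ?J \<and> y \<in> ?J}"
    unfolding l.J_square_def r.J_square_def by (rule arg_cong[of _ _ span], blast)+
  have prod: "a * b \<in> l.J_square" "a * b \<in> r.J_square" if "a \<in> ?J" "b \<in> ?J" for a b
    using l.J_squareI[OF that] r.J_squareI[OF that(2,1)] by simp_all
  have finish: ?thesis if "\<forall>i<2 * n. functional_on scale (\<phi> i) \<and> y i \<in> ?J \<and> (\<forall>x\<in>U. \<phi> i x = 0) \<and>
      (\<forall>j<2 * n. \<phi> i (y j) = (if i = j then 1 else 0))" "\<And>a b. a \<in> ?J \<Longrightarrow> b \<in> ?J \<Longrightarrow> a * b \<in> U" for \<phi> y U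
  proof (rule disjI2, rule exI[of _ n], rule exI[of _ e], rule exI[of _ \<phi>], rule exI[of _ y], intro conjI allI)
    show "\<exists>c. x - (\<Sum>j<n. scale (c j) (e j)) \<in> ?J" for x
      using \<alpha>(4)[of x] by (intro exI[of _ "\<lambda>j. \<alpha> j x"])
  qed (use that \<open>n > 0\<close> in auto)
  show ?thesis
  proof (cases "(\<exists>v\<in>?J. \<forall>x\<in>?J. \<exists>h. x - v * h \<in> l.J_square) \<and> (\<exists>v\<in>?J. \<forall>x\<in>?J. \<exists>h. x - h * v \<in> r.J_square)")
    case True
    then obtain v v' where v: "v \<in> ?J" "\<And>x. x \<in> ?J \<Longrightarrow> \<exists>h. x - v * h \<in> l.J_square"
      and v': "v' \<in> ?J" "\<And>x. x \<in> ?J \<Longrightarrow> \<exists>h. x - h * v' \<in> r.J_square" by blast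
    have vH: "range (\<lambda>a. v * a) = ?J"
      using v unfolding J2 by (rule R.nil_radical_generator)
    have Hv': "range (\<lambda>a. a * v') = ?J"
      using v' unfolding J2 by (rule L.nil_radical_generator)
    \<comment> \<open>From J = v H = H v', write v' = v g. Right multiplication by g maps H v onto H
      v' = J, so H v has at least the dimension of J and fills it: v serves on both sides.\<close>
    obtain g where g: "v' = v * g" using v'(1) vH by blast
    have sub: "range (\<lambda>a. a * v) \<subseteq> ?J" using v(1) L.nil_radical_mul(1) by blast
    interpret pair: finite_dimensional_vector_space_pair scale Basis scale Basis ..
    have "?J = (\<lambda>x. x * g) ` range (\<lambda>a. a * v)"
      using Hv' by (auto simp: g image_image mult.assoc)
    then have "vector_space.dim scale ?J \<le> vector_space.dim scale (range (\<lambda>a. a * v))"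
      using pair.dim_image_le[OF L.linear_mul(1)[of g], of "range (\<lambda>a. a * v)"] by simp
    then have "range (\<lambda>a. a * v) = ?J"
      by (intro L.mul_ideal_eqI L.mul_ideal_range L.mul_ideal_nil_radical sub)
    then show ?thesis using vH by blast
  next
    case False
    then show ?thesis
      using l.radical_dichotomy r.radical_dichotomy finish prod by blast
  qed
qed

section \<open>Modules\<close>

definition direct_sum :: "('h::ring_1, 'm::ab_group_add) rep_module \<Rightarrow> 'm set \<Rightarrow> 'm set \<Rightarrow> bool" where
  "direct_sum M N L \<longleftrightarrow> submodule N M \<and> submodule L M \<and> N \<inter> L = {0} \<and> {x + y | x y. x \<in> N \<and> y \<in> L} = carr M"

lemma indecomposable_iff:
  "indecomposable M \<longleftrightarrow> carr M \<noteq> {0} \<and> (\<forall>N L. direct_sum M N L \<longrightarrow> N = {0} \<or> L = {0})"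
  by (simp add: indecomposable_def direct_sum_def)

lemma module_homD:
  assumes "module_hom M N f"
  shows "x \<in> carr M \<Longrightarrow> f x \<in> carr N" "x \<in> carr M \<Longrightarrow> y \<in> carr M \<Longrightarrow> f (x + y) = f x + f y"
    "x \<in> carr M \<Longrightarrow> f (act M r x) = act N r (f x)"
  using assms by (auto simp: module_hom_def)

lemma module_homI:
  assumes "\<And>x. x \<in> carr M \<Longrightarrow> f x \<in> carr N" "\<And>x y. x \<in> carr M \<Longrightarrow> y \<in> carr M \<Longrightarrow> f (x + y) = f x + f y"
    "\<And>x r. x \<in> carr M \<Longrightarrow> f (act M r x) = act N r (f x)"
  shows "module_hom M N f"
  using assms by (auto simp: module_hom_def)

lemma rep_module_hom_id: "module_hom M M (\<lambda>x. x)"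
  by (simp add: module_hom_def)

lemma rep_module_hom_comp: "module_hom M N f \<Longrightarrow> module_hom N L g \<Longrightarrow> module_hom M L (\<lambda>x. g (f x))"
  by (rule module_homI) (simp_all add: module_homD)

lemma module_hom_funpow: "module_hom M M f \<Longrightarrow> module_hom M M (f ^^ k)"
proof (induction k)
  case (Suc k)
  then show ?case using rep_module_hom_comp[OF Suc.IH[OF Suc.prems] Suc.prems] by (simp add: comp_def)
qed (simp add: rep_module_hom_id id_def)

lemma submoduleD:
  assumes "submodule N M"
  shows "x \<in> N \<Longrightarrow> x \<in> carr M" "0 \<in> N" "x \<in> N \<Longrightarrow> y \<in> N \<Longrightarrow> x + y \<in> N" "x \<in> N \<Longrightarrow> act M r x \<in> N"
  using assms by (auto simp: submodule_def)

lemma submoduleI: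
  assumes "\<And>x. x \<in> N \<Longrightarrow> x \<in> carr M" "0 \<in> N" "\<And>x y. x \<in> N \<Longrightarrow> y \<in> N \<Longrightarrow> x + y \<in> N"
    "\<And>x r. x \<in> N \<Longrightarrow> act M r x \<in> N"
  shows "submodule N M"
  using assms by (auto simp: submodule_def)

context fd_algebra begin

lemma moduleD:
  assumes "module_over mul M"
  shows "0 \<in> carr M" "x \<in> carr M \<Longrightarrow> y \<in> carr M \<Longrightarrow> x + y \<in> carr M"
    "x \<in> carr M \<Longrightarrow> - x \<in> carr M" "x \<in> carr M \<Longrightarrow> act M r x \<in> carr M"
    "x \<in> carr M \<Longrightarrow> y \<in> carr M \<Longrightarrow> act M r (x + y) = act M r x + act M r y"
    "x \<in> carr M \<Longrightarrow> act M (r + t) x = act M r x + act M t x"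
    "x \<in> carr M \<Longrightarrow> act M (r \<odot> t) x = act M r (act M t x)"
    "x \<in> carr M \<Longrightarrow> act M 1 x = x"
  using assms unfolding module_over_def by auto

lemma module_more:
  assumes M: "module_over mul M"
  shows "act M r 0 = 0" "x \<in> carr M \<Longrightarrow> act M 0 x = 0"
    "x \<in> carr M \<Longrightarrow> act M r (- x) = - act M r x" "x \<in> carr M \<Longrightarrow> act M (- r) x = - act M r x"
    "x \<in> carr M \<Longrightarrow> y \<in> carr M \<Longrightarrow> act M r (x - y) = act M r x - act M r y"
    "x \<in> carr M \<Longrightarrow> act M (r - t) x = act M r x - act M t x"
    "x \<in> carr M \<Longrightarrow> y \<in> carr M \<Longrightarrow> x - y \<in> carr M"
proof -
  note D = moduleD[OF M]
  show r0: "act M r 0 = 0" for r using D(5)[OF D(1) D(1), of r] by simp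
  show a0: "act M 0 x = 0" if "x \<in> carr M" for x using D(6)[OF that, of 0 0] by simp
  show ng: "act M r (- x) = - act M r x" if "x \<in> carr M" for r x
    using D(5)[OF that D(3)[OF that], of r] r0[of r] by (simp add: eq_neg_iff_add_eq_0 add.commute)
  show gn: "act M (- r) x = - act M r x" if "x \<in> carr M" for r x
    using D(6)[OF that, of r "- r"] a0[OF that] by (simp add: eq_neg_iff_add_eq_0 add.commute)
  show "act M r (x - y) = act M r x - act M r y" if "x \<in> carr M" "y \<in> carr M"
    using D(5)[OF that(1) D(3)[OF that(2)], of r] ng[OF that(2), of r] by simp
  show "act M (r - t) x = act M r x - act M t x" if "x \<in> carr M"
    using D(6)[OF that, of r "- t"] gn[OF that, of t] by simp
  show "x - y \<in> carr M" if "x \<in> carr M" "y \<in> carr M"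
    using D(2)[OF that(1) D(3)[OF that(2)]] by simp
qed

lemma module_sum:
  assumes M: "module_over mul M"
  shows "(\<And>i. i \<in> I \<Longrightarrow> f i \<in> carr M) \<Longrightarrow> sum f I \<in> carr M"
    and "(\<And>i. i \<in> I \<Longrightarrow> f i \<in> carr M) \<Longrightarrow> act M r (sum f I) = (\<Sum>i\<in>I. act M r (f i))"
    and "x \<in> carr M \<Longrightarrow> act M (sum g I) x = (\<Sum>i\<in>I. act M (g i) x)"
proof -
  note D = moduleD[OF M] module_more[OF M]
  show 1: "(\<And>i. i \<in> I \<Longrightarrow> f i \<in> carr M) \<Longrightarrow> sum f I \<in> carr M" for I
    by (induction I rule: infinite_finite_induct) (auto simp: D)
  show "(\<And>i. i \<in> I \<Longrightarrow> f i \<in> carr M) \<Longrightarrow> act M r (sum f I) = (\<Sum>i\<in>I. act M r (f i))"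
    by (induction I rule: infinite_finite_induct) (auto simp: D 1)
  show "x \<in> carr M \<Longrightarrow> act M (sum g I) x = (\<Sum>i\<in>I. act M (g i) x)"
    by (induction I rule: infinite_finite_induct) (auto simp: D)
qed

lemma module_hom_more:
  assumes M: "module_over mul M" and N: "module_over mul N" and f: "module_hom M N f"
  shows "f 0 = 0" "x \<in> carr M \<Longrightarrow> f (- x) = - f x"
    "x \<in> carr M \<Longrightarrow> y \<in> carr M \<Longrightarrow> f (x - y) = f x - f y"
    "(\<And>i. i \<in> I \<Longrightarrow> h i \<in> carr M) \<Longrightarrow> f (sum h I) = (\<Sum>i\<in>I. f (h i))"
proof -
  note M' = moduleD[OF M] module_more[OF M] module_sum[OF M]
  note f' = module_homD[OF f]
  show f0: "f 0 = 0" using f'(2)[of 0 0] M'(1) by simp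
  show fn: "f (- x) = - f x" if "x \<in> carr M" for x
    using f'(2)[OF that M'(3)[OF that]] f0 by (simp add: eq_neg_iff_add_eq_0 add.commute)
  show "f (x - y) = f x - f y" if "x \<in> carr M" "y \<in> carr M"
    using f'(2)[OF that(1) M'(3)[OF that(2)]] fn[OF that(2)] by simp
  show "(\<And>i. i \<in> I \<Longrightarrow> h i \<in> carr M) \<Longrightarrow> f (sum h I) = (\<Sum>i\<in>I. f (h i))"
    by (induction I rule: infinite_finite_induct) (auto simp: f0 f' M')
qed

lemma submodule_more:
  assumes M: "module_over mul M" and N: "submodule N M"
  shows "x \<in> N \<Longrightarrow> - x \<in> N" "x \<in> N \<Longrightarrow> y \<in> N \<Longrightarrow> x - y \<in> N"
    "(\<And>i. i \<in> I \<Longrightarrow> f i \<in> N) \<Longrightarrow> sum f I \<in> N" "module_over mul (M\<lparr>carr := N\<rparr>)"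
proof -
  note D = moduleD[OF M] module_more[OF M] and S = submoduleD[OF N]
  show neg: "x \<in> N \<Longrightarrow> - x \<in> N" for x
    using S(4)[of x "- 1"] S(1)[of x] by (simp add: D)
  show "x \<in> N \<Longrightarrow> y \<in> N \<Longrightarrow> x - y \<in> N" using S(3)[of x "- y"] neg[of y] by simp
  show "(\<And>i. i \<in> I \<Longrightarrow> f i \<in> N) \<Longrightarrow> sum f I \<in> N"
    by (induction I rule: infinite_finite_induct) (auto simp: S)
  show "module_over mul (M\<lparr>carr := N\<rparr>)"
    unfolding module_over_def using S neg by (simp add: D)
qed

lemma submodule_self: "module_over mul M \<Longrightarrow> submodule (carr M) M"
  by (rule submoduleI) (simp_all add: moduleD)

lemma submodule_zero: "module_over mul M \<Longrightarrow> submodule {0} M"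
  by (rule submoduleI) (simp_all add: moduleD module_more)

lemma submodule_plus:
  assumes M: "module_over mul M" and "submodule N M" "submodule L M"
  shows "submodule {x + y | x y. x \<in> N \<and> y \<in> L} M" (is "submodule ?S M")
proof -
  note D = moduleD[OF M] and N = submoduleD[OF assms(2)] and L = submoduleD[OF assms(3)]
  have I: "x + y \<in> ?S" if "x \<in> N" "y \<in> L" for x y using that by blast
  show ?thesis
  proof (rule submoduleI)
    show "0 \<in> ?S" using I[OF N(2) L(2)] by simp
  next
    fix x assume "x \<in> ?S" then show "x \<in> carr M" using N L D by auto
  next
    fix x z assume "x \<in> ?S" "z \<in> ?S"
    then obtain a b a' b' where "x = a + b" "z = a' + b'" "a \<in> N" "a' \<in> N" "b \<in> L" "b' \<in> L" by blast
    then show "x + z \<in> ?S" using I[of "a + a'" "b + b'"] N L by (simp add: algebra_simps)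
  next
    fix x r assume "x \<in> ?S"
    then obtain a b where "x = a + b" "a \<in> N" "b \<in> L" by blast
    then show "act M r x \<in> ?S" using I[of "act M r a" "act M r b"] N L D by simp
  qed
qed

lemma submodule_image:
  assumes M: "module_over mul M" and N: "module_over mul N" and f: "module_hom M N f" and L: "submodule L M"
  shows "submodule (f ` L) N"
proof (rule submoduleI)
  note D = module_homD[OF f] submoduleD[OF L]
  show "0 \<in> f ` L" using module_hom_more(1)[OF M N f] D by (metis imageI)
  show "x \<in> carr N" if "x \<in> f ` L" for x using that D by auto
  fix x assume "x \<in> f ` L"
  then obtain a where a: "x = f a" "a \<in> L" by blast
  show "act N r x \<in> f ` L" for r
    using a D by (intro image_eqI[of _ _ "act M r a"]) auto
  fix y assume "y \<in> f ` L"
  then obtain b where b: "y = f b" "b \<in> L" by blast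
  show "x + y \<in> f ` L" using a b D by (intro image_eqI[of _ _ "a + b"]) auto
qed

lemma submodule_preimage:
  assumes M: "module_over mul M" and N: "module_over mul N" and f: "module_hom M N f" and L: "submodule L N"
  shows "submodule {x \<in> carr M. f x \<in> L} M"
  by (rule submoduleI)
    (auto simp: module_homD[OF f] submoduleD[OF L] moduleD[OF M] module_hom_more[OF M N f])

lemma module_iso_inverse:
  assumes M: "module_over mul M" and f: "module_hom M N f" and bij: "bij_betw f (carr M) (carr N)"
  obtains g where "module_hom N M g" "bij_betw g (carr N) (carr M)"
    "\<And>x. x \<in> carr M \<Longrightarrow> g (f x) = x" "\<And>y. y \<in> carr N \<Longrightarrow> f (g y) = y"
proof
  let ?g = "inv_into (carr M) f"
  show gbij: "bij_betw ?g (carr N) (carr M)" by (rule bij_betw_inv_into[OF bij])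
  show gf: "\<And>x. x \<in> carr M \<Longrightarrow> ?g (f x) = x" using bij by (simp add: bij_betw_inv_into_left)
  show fg: "\<And>y. y \<in> carr N \<Longrightarrow> f (?g y) = y" using bij by (simp add: bij_betw_inv_into_right)
  have gM: "\<And>y. y \<in> carr N \<Longrightarrow> ?g y \<in> carr M" using gbij by (auto simp: bij_betw_def)
  show "module_hom N M ?g"
  proof (rule module_homI)
    fix x y assume x: "x \<in> carr N" "y \<in> carr N"
    then have "?g (f (?g x + ?g y)) = ?g x + ?g y" by (intro gf moduleD[OF M] gM)
    then show "?g (x + y) = ?g x + ?g y" using x by (simp add: module_homD[OF f] gM fg)
  next
    fix x r assume x: "x \<in> carr N"
    then have "?g (f (act M r (?g x))) = act M r (?g x)" by (intro gf moduleD[OF M] gM)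
    then show "?g (act N r x) = act M r (?g x)" using x by (simp add: module_homD[OF f] gM fg)
  qed (rule gM)
qed

lemma isomorphic_refl: "isomorphic M M"
  unfolding isomorphic_def using rep_module_hom_id by (intro exI[of _ "\<lambda>x. x"]) (auto simp: bij_betw_def)

lemma isomorphic_sym: "module_over mul M \<Longrightarrow> isomorphic M N \<Longrightarrow> isomorphic N M"
  unfolding isomorphic_def using module_iso_inverse by metis

lemma isomorphic_trans: "isomorphic M N \<Longrightarrow> isomorphic N L \<Longrightarrow> isomorphic M L"
proof -
  assume "isomorphic M N" "isomorphic N L"
  then obtain f g where fg: "module_hom M N f" "module_hom N L g"
    "bij_betw f (carr M) (carr N)" "bij_betw g (carr N) (carr L)"
    by (auto simp: isomorphic_def)
  have "bij_betw (\<lambda>x. g (f x)) (carr M) (carr L)"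
    using bij_betw_trans[OF fg(3,4)] by (simp add: comp_def)
  then show "isomorphic M L"
    unfolding isomorphic_def using rep_module_hom_comp[OF fg(1,2)] by blast
qed

lemma direct_sum_image:
  assumes M: "module_over mul M" and N: "module_over mul N" and f: "module_hom M N f"
    and bij: "bij_betw f (carr M) (carr N)" and ds: "direct_sum M A B"
  shows "direct_sum N (f ` A) (f ` B)"
proof -
  have sub: "submodule A M" "submodule B M" and int: "A \<inter> B = {0}"
    and sum: "{x + y | x y. x \<in> A \<and> y \<in> B} = carr M" using ds by (auto simp: direct_sum_def)
  have AB: "A \<subseteq> carr M" "B \<subseteq> carr M" using sub by (auto simp: submodule_def)
  have "f ` A \<inter> f ` B = f ` (A \<inter> B)"
    using AB bij by (intro inj_on_image_Int[symmetric, of f "carr M"]) (auto simp: bij_betw_def)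
  also have "\<dots> = {0}" by (simp add: int module_hom_more[OF M N f])
  finally have 1: "f ` A \<inter> f ` B = {0}" .
  have "{x + y | x y. x \<in> f ` A \<and> y \<in> f ` B} = f ` {x + y | x y. x \<in> A \<and> y \<in> B}"
  proof (intro equalityI subsetI)
    fix z assume "z \<in> {x + y | x y. x \<in> f ` A \<and> y \<in> f ` B}"
    then obtain a b where "z = f a + f b" "a \<in> A" "b \<in> B" by blast
    moreover from this have "z = f (a + b)" using AB by (simp add: module_homD[OF f] subsetD)
    ultimately show "z \<in> f ` {x + y | x y. x \<in> A \<and> y \<in> B}" by blast
  next
    fix z assume "z \<in> f ` {x + y | x y. x \<in> A \<and> y \<in> B}"
    then obtain a b where "z = f (a + b)" "a \<in> A" "b \<in> B" by blast
    moreover from this have "z = f a + f b" using AB by (simp add: module_homD[OF f] subsetD)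
    ultimately show "z \<in> {x + y | x y. x \<in> f ` A \<and> y \<in> f ` B}" by blast
  qed
  also have "\<dots> = carr N" using bij sum by (simp add: bij_betw_def)
  finally show ?thesis
    using 1 submodule_image[OF M N f] sub by (simp add: direct_sum_def)
qed

lemma indecomposable_iso:
  assumes M: "module_over mul M" and N: "module_over mul N" and iso: "isomorphic M N" and ind: "indecomposable M"
  shows "indecomposable N"
proof -
  obtain f where f: "module_hom M N f" "bij_betw f (carr M) (carr N)"
    using iso by (auto simp: isomorphic_def)
  obtain g where g: "module_hom N M g" "bij_betw g (carr N) (carr M)"
    "\<And>x. x \<in> carr M \<Longrightarrow> g (f x) = x" "\<And>y. y \<in> carr N \<Longrightarrow> f (g y) = y"
    by (rule module_iso_inverse[OF M f], rule that)
  have zero: "A = {0}" if "g ` A = {0}" "submodule A N" for A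
  proof -
    have "A = f ` g ` A"
      using g(4) submoduleD(1)[OF that(2)] by (force simp: image_image)
    then show ?thesis using that(1) by (simp add: module_hom_more[OF M N f(1)])
  qed
  have "carr N \<noteq> {0}"
  proof
    assume "carr N = {0}"
    then have "carr M = {0}"
      using g(2) module_hom_more(1)[OF N M g(1)] by (simp add: bij_betw_def)
    then show False using ind by (simp add: indecomposable_iff)
  qed
  moreover have "A = {0} \<or> B = {0}" if AB: "direct_sum N A B" for A B
  proof -
    have "g ` A = {0} \<or> g ` B = {0}"
      using direct_sum_image[OF N M g(1,2) AB] ind by (simp add: indecomposable_iff)
    then show ?thesis using zero AB unfolding direct_sum_def by metis
  qed
  ultimately show ?thesis by (simp add: indecomposable_iff)
qed

text \<open>\<open>fd_module\<close> asks for a set of generators with one coefficient each; the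
  coefficients of equal members of the family are added up.\<close>

lemma spanning_image:
  assumes M: "module_over mul M" and fin: "finite I" and g: "\<And>i. i \<in> I \<Longrightarrow> g i \<in> carr M"
    and x: "x = (\<Sum>i\<in>I. act M (scale (c i) 1) (g i))"
  shows "\<exists>c. x = (\<Sum>b\<in>g ` I. act M (scale (c b) 1) b)"
proof -
  have "x = (\<Sum>b\<in>g ` I. \<Sum>i\<in>{i \<in> I. g i = b}. act M (scale (c i) 1) (g i))"
    unfolding x by (rule sum.image_gen[OF fin])
  also have "\<dots> = (\<Sum>b\<in>g ` I. act M (scale (\<Sum>i\<in>{i \<in> I. g i = b}. c i) 1) b)"
    using g by (intro sum.cong refl) (auto simp: scale_sum_left module_sum(3)[OF M])
  finally show ?thesis
    by (intro exI[of _ "\<lambda>b. \<Sum>i\<in>{i \<in> I. g i = b}. c i"])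
qed

lemma fd_moduleI:
  assumes M: "module_over mul M" and fin: "finite I" and g: "\<And>i. i \<in> I \<Longrightarrow> g i \<in> carr M"
    and sp: "\<And>x. x \<in> carr M \<Longrightarrow> \<exists>c. x = (\<Sum>i\<in>I. act M (scale (c i) 1) (g i))"
  shows "fd_module scale M"
  unfolding fd_module_def
proof (intro exI[of _ "g ` I"] conjI ballI)
  fix x assume "x \<in> carr M"
  then obtain c where "x = (\<Sum>i\<in>I. act M (scale (c i) 1) (g i))" using sp by blast
  from spanning_image[OF M fin _ this] g show "\<exists>c. x = (\<Sum>b\<in>g ` I. act M (scale (c b) 1) b)"
    by simp
qed (use fin g in auto)

text \<open>A carrier is only a subset of an ambient group, so a submodule N is measured by the
  dimension of its preimage in the coefficient space k^B. This is dim N plus the dimension of the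
  space of relations among B, hence strictly monotone and at most |B|.\<close>

lemma submodule_measure:
  fixes M :: "('h, 'm::ab_group_add) rep_module"
  assumes M: "module_over mul M" and B: "finite B" "B \<subseteq> carr M"
    and sp: "\<And>x. x \<in> carr M \<Longrightarrow> \<exists>c. x = (\<Sum>b\<in>B. act M (scale (c b) 1) b)"
  shows "\<exists>\<mu>::'m set \<Rightarrow> nat. (\<forall>N L. submodule N M \<and> submodule L M \<and> N \<subset> L \<longrightarrow> \<mu> N < \<mu> L) \<and>
    (\<forall>N. \<mu> N \<le> card B)"
proof -
  define \<psi> where "\<psi> c = (\<Sum>b\<in>B. act M (scale (c b) 1) b)" for c
  define U where "U N = {c. (\<forall>x. x \<notin> B \<longrightarrow> c x = 0) \<and> \<psi> c \<in> N}" for N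
  have BM: "b \<in> B \<Longrightarrow> b \<in> carr M" for b using B by blast
  have \<psi>_add: "\<psi> (c + d) = \<psi> c + \<psi> d" for c d
    by (simp add: \<psi>_def scale_left_distrib moduleD[OF M] BM sum.distrib)
  have \<psi>_scale: "\<psi> (fun_scale k c) = act M (scale k 1) (\<psi> c)" for k c
  proof -
    have "scale (k * x) 1 = scale k 1 \<odot> scale x 1" for x by (simp add: mul_scale)
    then show ?thesis
      unfolding \<psi>_def by (subst module_sum(2)[OF M]) (simp_all add: moduleD[OF M] BM)
  qed
  have \<psi>_0: "\<psi> 0 = 0" by (simp add: \<psi>_def module_more[OF M] BM)
  have U: "fun_space.subspace (U N)" if "submodule N M" for N
    using submoduleD[OF that] by (auto simp: fun_space.subspace_def U_def \<psi>_0 \<psi>_add \<psi>_scale)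
  let ?\<mu> = "\<lambda>N. fun_space.dim (U N)"
  let ?W = "(\<lambda>b x. if x = b then 1 else 0 :: 'k) ` B"
  have USW: "U N \<subseteq> fun_space.span ?W" for N
  proof
    fix c assume c: "c \<in> U N"
    have "c = (\<Sum>b\<in>B. fun_scale (c b) (\<lambda>x. if x = b then 1 else 0))"
      using c B(1) by (auto simp: fun_eq_iff sum_fun_apply U_def if_distrib[of "(*) _"] cong: if_cong)
    then show "c \<in> fun_space.span ?W"
      by (metis (no_types, lifting) fun_space.span_base fun_space.span_scale fun_space.span_sum imageI)
  qed
  have fin: "finite I" "card I \<le> card T" if "fun_space.independent I" "I \<subseteq> fun_space.span T" "finite T" for I T :: "('m \<Rightarrow> 'k) set"
    using fun_space.independent_span_bound[OF that(3,1,2)] by auto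
  have "?\<mu> N \<le> card B" for N
    using fun_space.dim_le_card[OF USW, of N] card_image_le[OF B(1)] B(1) by (meson finite_imageI le_trans)
  moreover have "?\<mu> N < ?\<mu> L" if N: "submodule N M" and L: "submodule L M" and NL: "N \<subset> L" for N L
  proof -
    obtain x where x: "x \<in> L" "x \<notin> N" using NL by blast
    obtain c where c: "x = (\<Sum>b\<in>B. act M (scale (c b) 1) b)" using sp submoduleD(1)[OF L x(1)] by blast
    let ?c = "\<lambda>b. if b \<in> B then c b else 0"
    have "\<psi> ?c = x" unfolding \<psi>_def c by simp
    then have cU: "?c \<in> U L" "?c \<notin> U N" using x by (auto simp: U_def)
    obtain I where I: "I \<subseteq> U N" "fun_space.independent I" "U N \<subseteq> fun_space.span I" "card I = ?\<mu> N"
      by (rule fun_space.basis_exists)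
    obtain I' where I': "I' \<subseteq> U L" "fun_space.independent I'" "U L \<subseteq> fun_space.span I'" "card I' = ?\<mu> L"
      by (rule fun_space.basis_exists)
    have finW: "finite ?W" using B(1) by simp
    have finI: "finite I" "finite I'"
      using fin[OF I(2) _ finW] fin[OF I'(2) _ finW] I(1) I'(1) USW by blast+
    have "fun_space.span I \<subseteq> U N" by (rule fun_space.span_minimal[OF I(1) U[OF N]])
    then have c: "?c \<notin> fun_space.span I" using cU by blast
    then have ind: "fun_space.independent (insert ?c I)" using I(2) by (rule fun_space.independent_insertI)
    have "U N \<subseteq> U L" using NL by (auto simp: U_def)
    then have "insert ?c I \<subseteq> fun_space.span I'" using I(1) cU I'(3) by blast
    then have "card (insert ?c I) \<le> card I'" using fin(2)[OF ind _ finI(2)] by blast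
    moreover have "card (insert ?c I) = Suc (card I)"
      using c finI(1) fun_space.span_base by (metis card_insert_disjoint)
    ultimately show ?thesis using I(4) I'(4) by simp
  qed
  ultimately show ?thesis by (intro exI[of _ ?\<mu>]) blast
qed

lemma fd_module_measure:
  fixes M :: "('h, 'm::ab_group_add) rep_module"
  assumes M: "module_over mul M" and fd: "fd_module scale M"
  obtains \<mu> :: "'m set \<Rightarrow> nat"
  where "\<And>N L. submodule N M \<Longrightarrow> submodule L M \<Longrightarrow> N \<subset> L \<Longrightarrow> \<mu> N < \<mu> L"
proof -
  obtain B where "finite B" "B \<subseteq> carr M" "\<forall>x\<in>carr M. \<exists>c. x = (\<Sum>b\<in>B. act M (scale (c b) 1) b)"
    using fd by (auto simp: fd_module_def)
  then obtain \<mu> :: "'m set \<Rightarrow> nat" where "\<forall>N L. submodule N M \<and> submodule L M \<and> N \<subset> L \<longrightarrow> \<mu> N < \<mu> L"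
    using submodule_measure[OF M, of B] by auto
  then show thesis using that[of \<mu>] by simp
qed

text \<open>Images and kernels of the powers stabilise; from then on kernel and image of \<theta>^k
  are complementary, so one of them is 0.\<close>

lemma fitting:
  fixes M :: "('h, 'm::ab_group_add) rep_module"
  assumes M: "module_over mul M" and fd: "fd_module scale M" and ind: "indecomposable M"
    and \<theta>: "module_hom M M \<theta>"
  shows "(\<exists>k. \<forall>x\<in>carr M. (\<theta> ^^ k) x = 0) \<or> bij_betw \<theta> (carr M) (carr M)"
proof -
  obtain \<mu> :: "'m set \<Rightarrow> nat" where \<mu>: "\<And>N L. submodule N M \<Longrightarrow> submodule L M \<Longrightarrow> N \<subset> L \<Longrightarrow> \<mu> N < \<mu> L"
    by (rule fd_module_measure[OF M fd], rule that)
  define I where "I k = (\<theta> ^^ k) ` carr M" for k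
  define Z where "Z k = {x \<in> carr M. (\<theta> ^^ k) x = 0}" for k
  note h = module_hom_funpow[OF \<theta>] 
  note hD = module_homD[OF h] module_hom_more[OF M M h]
  have subI: "submodule (I k) M" for k
    unfolding I_def by (rule submodule_image[OF M M h submodule_self[OF M]])
  have subZ: "submodule (Z k) M" for k
    using submodule_preimage[OF M M h submodule_zero[OF M]] by (simp add: Z_def)
  have I_mono: "I (j + k) \<subseteq> I j" for j k
    unfolding I_def using hD(1) by (auto simp: funpow_add)
  have Z_mono: "Z j \<subseteq> Z (k + j)" for j k
    unfolding Z_def using hD(4) by (auto simp: funpow_add)
  obtain a where a: "\<And>j. \<mu> (I a) \<le> \<mu> (I j)"
    using ex_has_least_nat[of "\<lambda>_. True" 0 "\<lambda>k. \<mu> (I k)"] by blast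
  have Ia: "I (a + k) = I a" for k
    using I_mono[of a k] \<mu>[OF subI subI, of "a + k" a] a[of "a + k"] by fastforce
  have "\<mu> (Z j) \<le> \<mu> (carr M)" for j
    using \<mu>[OF subZ submodule_self[OF M], of j] submoduleD(1)[OF subZ[of j]]
    by (metis less_imp_le order.refl psubsetI subsetI)
  then obtain b where b: "\<And>j. \<mu> (Z j) \<le> \<mu> (Z b)"
    using ex_has_greatest_nat[of "\<lambda>_. True" 0 "\<lambda>k. \<mu> (Z k)" "Suc (\<mu> (carr M))"]
    by (auto simp: less_Suc_eq_le)
  have Zb: "Z (k + b) = Z b" for k
    using Z_mono[of b k] \<mu>[OF subZ subZ, of b "k + b"] b[of "k + b"] by fastforce
  \<comment> \<open>Past both points of stabilisation; the extra 1 guarantees a factor \<theta> in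
    \<theta>^k, from which injectivity and surjectivity of \<theta> itself are read off.\<close>
  define k where "k = Suc (a + b)"
  have Ik: "I (k + k) = I k" using Ia[of "Suc b + k"] Ia[of "Suc b"] by (simp add: k_def algebra_simps)
  have Zk: "Z (k + k) = Z k" using Zb[of "Suc a + k"] Zb[of "Suc a"] by (simp add: k_def algebra_simps)
  have ds: "direct_sum M (Z k) (I k)"
    unfolding direct_sum_def
  proof (intro conjI subZ subI equalityI subsetI)
    fix x assume x: "x \<in> Z k \<inter> I k"
    then obtain y where y: "y \<in> carr M" "x = (\<theta> ^^ k) y" by (auto simp: I_def)
    then have "y \<in> Z (k + k)" using x by (simp add: Z_def funpow_add)
    then have "y \<in> Z k" using Zk by simp
    then show "x \<in> {0}" using y by (simp add: Z_def)
  next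
    fix x :: 'm assume "x \<in> {0}"
    then show "x \<in> Z k \<inter> I k" using submoduleD(2)[OF subI] submoduleD(2)[OF subZ] by simp
  next
    fix x assume "x \<in> {x + y | x y. x \<in> Z k \<and> y \<in> I k}"
    then show "x \<in> carr M"
      using submoduleD(1)[OF subI] submoduleD(1)[OF subZ] moduleD(2)[OF M] by blast
  next
    fix x assume x: "x \<in> carr M"
    then have "(\<theta> ^^ k) x \<in> I (k + k)" unfolding Ik by (simp add: I_def)
    then obtain y where y: "y \<in> carr M" "(\<theta> ^^ k) x = (\<theta> ^^ k) ((\<theta> ^^ k) y)"
      by (auto simp: I_def funpow_add)
    then have "x - (\<theta> ^^ k) y \<in> Z k"
      using x by (simp add: Z_def hD module_more[OF M])
    moreover have "(\<theta> ^^ k) y \<in> I k" using y by (simp add: I_def)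
    moreover have "x = (x - (\<theta> ^^ k) y) + (\<theta> ^^ k) y" by simp
    ultimately show "x \<in> {x + y | x y. x \<in> Z k \<and> y \<in> I k}" by blast
  qed
  have "I k = carr M" if "Z k = {0}"
  proof -
    have "carr M = {x + y | x y. x \<in> Z k \<and> y \<in> I k}" using ds by (simp add: direct_sum_def)
    then show ?thesis using that by simp
  qed
  moreover have "Z k = {0} \<or> I k = {0}"
    using ind ds unfolding indecomposable_iff by blast
  ultimately consider "I k = {0}" | "Z k = {0}" "I k = carr M" by blast
  then show ?thesis
  proof cases
    case 1
    then have "\<forall>x\<in>carr M. (\<theta> ^^ k) x = 0" by (auto simp: I_def)
    then show ?thesis by blast
  next
    case 2
    have "inj_on \<theta> (carr M)"
    proof (rule inj_onI)
      fix x y assume xy: "x \<in> carr M" "y \<in> carr M" "\<theta> x = \<theta> y"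
      then have "\<theta> (x - y) = 0" using module_hom_more(3)[OF M M \<theta>] by simp
      then have "(\<theta> ^^ k) (x - y) = 0"
        using hD(4)[of "a + b"] by (simp add: k_def funpow_swap1[symmetric] funpow_Suc_right del: funpow.simps)
      then have "x - y \<in> Z k" using xy by (simp add: Z_def module_more[OF M])
      then show "x = y" using 2 by simp
    qed
    moreover have "\<theta> ` carr M = carr M"
    proof
      show "\<theta> ` carr M \<subseteq> carr M" using module_homD(1)[OF \<theta>] by blast
      have "I k \<subseteq> \<theta> ` carr M" using hD(1) by (auto simp: I_def k_def)
      then show "carr M \<subseteq> \<theta> ` carr M" using 2 by simp
    qed
    ultimately show ?thesis by (simp add: bij_betw_def)
  qed
qed

text \<open>The endomorphism ring is local. After composition with the inverse u of the sum, the two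
  maps add up to the identity. If the first is nilpotent, the second has zero kernel, so it is not
  nilpotent, and Fitting's lemma makes it bijective.\<close>

lemma bij_summand:
  assumes M: "module_over mul M" and fd: "fd_module scale M" and ind: "indecomposable M"
    and \<theta>: "module_hom M M \<theta>" and \<eta>: "module_hom M M \<eta>"
    and bij: "bij_betw (\<lambda>x. \<theta> x + \<eta> x) (carr M) (carr M)"
  shows "bij_betw \<theta> (carr M) (carr M) \<or> bij_betw \<eta> (carr M) (carr M)"
proof -
  let ?s = "\<lambda>x. \<theta> x + \<eta> x"
  note D = moduleD[OF M] module_more[OF M]
  have s: "module_hom M M ?s"
    by (rule module_homI) (auto simp: D module_homD[OF \<theta>] module_homD[OF \<eta>])
  obtain u where u: "module_hom M M u" "\<And>x. x \<in> carr M \<Longrightarrow> u (?s x) = x" "\<And>x. x \<in> carr M \<Longrightarrow> ?s (u x) = x"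
    by (rule module_iso_inverse[OF M s bij], rule that)
  have lift: "bij_betw \<tau> (carr M) (carr M)"
    if "module_hom M M \<tau>" "bij_betw (\<lambda>x. u (\<tau> x)) (carr M) (carr M)" for \<tau>
  proof -
    have "bij_betw (?s \<circ> (\<lambda>x. u (\<tau> x))) (carr M) (carr M)"
      using that(2) bij by (rule bij_betw_trans)
    then show ?thesis
      by (rule bij_betw_cong[THEN iffD1, rotated]) (simp add: u(3) module_homD(1)[OF that(1)])
  qed
  let ?\<alpha> = "\<lambda>x. u (\<theta> x)" and ?\<beta> = "\<lambda>x. u (\<eta> x)"
  have \<alpha>: "module_hom M M ?\<alpha>" and \<beta>: "module_hom M M ?\<beta>"
    using \<theta> \<eta> u(1) by (auto intro: rep_module_hom_comp)
  have sum: "?\<alpha> x + ?\<beta> x = x" if "x \<in> carr M" for x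
    using u(2)[OF that] that by (simp add: module_homD[OF u(1)] module_homD[OF \<theta>] module_homD[OF \<eta>])
  from fitting[OF M fd ind \<alpha>] show ?thesis
  proof
    assume "\<exists>k. \<forall>x\<in>carr M. (?\<alpha> ^^ k) x = 0"
    then obtain k where k: "\<And>x. x \<in> carr M \<Longrightarrow> (?\<alpha> ^^ k) x = 0" by blast
    have ker: "x = 0" if x: "x \<in> carr M" "?\<beta> x = 0" for x
    proof -
      have "?\<alpha> x = x" using sum[OF x(1)] x(2) by simp
      then have "(?\<alpha> ^^ k) x = x" by (induction k) simp_all
      then show ?thesis using k[OF x(1)] by simp
    qed
    have "\<not> (\<exists>j. \<forall>x\<in>carr M. (?\<beta> ^^ j) x = 0)"
    proof
      assume "\<exists>j. \<forall>x\<in>carr M. (?\<beta> ^^ j) x = 0"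
      then obtain j where j: "\<And>x. x \<in> carr M \<Longrightarrow> (?\<beta> ^^ j) x = 0" by blast
      have "x = 0" if "x \<in> carr M" "(?\<beta> ^^ j) x = 0" for x
        using that
      proof (induction j)
        case (Suc j)
        then show ?case using ker module_homD(1)[OF module_hom_funpow[OF \<beta>]] by simp
      qed simp
      then have "carr M = {0}" using j D(1) by blast
      then show False using ind by (simp add: indecomposable_iff)
    qed
    then show ?thesis using fitting[OF M fd ind \<beta>] lift[OF \<eta>] by blast
  qed (use lift[OF \<theta>] in blast)
qed

lemma bij_summand_sum:
  assumes M: "module_over mul M" and fd: "fd_module scale M" and ind: "indecomposable M"
    and "finite I" and "\<And>i. i \<in> I \<Longrightarrow> module_hom M M (\<theta> i)"
    and "bij_betw (\<lambda>x. \<Sum>i\<in>I. \<theta> i x) (carr M) (carr M)"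
  shows "\<exists>i\<in>I. bij_betw (\<theta> i) (carr M) (carr M)"
  using assms(4-)
proof (induction I rule: finite_induct)
  case empty
  then have "carr M = {0}" using moduleD(1)[OF M] by (auto simp: bij_betw_def image_constant_conv split: if_splits)
  then show ?case using ind by (simp add: indecomposable_iff)
next
  case (insert i I)
  have \<theta>: "\<theta> j x \<in> carr M" "\<theta> j (x + y) = \<theta> j x + \<theta> j y" "\<theta> j (act M r x) = act M r (\<theta> j x)"
    if "j \<in> I" "x \<in> carr M" "y \<in> carr M" for j x y r
    using module_homD[OF insert.prems(1)[of j]] that by auto
  have "module_hom M M (\<lambda>x. \<Sum>i\<in>I. \<theta> i x)"
  proof (rule module_homI)
    fix x y assume "x \<in> carr M" "y \<in> carr M"
    then show "(\<Sum>i\<in>I. \<theta> i (x + y)) = (\<Sum>i\<in>I. \<theta> i x) + (\<Sum>i\<in>I. \<theta> i y)"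
      by (simp add: \<theta> sum.distrib)
  next
    fix x r assume x: "x \<in> carr M"
    then show "(\<Sum>i\<in>I. \<theta> i (act M r x)) = act M r (\<Sum>i\<in>I. \<theta> i x)"
      using x by (subst module_sum(2)[OF M]) (simp_all add: \<theta>)
  qed (auto intro: module_sum(1)[OF M] \<theta>)
  moreover have "bij_betw (\<lambda>x. \<theta> i x + (\<Sum>i\<in>I. \<theta> i x)) (carr M) (carr M)"
    using insert.prems(2) insert.hyps by simp
  ultimately show ?case
    using bij_summand[OF M fd ind insert.prems(1)[of i]] insert.IH insert.prems(1) by blast
qed

end

section \<open>Composition series and uniserial projectives\<close>

definition covers :: "('h::ring_1, 'm::ab_group_add) rep_module \<Rightarrow> 'm set \<Rightarrow> 'm set \<Rightarrow> bool" where
  "covers M N L \<longleftrightarrow> N \<subset> L \<and> (\<forall>X. submodule X M \<and> N \<subseteq> X \<and> X \<subseteq> L \<longrightarrow> X = N \<or> X = L)"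

definition series_between ::
  "('h::ring_1, 'm::ab_group_add) rep_module \<Rightarrow> 'm set \<Rightarrow> 'm set \<Rightarrow> 'm set list \<Rightarrow> bool" where
  "series_between M A B Ns \<longleftrightarrow> Ns \<noteq> [] \<and> hd Ns = A \<and> last Ns = B \<and> (\<forall>N\<in>set Ns. submodule N M) \<and>
     successively (covers M) Ns"

lemma composition_series_iff: "composition_series M Ns \<longleftrightarrow> series_between M {0} (carr M) Ns"
  by (simp add: composition_series_def series_between_def successively_conv_nth covers_def)

lemma series_append:
  assumes "series_between M A B Ns" "series_between M B C Ls"
  shows "series_between M A C (Ns @ tl Ls)"
proof -
  obtain Ls' where Ls: "Ls = B # Ls'" using assms(2) by (cases Ls) (auto simp: series_between_def)
  show ?thesis
    using assms unfolding series_between_def Ls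
    by (cases Ls') (auto simp: successively_append_iff successively_Cons)
qed

lemma series_strict_sorted: "series_between M A B Ns \<Longrightarrow> sorted_wrt (\<subset>) Ns"
proof -
  assume "series_between M A B Ns"
  then have "successively (\<subset>) Ns"
    unfolding series_between_def using successively_mono[of "covers M" Ns "(\<subset>)"] by (auto simp: covers_def)
  then show ?thesis by (simp add: successively_conv_sorted_wrt)
qed

lemma strict_sorted_unique:
  "sorted_wrt (\<subset>) xs \<Longrightarrow> sorted_wrt (\<subset>) ys \<Longrightarrow> set xs = set ys \<Longrightarrow> xs = (ys :: 'a set list)"
proof (induction xs arbitrary: ys)
  case (Cons x xs)
  obtain y ys' where ys: "ys = y # ys'" using Cons.prems(3) by (cases ys) auto
  have xy: "x = y"
  proof (rule ccontr)
    assume "x \<noteq> y"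
    then have "x \<in> set ys'" "y \<in> set xs" using Cons.prems(3) ys by auto
    then show False using Cons.prems(1,2) ys by auto
  qed
  moreover have "x \<notin> set xs" "y \<notin> set ys'" using Cons.prems(1,2) ys by auto
  ultimately have "set xs = set ys'" using Cons.prems(3) ys by auto
  then show ?case using Cons.IH[of ys'] Cons.prems(1,2) ys xy by simp
qed auto

text \<open>At the first step where the series is no longer inside N, comparability squeezes N
  between two neighbours.\<close>

lemma series_contains:
  assumes "\<And>X Y. submodule X M \<Longrightarrow> submodule Y M \<Longrightarrow> X \<subseteq> Y \<or> Y \<subseteq> X" and N: "submodule N M"
  shows "series_between M A B Ns \<Longrightarrow> A \<subseteq> N \<Longrightarrow> N \<subseteq> B \<Longrightarrow> N \<in> set Ns"
proof (induction Ns arbitrary: A)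
  case (Cons x Ns)
  show ?case
  proof (cases Ns)
    case Nil
    then show ?thesis using Cons.prems by (auto simp: series_between_def)
  next
    case (Cons y Ls)
    have x: "x = A" "covers M x y" "series_between M y B Ns" "submodule y M"
      using Cons.prems(1) unfolding Cons by (auto simp: series_between_def)
    show ?thesis
    proof (cases "y \<subseteq> N")
      case True
      then show ?thesis using Cons.IH[OF x(3)] Cons.prems(3) by simp
    next
      case False
      then have "N \<subseteq> y" using assms(1)[OF N x(4)] by blast
      then have "N = x \<or> N = y" using x(1,2) Cons.prems(2) N by (auto simp: covers_def)
      then show ?thesis using Cons by auto
    qed
  qed
qed (simp add: series_between_def)

context fd_algebra begin

text \<open>Peel off from B a proper submodule over A of greatest measure; strict monotonicity
  leaves nothing between it and B.\<close>

lemma series_exists: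
  assumes \<mu>: "\<And>N L. submodule N M \<Longrightarrow> submodule L M \<Longrightarrow> N \<subset> L \<Longrightarrow> (\<mu> N :: nat) < \<mu> L"
    and A: "submodule A M"
  shows "submodule B M \<Longrightarrow> A \<subseteq> B \<Longrightarrow> \<exists>Ns. series_between M A B Ns"
proof (induction "\<mu> B" arbitrary: B rule: less_induct)
  case less
  show ?case
  proof (cases "A = B")
    case True
    then show ?thesis using A by (intro exI[of _ "[A]"]) (simp add: series_between_def)
  next
    case False
    let ?P = "\<lambda>C. submodule C M \<and> A \<subseteq> C \<and> C \<subset> B"
    have "?P A" using A less.prems False by auto
    moreover have "\<forall>C. ?P C \<longrightarrow> \<mu> C < \<mu> B" using \<mu> less.prems by blast
    ultimately obtain C where C: "?P C" "\<forall>D. ?P D \<longrightarrow> \<mu> D \<le> \<mu> C"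
      using ex_has_greatest_nat[of ?P A \<mu> "\<mu> B"] by blast
    have cov: "covers M C B"
      unfolding covers_def
    proof (intro conjI allI impI)
      fix X assume X: "submodule X M \<and> C \<subseteq> X \<and> X \<subseteq> B"
      show "X = C \<or> X = B"
      proof (rule ccontr)
        assume "\<not> (X = C \<or> X = B)"
        then have "?P X" "C \<subset> X" using X C(1) by auto
        then show False using C(2) \<mu>[of C X] C(1) by (meson leD)
      qed
    qed (use C in blast)
    obtain Ns where "series_between M A C Ns"
      using less.hyps[of C] \<mu>[of C B] C(1) less.prems by blast
    moreover have "series_between M C B [C, B]"
      using cov C(1) less.prems by (simp add: series_between_def)
    ultimately show ?thesis using series_append by blast
  qed
qed

text \<open>Under comparability every series consists of all submodules, and a strict chain is
  determined by its set of members.\<close>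

lemma unique_composition_seriesI:
  fixes M :: "('h, 'm::ab_group_add) rep_module"
  assumes M: "module_over mul M" and fd: "fd_module scale M"
    and chain: "\<And>X Y. submodule X M \<Longrightarrow> submodule Y M \<Longrightarrow> X \<subseteq> Y \<or> Y \<subseteq> X"
  shows "\<exists>!Ns. composition_series M Ns"
proof -
  obtain \<mu> :: "'m set \<Rightarrow> nat" where \<mu>: "\<And>N L. submodule N M \<Longrightarrow> submodule L M \<Longrightarrow> N \<subset> L \<Longrightarrow> \<mu> N < \<mu> L"
    by (rule fd_module_measure[OF M fd], rule that)
  have "\<exists>Ns. series_between M {0} (carr M) Ns"
    by (rule series_exists[of M \<mu>, OF \<mu> submodule_zero[OF M] submodule_self[OF M]])
      (use moduleD(1)[OF M] in auto)
  moreover have "set Ns = {N. submodule N M}" if "series_between M {0} (carr M) Ns" for Ns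
  proof (intro equalityI subsetI)
    fix N assume "N \<in> {N. submodule N M}"
    then show "N \<in> set Ns"
      using series_contains[OF chain _ that, of N] by (auto simp: submodule_def)
  qed (use that in \<open>auto simp: series_between_def\<close>)
  ultimately show ?thesis
    unfolding composition_series_iff using strict_sorted_unique series_strict_sorted by metis
qed

text \<open>Every submodule X lies on some composition series, joined from one up to X and one above
  X; uniqueness puts all submodules on one finite chain.\<close>

lemma unique_composition_seriesD:
  fixes M :: "('h, 'm::ab_group_add) rep_module"
  assumes M: "module_over mul M" and fd: "fd_module scale M" and uniq: "\<exists>!Ns. composition_series M Ns"
  shows "submodule X M \<Longrightarrow> submodule Y M \<Longrightarrow> X \<subseteq> Y \<or> Y \<subseteq> X" "finite {N. submodule N M}"
proof -
  obtain \<mu> :: "'m set \<Rightarrow> nat" where \<mu>: "\<And>N L. submodule N M \<Longrightarrow> submodule L M \<Longrightarrow> N \<subset> L \<Longrightarrow> \<mu> N < \<mu> L"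
    by (rule fd_module_measure[OF M fd], rule that)
  obtain Ns where Ns: "series_between M {0} (carr M) Ns" "\<And>Ls. series_between M {0} (carr M) Ls \<Longrightarrow> Ls = Ns"
    using uniq unfolding composition_series_iff by blast
  have mem: "X \<in> set Ns" if X: "submodule X M" for X
  proof -
    have X': "{0} \<subseteq> X" "X \<subseteq> carr M" using X by (auto simp: submodule_def)
    obtain As where As: "series_between M {0} X As"
      using series_exists[of M \<mu>, OF \<mu> submodule_zero[OF M] X X'(1)] by blast
    obtain Bs where Bs: "series_between M X (carr M) Bs"
      using series_exists[of M \<mu>, OF \<mu> X submodule_self[OF M] X'(2)] by blast
    have "As @ tl Bs = Ns" by (rule Ns(2)[OF series_append[OF As Bs]])
    moreover have "X \<in> set As" using As by (auto simp: series_between_def)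
    ultimately show ?thesis by auto
  qed
  have "sorted_wrt (\<subset>) Ns" by (rule series_strict_sorted[OF Ns(1)])
  then have *: "x \<subseteq> y \<or> y \<subseteq> x" if "x \<in> set Ns" "y \<in> set Ns" for x y
    using that by (induction Ns) auto
  show "submodule X M \<Longrightarrow> submodule Y M \<Longrightarrow> X \<subseteq> Y \<or> Y \<subseteq> X" using * mem by simp
  show "finite {N. submodule N M}" by (rule finite_subset[of _ "set Ns"]) (auto intro: mem)
qed

definition regular :: "('h, 'h) rep_module" where
  "regular = \<lparr>carr = UNIV, act = mul\<rparr>"

lemma regular_module: "module_over mul regular"
  unfolding module_over_def regular_def by (simp add: mul_add mul_assoc)

text \<open>The usual splitting of a free cover H^B -> P. Lifting is available only for modules
  inside \<open>nat \<Rightarrow>\<^sub>0 'k\<close>, so the free module \<open>F\<close> is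
  replaced by a copy \<open>N\<close> there, and coordinates are read off after transport back along
  \<open>g\<close>.\<close>

lemma projective_dual_basis:
  fixes P :: "('h, nat \<Rightarrow>\<^sub>0 'k) rep_module"
  assumes P: "module_over mul P" and fd: "fd_module scale P" and proj: "projective mul P"
  obtains B h where "finite B" "B \<subseteq> carr P" "\<And>b. b \<in> B \<Longrightarrow> module_hom P regular (h b)"
    "\<And>z. z \<in> carr P \<Longrightarrow> z = (\<Sum>b\<in>B. act P (h b z) b)"
proof -
  obtain B where B: "finite B" "B \<subseteq> carr P" "\<And>x. x \<in> carr P \<Longrightarrow> \<exists>c. x = (\<Sum>b\<in>B. act P (scale (c b) 1) b)"
    using fd by (auto simp: fd_module_def)
  have BP: "b \<in> B \<Longrightarrow> b \<in> carr P" for b using B(2) by blast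
  define F :: "('h, (nat \<Rightarrow>\<^sub>0 'k) \<Rightarrow> 'h) rep_module"
    where "F = \<lparr>carr = {p. \<forall>x. x \<notin> B \<longrightarrow> p x = 0}, act = (\<lambda>r p x. r \<odot> p x)\<rparr>"
  have F: "module_over mul F"
    unfolding module_over_def F_def by (auto simp: fun_eq_iff mul_add mul_assoc)
  have fdF: "fd_module scale F"
  proof (rule fd_moduleI[OF F, of "B \<times> Basis" "\<lambda>(b, a) x. if x = b then a else 0"])
    show "finite (B \<times> Basis)" using B(1) finite_Basis by simp
    show "(case i of (b, a) \<Rightarrow> \<lambda>x. if x = b then a else 0) \<in> carr F" if "i \<in> B \<times> Basis" for i
      using that by (auto simp: F_def)
    fix p assume p: "p \<in> carr F"
    let ?c = "\<lambda>(b, a). representation Basis (p b) a"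
    have "p = (\<Sum>i\<in>B \<times> Basis. act F (scale (?c i) 1) ((\<lambda>(b, a) x. if x = b then a else 0) i))"
    proof
      fix x
      have "(\<Sum>i\<in>B \<times> Basis. act F (scale (?c i) 1) ((\<lambda>(b, a) x. if x = b then a else 0) i)) x =
          (\<Sum>(b, a)\<in>B \<times> Basis. if x = b then scale (representation Basis (p b) a) a else 0)"
        unfolding sum_fun_apply F_def
        by (intro sum.cong refl) (auto simp: mul_scale)
      also have "\<dots> = (\<Sum>b\<in>B. \<Sum>a\<in>Basis. if x = b then scale (representation Basis (p b) a) a else 0)"
        by (rule sum.cartesian_product[symmetric])
      also have "\<dots> = (\<Sum>b\<in>B. if x = b then p b else 0)"
        using sum_representation_eq[OF independent_Basis _ finite_Basis] span_Basis
        by (intro sum.cong refl) simp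
      also have "\<dots> = p x" using p B(1) by (simp add: F_def)
      finally show "p x = (\<Sum>i\<in>B \<times> Basis. act F (scale (?c i) 1) ((\<lambda>(b, a) x. if x = b then a else 0) i)) x" ..
    qed
    then show "\<exists>c. p = (\<Sum>i\<in>B \<times> Basis. act F (scale (c i) 1) (case i of (b, a) \<Rightarrow> \<lambda>x. if x = b then a else 0))"
      by (rule exI[of _ ?c])
  qed
  obtain N :: "('h, nat \<Rightarrow>\<^sub>0 'k) rep_module"
    where N: "module_over mul N" "isomorphic F N"
    using fd_module_in_universe[OF k_algebra_axioms mul F fdF] by blast
  obtain f where f: "module_hom F N f" "bij_betw f (carr F) (carr N)"
    using N(2) by (auto simp: isomorphic_def)
  obtain g where g: "module_hom N F g" "bij_betw g (carr N) (carr F)"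
    by (rule module_iso_inverse[OF F f])
  define G where "G p = (\<Sum>b\<in>B. act P (p b) b)" for p
  have G: "module_hom F P G"
  proof (rule module_homI)
    fix p q assume "p \<in> carr F" "q \<in> carr F"
    show "G p \<in> carr P" unfolding G_def by (intro module_sum(1)[OF P] moduleD(4)[OF P] BP)
    show "G (p + q) = G p + G q"
      by (simp add: G_def moduleD[OF P] BP sum.distrib)
    show "G (act F r p) = act P r (G p)" for r
      unfolding G_def by (subst module_sum(2)[OF P]) (simp_all add: F_def moduleD[OF P] BP)
  qed
  have surj: "(\<lambda>x. G (g x)) ` carr N = carr P"
  proof (intro equalityI subsetI)
    fix x assume "x \<in> carr P"
    then obtain c where c: "x = (\<Sum>b\<in>B. act P (scale (c b) 1) b)" using B(3) by blast
    let ?p = "\<lambda>b. if b \<in> B then scale (c b) 1 else 0"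
    have "?p \<in> carr F" by (simp add: F_def)
    then have "?p \<in> g ` carr N" using g(2) by (simp only: bij_betw_def)
    then obtain y where y: "?p = g y" "y \<in> carr N" by (rule imageE)
    have "G ?p = x" by (simp add: G_def c)
    then show "x \<in> (\<lambda>x. G (g x)) ` carr N" using y by (intro image_eqI[of _ _ y]) simp_all
  qed (use module_homD(1)[OF G] module_homD(1)[OF g(1)] in auto)
  obtain l where l: "module_hom P N l" "\<forall>x\<in>carr P. G (g (l x)) = x"
    using proj[unfolded projective_def, rule_format, of N P "\<lambda>x. G (g x)" "\<lambda>x. x"] N(1) P surj
      rep_module_hom_comp[OF g(1) G] rep_module_hom_id by blast
  have gl: "module_hom P F (\<lambda>z. g (l z))" by (rule rep_module_hom_comp[OF l(1) g(1)])
  show thesis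
  proof (rule that[of B "\<lambda>b z. g (l z) b"])
    show "module_hom P regular (\<lambda>z. g (l z) b)" for b
      by (rule module_homI) (auto simp: regular_def module_homD[OF gl], auto simp: F_def)
    show "z = (\<Sum>b\<in>B. act P (g (l z) b) b)" if "z \<in> carr P" for z
      using l(2) that by (simp add: G_def)
  qed (use B in auto)
qed

text \<open>The identity is the sum of the endomorphisms z |-> h_b(z) b, so one of them is bijective
  by locality; precomposing with its inverse gives h with h(z) x = z. Thus h identifies P with H
  h(x), and h(x) is idempotent.\<close>

lemma projective_indecomposable_cyclic:
  fixes P :: "('h, nat \<Rightarrow>\<^sub>0 'k) rep_module"
  assumes P: "module_over mul P" and fd: "fd_module scale P" and proj: "projective mul P"
    and ind: "indecomposable P"
  obtains x h where "x \<in> carr P" "module_hom P regular h" "\<And>z. z \<in> carr P \<Longrightarrow> act P (h z) x = z"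
proof -
  obtain B h where B: "finite B" "B \<subseteq> carr P" "\<And>b. b \<in> B \<Longrightarrow> module_hom P regular (h b)"
    "\<And>z. z \<in> carr P \<Longrightarrow> z = (\<Sum>b\<in>B. act P (h b z) b)"
    by (rule projective_dual_basis[OF P fd proj], rule that)
  have hom: "module_hom P P (\<lambda>z. act P (h b z) b)" if b: "b \<in> B" for b
  proof -
    have bP: "b \<in> carr P" using b B(2) by blast
    show ?thesis
      by (rule module_homI) (auto simp: module_homD[OF B(3)[OF b]] moduleD[OF P] bP, auto simp: regular_def moduleD[OF P] bP)
  qed
  have "bij_betw (\<lambda>z. \<Sum>b\<in>B. act P (h b z) b) (carr P) (carr P)"
    by (rule bij_betw_cong[THEN iffD1, of _ "\<lambda>z. z"]) (use B(4) in \<open>auto simp: bij_betw_def\<close>)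
  then have "\<exists>b\<in>B. bij_betw (\<lambda>z. act P (h b z) b) (carr P) (carr P)"
    by (intro bij_summand_sum[OF P fd ind B(1), of "\<lambda>b z. act P (h b z) b"] hom)
  then obtain b where b: "b \<in> B" "bij_betw (\<lambda>z. act P (h b z) b) (carr P) (carr P)"
    by (rule bexE)
  obtain u where u: "module_hom P P u" "\<And>y. y \<in> carr P \<Longrightarrow> act P (h b (u y)) b = y"
    by (rule module_iso_inverse[OF P hom[OF b(1)] b(2)], rule that)
  show thesis
    by (rule that[of b "\<lambda>z. h b (u z)"])
      (use b B(2) u rep_module_hom_comp[OF u(1) B(3)[OF b(1)]] in auto)
qed

text \<open>For y in N, the endomorphism z |-> h(z) y has its image in N, so it is not bijective and
  hence nilpotent. Its powers are z |-> h(z) h(y)^k x, which makes h(y) nilpotent; the same applies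
  to every a y in place of y.\<close>

lemma proper_submodule_radical:
  assumes P: "module_over mul P" and fd: "fd_module scale P" and ind: "indecomposable P"
    and x: "x \<in> carr P" and h: "module_hom P regular h" and hx: "\<And>z. z \<in> carr P \<Longrightarrow> act P (h z) x = z"
    and N: "submodule N P" "N \<noteq> carr P" and y: "y \<in> N"
  shows "h y \<in> nil_radical"
proof -
  note D = moduleD[OF P]
  have h_act: "h (act P r z) = r \<odot> h z" if "z \<in> carr P" for r z
    using module_homD(3)[OF h that] by (simp add: regular_def)
  have idem: "h z \<odot> h x = h z" if "z \<in> carr P" for z
    using h_act[OF x, of "h z"] hx[OF that] by simp
  have nil: "\<exists>k. h y ^ k = 0" if y: "y \<in> N" for y
  proof -
    have yP: "y \<in> carr P" by (rule submoduleD(1)[OF N(1) y])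
    let ?\<theta> = "\<lambda>z. act P (h z) y"
    have \<theta>: "module_hom P P ?\<theta>"
      by (rule module_homI) (auto simp: module_homD[OF h] D yP, auto simp: regular_def D yP)
    have "\<not> bij_betw ?\<theta> (carr P) (carr P)"
    proof
      assume "bij_betw ?\<theta> (carr P) (carr P)"
      then have "?\<theta> ` carr P = carr P" by (simp add: bij_betw_def)
      moreover have "?\<theta> ` carr P \<subseteq> N" using submoduleD(4)[OF N(1) y] by blast
      ultimately have "carr P \<subseteq> N" by simp
      then show False using N by (auto simp: submodule_def)
    qed
    then obtain k where k: "\<And>z. z \<in> carr P \<Longrightarrow> (?\<theta> ^^ k) z = 0"
      using fitting[OF P fd ind \<theta>] by blast
    have pow: "(?\<theta> ^^ k) z = act P (h z \<odot> h y ^ k) x" if z: "z \<in> carr P" for z k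
    proof (induction k)
      case (Suc k)
      let ?c = "h z \<odot> h y ^ k"
      \<comment> \<open>h(x) is a right unit for values of h: it is absorbed by h(z) if k = 0, and
        by the last factor h(y) otherwise.\<close>
      have "?c \<odot> h x = ?c"
      proof (cases k)
        case (Suc j)
        then have "?c = h z \<odot> (h y ^ j \<odot> h y)" by (simp add: mul_power)
        then show ?thesis using idem[OF yP] by (simp add: mul_assoc)
      qed (simp add: idem z)
      then have "(?\<theta> ^^ Suc k) z = act P ?c y" using Suc x by (simp add: h_act)
      also have "\<dots> = act P ?c (act P (h y) x)" using hx[OF yP] by simp
      also have "\<dots> = act P (h z \<odot> h y ^ Suc k) x"
        using x by (simp add: D(7)[symmetric] mul_assoc mul_power(2) del: power_Suc)
      finally show ?case .
    qed (simp add: hx z)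
    have "h (act P (h x \<odot> h y ^ k) x) = 0"
      using k[OF x] pow[OF x, of k] module_hom_more(1)[OF P regular_module h] by simp
    then have "h y \<odot> (h x \<odot> h y ^ k \<odot> h x) = 0" using x by (simp add: h_act)
    then have "h y ^ Suc k \<odot> h x = 0" using idem[OF yP] by (simp add: mul_assoc[symmetric] mul_power)
    then have "h y ^ k \<odot> (h y \<odot> h x) = 0" by (simp add: mul_assoc[symmetric] mul_power)
    then have "h y ^ Suc k = 0" using idem[OF yP] by (simp add: mul_power)
    then show ?thesis by blast
  qed
  show ?thesis
    unfolding nil_radical_iff
  proof
    fix a
    have "act P a y \<in> N" by (rule submoduleD(4)[OF N(1) y])
    from nil[OF this] show "\<exists>k. (a \<odot> h y) ^ k = 0"
      using h_act[OF submoduleD(1)[OF N(1) y]] by simp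
  qed
qed

lemma mul_power_add: "v ^ (i + j) = v ^ i \<odot> v ^ j"
proof (induction i)
  case (Suc i)
  have "v ^ (Suc i + j) = v \<odot> v ^ (i + j)" by (simp only: mul_power add_Suc)
  also have "\<dots> = (v \<odot> v ^ i) \<odot> v ^ j" by (simp only: Suc mul_assoc)
  finally show ?case by (simp only: mul_power)
qed simp

lemma power_normal:
  assumes "\<And>r. \<exists>r'. v \<odot> r = r' \<odot> v"
  shows "\<exists>r'. v ^ i \<odot> r = r' \<odot> v ^ i"
proof (induction i arbitrary: r)
  case (Suc i)
  obtain r1 where "v \<odot> r = r1 \<odot> v" using assms by blast
  moreover obtain r2 where "v ^ i \<odot> r1 = r2 \<odot> v ^ i" using Suc by blast
  ultimately have "v ^ Suc i \<odot> r = r2 \<odot> v ^ Suc i"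
    by (simp only: mul_power(2)[symmetric] mul_assoc) (simp add: mul_assoc[symmetric])
  then show ?case by blast
qed auto

theorem normal_generator_uniserial:
  fixes P :: "('h, nat \<Rightarrow>\<^sub>0 'k) rep_module"
  assumes v: "range (\<lambda>a. a \<odot> v) = nil_radical" "range (\<lambda>a. v \<odot> a) = nil_radical"
    and P: "module_over mul P" and fd: "fd_module scale P" and proj: "projective mul P"
    and ind: "indecomposable P"
  shows "\<exists>!Ns. composition_series P Ns"
proof (rule unique_composition_seriesI[OF P fd])
  note D = moduleD[OF P]
  obtain x h where x: "x \<in> carr P" "module_hom P regular h" "\<And>z. z \<in> carr P \<Longrightarrow> act P (h z) x = z"
    by (rule projective_indecomposable_cyclic[OF P fd proj ind], rule that)
  have "v \<odot> r \<in> range (\<lambda>a. a \<odot> v)" for r using v by blast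
  then have normal: "\<exists>r'. v \<odot> r = r' \<odot> v" for r by blast
  have "v \<in> nil_radical" using v(1) by (metis mul_one(1) rangeI)
  then obtain k where k: "v ^ k = 0" unfolding nil_radical_iff by (metis mul_one(1))
  define V where "V i = (\<lambda>z. act P (v ^ i) z) ` carr P" for i
  have V_mono: "V (i + j) \<subseteq> V i" for i j
  proof
    fix z assume "z \<in> V (i + j)"
    then obtain w where w: "w \<in> carr P" "z = act P (v ^ (i + j)) w" by (auto simp: V_def)
    then show "z \<in> V i" unfolding V_def using w D
      by (intro image_eqI[of _ _ "act P (v ^ j) w"]) (simp_all add: mul_power_add)
  qed
  have Vk: "V k = {0}" unfolding V_def using D(1) by (auto simp: k module_more[OF P])
  have sub: "\<exists>i. N = V i" if N: "submodule N P" for N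
  proof (cases "N = {0}")
    case True
    then show ?thesis using Vk by blast
  next
    case False
    have "i < k" if "N \<subseteq> V i" for i
    proof (rule ccontr)
      assume "\<not> i < k"
      then have "V i \<subseteq> V k" using V_mono[of k "i - k"] by simp
      then show False using that Vk False submoduleD(2)[OF N] by auto
    qed
    moreover have "N \<subseteq> V 0" using submoduleD(1)[OF N] D(8) by (force simp: V_def)
    ultimately obtain i where i: "N \<subseteq> V i" "\<And>j. N \<subseteq> V j \<Longrightarrow> j \<le> i"
      using ex_has_greatest_nat[of "\<lambda>i. N \<subseteq> V i" 0 "\<lambda>i. i" k] by auto
    \<comment> \<open>A submodule, because v^i H is contained in H v^i. If it were proper, h would
      map it into J = v H, so each of its elements z = h(z) x would lie in v P, and N in v^(i+1) P,
      against the choice of i. So it is P, and N = v^i P.\<close>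
    let ?N' = "{z \<in> carr P. act P (v ^ i) z \<in> N}"
    have N': "submodule ?N' P"
    proof (rule submoduleI)
      fix z r assume z: "z \<in> ?N'"
      obtain r' where "v ^ i \<odot> r = r' \<odot> v ^ i" using power_normal[OF normal] by blast
      then have "act P (v ^ i) (act P r z) = act P r' (act P (v ^ i) z)"
        using z by (simp add: D(7)[symmetric])
      then show "act P r z \<in> ?N'" using z D submoduleD(4)[OF N] by simp
    qed (use D submoduleD[OF N] in \<open>auto simp: module_more[OF P]\<close>)
    have "?N' = carr P"
    proof (rule ccontr)
      assume N'_ne: "?N' \<noteq> carr P"
      have "N \<subseteq> V (Suc i)"
      proof
        fix y assume y: "y \<in> N"
        then obtain z where z: "z \<in> carr P" "y = act P (v ^ i) z" using i(1) by (auto simp: V_def)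
        then have "z \<in> ?N'" using y by simp
        from proper_submodule_radical[OF P fd ind x N' N'_ne this]
        obtain a where a: "h z = v \<odot> a" using v(2) by blast
        have "z = act P v (act P a x)" using x(3)[OF z(1)] a x(1) by (simp add: D(7))
        then have "y = act P (v ^ Suc i) (act P a x)"
          using z(2) D(4)[OF x(1)] by (simp add: D(7)[symmetric] mul_power(2)[symmetric] del: power_Suc)
        then show "y \<in> V (Suc i)" unfolding V_def using D(4)[OF x(1)] by blast
      qed
      then show False using i(2)[of "Suc i"] by simp
    qed
    then have "V i \<subseteq> N" by (auto simp: V_def)
    then show ?thesis using i(1) by blast
  qed
  fix X Y assume "submodule X P" "submodule Y P"
  then obtain i j where ij: "X = V i" "Y = V j" using sub by blast
  have "V j \<subseteq> V i \<or> V i \<subseteq> V j"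
    using V_mono[of i "j - i"] V_mono[of j "i - j"] by (cases "i \<le> j") auto
  then show "X \<subseteq> Y \<or> Y \<subseteq> X" using ij by blast
qed

end

section \<open>Primitive idempotents\<close>

text \<open>Symmetric in left and right, so the same idempotents serve for right modules.\<close>

definition primitive_idempotent :: "'h::ring_1 \<Rightarrow> bool" where
  "primitive_idempotent e \<longleftrightarrow> e * e = e \<and> e \<noteq> 0 \<and>
     (\<forall>f. f * f = f \<and> e * f = f \<and> f * e = f \<longrightarrow> f = 0 \<or> f = e)"

lemma finite_chain_max:
  assumes "finite K" "K \<noteq> {}" "\<And>i j. i \<in> K \<Longrightarrow> j \<in> K \<Longrightarrow> F i \<subseteq> F j \<or> F j \<subseteq> F i"
  shows "\<exists>i\<in>K. \<forall>j\<in>K. F j \<subseteq> F i"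
  using assms
proof (induction K rule: finite_ne_induct)
  case (insert x K)
  then obtain i where i: "i \<in> K" "\<forall>j\<in>K. F j \<subseteq> F i" by blast
  have "F x \<subseteq> F i \<or> F i \<subseteq> F x" using insert.prems i(1) by blast
  then show ?case using i by blast
qed simp

text \<open>\<open>R\<close> is a relation and not a function, as M may have several descriptions c
  in C; a shared description forces equivalence.\<close>

lemma finite_quotientI:
  assumes "finite C" and "\<And>M. M \<in> X \<Longrightarrow> \<exists>c\<in>C. R c M"
    and "\<And>c M N. M \<in> X \<Longrightarrow> N \<in> X \<Longrightarrow> R c M \<Longrightarrow> R c N \<Longrightarrow> eq M N"
    and trans: "\<And>M N L. M \<in> X \<Longrightarrow> N \<in> X \<Longrightarrow> L \<in> X \<Longrightarrow> eq M N \<Longrightarrow> eq N L \<Longrightarrow> eq M L"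
  shows "finite (X // {(M, N) \<in> X \<times> X. eq M N})"
proof (rule finite_surj[OF assms(1)])
  show "X // {(M, N) \<in> X \<times> X. eq M N} \<subseteq> (\<lambda>c. {N \<in> X. \<exists>M\<in>X. R c M \<and> eq M N}) ` C"
  proof
    fix Q assume "Q \<in> X // {(M, N) \<in> X \<times> X. eq M N}"
    then obtain M where M: "M \<in> X" "Q = {N \<in> X. eq M N}" by (auto simp: quotient_def)
    obtain c where c: "c \<in> C" "R c M" using assms(2) M(1) by blast
    have "Q = {N \<in> X. \<exists>M\<in>X. R c M \<and> eq M N}"
      unfolding M(2) using assms(3)[OF M(1) _ c(2)] M(1) c(2) trans by blast
    then show "Q \<in> (\<lambda>c. {N \<in> X. \<exists>M\<in>X. R c M \<and> eq M N}) ` C" using c(1) by blast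
  qed
qed

section \<open>Left ideals generated by idempotents\<close>

context fd_algebra begin

lemma primitive_idempotent_iff:
  "primitive_idempotent e \<longleftrightarrow> e \<odot> e = e \<and> e \<noteq> 0 \<and>
     (\<forall>f. f \<odot> f = f \<and> e \<odot> f = f \<and> f \<odot> e = f \<longrightarrow> f = 0 \<or> f = e)"
  using mul by (auto simp: primitive_idempotent_def)

definition ideal_of :: "'h \<Rightarrow> ('h, 'h) rep_module" where
  "ideal_of e = \<lparr>carr = range (\<lambda>a. a \<odot> e), act = mul\<rparr>"

lemma carr_ideal_of: "carr (ideal_of e) = range (\<lambda>a. a \<odot> e)"
  by (simp add: ideal_of_def)

lemma ideal_of_module: "module_over mul (ideal_of e)"
proof -
  have "submodule (range (\<lambda>a. a \<odot> e)) regular"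
    using mul_ideal_range[of e] by (simp add: submodule_def regular_def mul_ideal_def)
  from submodule_more(4)[OF regular_module this] show ?thesis
    by (simp add: regular_def ideal_of_def)
qed

lemma submodule_ideal_of: "submodule X (ideal_of e) \<longleftrightarrow> mul_ideal X \<and> X \<subseteq> range (\<lambda>a. a \<odot> e)"
  by (auto simp: submodule_def ideal_of_def mul_ideal_def)

lemma ideal_of_fd: "fd_module scale (ideal_of e)"
proof (rule fd_moduleI[OF ideal_of_module finite_Basis, of "\<lambda>b. b \<odot> e"])
  show "b \<odot> e \<in> carr (ideal_of e)" for b by (simp add: ideal_of_def)
  fix x assume "x \<in> carr (ideal_of e)"
  then obtain a where a: "x = a \<odot> e" by (auto simp: ideal_of_def)
  have "a = (\<Sum>b\<in>Basis. scale (representation Basis a b) b)"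
    using sum_representation_eq[OF independent_Basis _ finite_Basis] span_Basis by simp
  then have "x = (\<Sum>b\<in>Basis. scale (representation Basis a b) b) \<odot> e" using a by simp
  also have "\<dots> = (\<Sum>b\<in>Basis. act (ideal_of e) (scale (representation Basis a b) 1) (b \<odot> e))"
    by (simp add: mul_sum mul_scale ideal_of_def)
  finally show "\<exists>c. x = (\<Sum>b\<in>Basis. act (ideal_of e) (scale (c b) 1) (b \<odot> e))"
    by (rule exI[of _ "representation Basis a"])
qed

text \<open>A decomposition of H e splits e into f + g. Comparing components in f = f e and g = g e
  shows that f and g are orthogonal idempotents, so f is 0 or e.\<close>

lemma ideal_of_indecomposable:
  assumes e: "primitive_idempotent e"
  shows "indecomposable (ideal_of e)"
  unfolding indecomposable_iff
proof (intro conjI allI impI)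
  have ee: "e \<odot> e = e" "e \<noteq> 0" using e by (auto simp: primitive_idempotent_iff)
  have "e \<in> range (\<lambda>a. a \<odot> e)" by (rule range_eqI[of _ _ 1]) simp
  then show "carr (ideal_of e) \<noteq> {0}" using ee(2) by (auto simp: ideal_of_def)
  fix N L assume ds: "direct_sum (ideal_of e) N L"
  have sub: "mul_ideal N" "mul_ideal L" "N \<subseteq> range (\<lambda>a. a \<odot> e)" "L \<subseteq> range (\<lambda>a. a \<odot> e)" "N \<inter> L = {0}"
    and sum: "{x + y | x y. x \<in> N \<and> y \<in> L} = range (\<lambda>a. a \<odot> e)"
    using ds unfolding direct_sum_def submodule_ideal_of carr_ideal_of by blast+
  note N = mul_idealD[OF sub(1)] and L = mul_idealD[OF sub(2)]
  have re: "x \<odot> e = x" if "x \<in> range (\<lambda>a. a \<odot> e)" for x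
    using that by (auto simp: mul_assoc ee)
  obtain f g where fg: "e = f + g" "f \<in> N" "g \<in> L"
    using sum \<open>e \<in> range (\<lambda>a. a \<odot> e)\<close> by blast
  have f: "f = f \<odot> f + f \<odot> g" and g: "g = g \<odot> f + g \<odot> g"
    using re[of f] re[of g] fg sub(3,4) by (auto simp: fg(1) mul_add)
  have "f \<odot> g \<in> N" using N(5)[OF fg(2) N(3)[OF fg(2), of f]] f by (metis add_diff_cancel_left')
  then have fg0: "f \<odot> g = 0" using L(3)[OF fg(3), of f] sub(5) by auto
  have "g \<odot> f \<in> L" using L(5)[OF fg(3) L(3)[OF fg(3), of g]] g by (metis add_diff_cancel_right')
  then have gf0: "g \<odot> f = 0" using N(3)[OF fg(2), of g] sub(5) by auto
  have "f \<odot> f = f" using f fg0 by simp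
  moreover from this have "e \<odot> f = f" "f \<odot> e = f" using fg0 gf0 by (simp_all add: fg(1) mul_add)
  ultimately have "f = 0 \<or> f = e" using e by (auto simp: primitive_idempotent_iff)
  then show "N = {0} \<or> L = {0}"
  proof
    assume "f = 0"
    then have "e \<in> L" using fg by simp
    then have "range (\<lambda>a. a \<odot> e) \<subseteq> L" using L(3) by blast
    then have "N = N \<inter> L" using sub(3) by blast
    then show ?thesis using sub(5) by simp
  next
    assume "f = e"
    then have "range (\<lambda>a. a \<odot> e) \<subseteq> N" using N(3) fg(2) by blast
    then have "L = N \<inter> L" using sub(4) by blast
    then show ?thesis using sub(5) by simp
  qed
qed

text \<open>A map out of H e is given by the image of e; a preimage n of that image defines the lift
  z |-> g(z) n. The copy P is needed because \<open>projective\<close> refers to the ambient group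
  of its argument.\<close>

lemma ideal_of_copy_projective:
  fixes P :: "('h, nat \<Rightarrow>\<^sub>0 'k) rep_module"
  assumes e: "e \<odot> e = e" and P: "module_over mul P"
    and f: "module_hom (ideal_of e) P f" "bij_betw f (carr (ideal_of e)) (carr P)"
  shows "projective mul P"
  unfolding projective_def
proof (intro allI impI, elim conjE)
  fix N L :: "('h, nat \<Rightarrow>\<^sub>0 'k) rep_module" and q l
  assume N: "module_over mul N" and L: "module_over mul L" and q: "module_hom N L q"
    and surj: "q ` carr N = carr L" and l: "module_hom P L l"
  obtain g where g: "module_hom P (ideal_of e) g" "\<And>y. y \<in> carr P \<Longrightarrow> f (g y) = y"
    by (rule module_iso_inverse[OF ideal_of_module f], rule that)
  have eI: "e \<in> carr (ideal_of e)" unfolding ideal_of_def by (simp, rule range_eqI[of _ _ 1]) simp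
  have "l (f e) \<in> q ` carr N" using module_homD(1)[OF l] module_homD(1)[OF f(1) eI] surj by simp
  then obtain n where n: "n \<in> carr N" "l (f e) = q n" by blast
  let ?h = "\<lambda>z. act N (g z) n"
  have "module_hom P N ?h"
    by (rule module_homI) (auto simp: module_homD[OF g(1)] moduleD[OF N] n(1), auto simp: ideal_of_def moduleD[OF N] n(1))
  moreover have "q (?h z) = l z" if z: "z \<in> carr P" for z
  proof -
    have "g z \<in> range (\<lambda>a. a \<odot> e)" using module_homD(1)[OF g(1) z] by (simp add: ideal_of_def)
    then have "g z = act (ideal_of e) (g z) e" by (auto simp: ideal_of_def mul_assoc e)
    then have "l z = l (f (act (ideal_of e) (g z) e))" using g(2)[OF z] by simp
    also have "\<dots> = act L (g z) (l (f e))"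
      by (simp only: module_homD(3)[OF f(1) eI] module_homD(3)[OF l module_homD(1)[OF f(1) eI]])
    finally show ?thesis using n module_homD(3)[OF q n(1)] by simp
  qed
  ultimately show "\<exists>h. module_hom P N h \<and> (\<forall>x\<in>carr P. q (h x) = l x)" by blast
qed

text \<open>The Nakayama condition is applied to a copy of H e inside
  \<open>nat \<Rightarrow>\<^sub>0 'k\<close> and pulled back along the bijection.\<close>

lemma primitive_ideals_chain:
  assumes nak: "\<And>P :: ('h, nat \<Rightarrow>\<^sub>0 'k) rep_module. module_over mul P \<Longrightarrow> fd_module scale P \<Longrightarrow>
      projective mul P \<Longrightarrow> indecomposable P \<Longrightarrow> \<exists>!Ns. composition_series P Ns"
    and e: "primitive_idempotent e"
  shows "mul_ideal X \<Longrightarrow> mul_ideal Y \<Longrightarrow> X \<subseteq> range (\<lambda>a. a \<odot> e) \<Longrightarrow> Y \<subseteq> range (\<lambda>a. a \<odot> e) \<Longrightarrow> X \<subseteq> Y \<or> Y \<subseteq> X"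
    and "finite {X. mul_ideal X \<and> X \<subseteq> range (\<lambda>a. a \<odot> e)}"
proof -
  obtain P :: "('h, nat \<Rightarrow>\<^sub>0 'k) rep_module"
    where P: "module_over mul P" "fd_module scale P" "isomorphic (ideal_of e) P"
    using fd_module_in_universe[OF k_algebra_axioms mul ideal_of_module ideal_of_fd] by blast
  obtain f where f: "module_hom (ideal_of e) P f" "bij_betw f (carr (ideal_of e)) (carr P)"
    using P(3) by (auto simp: isomorphic_def)
  have ee: "e \<odot> e = e" using e by (simp add: primitive_idempotent_iff)
  have uniq: "\<exists>!Ns. composition_series P Ns"
    by (rule nak[OF P(1,2) ideal_of_copy_projective[OF ee P(1) f]
      indecomposable_iso[OF ideal_of_module P(1,3) ideal_of_indecomposable[OF e]]])
  have sub: "submodule (f ` X) P" if "mul_ideal X" "X \<subseteq> range (\<lambda>a. a \<odot> e)" for X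
    using that by (intro submodule_image[OF ideal_of_module P(1) f(1)]) (simp add: submodule_ideal_of)
  have inj: "inj_on f (range (\<lambda>a. a \<odot> e))" using f(2) by (simp add: bij_betw_def ideal_of_def)
  have reflect: "A \<subseteq> B" if "f ` A \<subseteq> f ` B" "A \<subseteq> range (\<lambda>a. a \<odot> e)" "B \<subseteq> range (\<lambda>a. a \<odot> e)" for A B
    using that inj_on_image_mem_iff[OF inj _ that(3)] by blast
  show "X \<subseteq> Y \<or> Y \<subseteq> X" if XY: "mul_ideal X" "mul_ideal Y" "X \<subseteq> range (\<lambda>a. a \<odot> e)" "Y \<subseteq> range (\<lambda>a. a \<odot> e)"
    using unique_composition_seriesD(1)[OF P(1,2) uniq sub[OF XY(1,3)] sub[OF XY(2,4)]]
      reflect XY(3,4) by blast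
  show "finite {X. mul_ideal X \<and> X \<subseteq> range (\<lambda>a. a \<odot> e)}"
  proof (rule inj_on_finite[of "(`) f"])
    show "inj_on ((`) f) {X. mul_ideal X \<and> X \<subseteq> range (\<lambda>a. a \<odot> e)}"
      by (rule inj_onI) (use inj_on_image_eq_iff[OF inj] in blast)
    show "(`) f ` {X. mul_ideal X \<and> X \<subseteq> range (\<lambda>a. a \<odot> e)} \<subseteq> {N. submodule N P}" using sub by blast
  qed (rule unique_composition_seriesD(2)[OF P(1,2) uniq])
qed

text \<open>A nonprimitive e splits as f + (e - f), and both generate smaller left ideals: e in H f
  would give e = e f = f, and e in H (e - f) would give f = e f = 0.\<close>

lemma idempotent_primitive_sum:
  "e \<odot> e = e \<Longrightarrow> \<exists>es. (\<forall>f\<in>set es. primitive_idempotent f) \<and> sum_list es = e"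
proof (induction "dim (range (\<lambda>a. a \<odot> e))" arbitrary: e rule: less_induct)
  case less
  consider "e = 0" | "primitive_idempotent e" | f where "f \<odot> f = f" "e \<odot> f = f" "f \<odot> e = f" "f \<noteq> 0" "f \<noteq> e"
    using less.prems by (auto simp: primitive_idempotent_iff)
  then show ?case
  proof cases
    case 1
    then show ?thesis by (intro exI[of _ "[]"]) simp
  next
    case 2
    then show ?thesis by (intro exI[of _ "[e]"]) simp
  next
    case (3 f)
    let ?g = "e - f"
    have smaller: "dim (range (\<lambda>a. a \<odot> g)) < dim (range (\<lambda>a. a \<odot> e))"
      if g: "g \<odot> e = g" "\<And>a. e \<noteq> a \<odot> g" for g
    proof (rule ccontr)
      assume "\<not> ?thesis"
      moreover have "range (\<lambda>a. a \<odot> g) \<subseteq> range (\<lambda>a. a \<odot> e)"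
      proof (rule image_subsetI)
        fix a
        have "a \<odot> g = (a \<odot> g) \<odot> e" by (simp add: mul_assoc g(1))
        then show "a \<odot> g \<in> range (\<lambda>a. a \<odot> e)" by (rule range_eqI)
      qed
      ultimately have "range (\<lambda>a. a \<odot> g) = range (\<lambda>a. a \<odot> e)"
        by (intro mul_ideal_eqI mul_ideal_range) simp_all
      moreover have "e \<in> range (\<lambda>a. a \<odot> e)" by (rule range_eqI[of _ _ 1]) simp
      ultimately have "e \<in> range (\<lambda>a. a \<odot> g)" by simp
      then show False using g(2) by blast
    qed
    have gg: "?g \<odot> ?g = ?g" "?g \<odot> e = ?g" "?g \<odot> f = 0" using 3 less.prems by (simp_all add: mul_diff)
    have "e \<noteq> a \<odot> f" for a
    proof
      assume a: "e = a \<odot> f"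
      then have "e \<odot> f = e" using 3 by (simp add: mul_assoc)
      then show False using 3 by simp
    qed
    moreover have "e \<noteq> a \<odot> ?g" for a
    proof
      assume a: "e = a \<odot> ?g"
      then have "e \<odot> f = a \<odot> (?g \<odot> f)" by (metis mul_assoc)
      then show False using 3 gg by simp
    qed
    ultimately obtain es es' where "\<forall>f\<in>set es. primitive_idempotent f" "sum_list es = f"
      "\<forall>f\<in>set es'. primitive_idempotent f" "sum_list es' = ?g"
      using less.hyps[of f, OF smaller] less.hyps[of ?g, OF smaller] 3 gg by metis
    then show ?thesis by (intro exI[of _ "es @ es'"]) auto
  qed
qed

lemma cyclic_isomorphic:
  assumes M: "module_over mul M" and N: "module_over mul N"
    and m: "m \<in> carr M" "carr M = range (\<lambda>a. act M a m)" and n: "n \<in> carr N" "carr N = range (\<lambda>a. act N a n)"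
    and ann: "\<And>a. act M a m = 0 \<longleftrightarrow> act N a n = 0"
  shows "isomorphic M N"
proof -
  define f where "f z = act N (SOME a. z = act M a m) n" for z
  have eq: "act M a m = act M b m \<longleftrightarrow> act N a n = act N b n" for a b
    using ann[of "a - b"] module_more(6)[OF M m(1), of a b] module_more(6)[OF N n(1), of a b] by simp
  have f: "f (act M a m) = act N a n" for a
  proof -
    have "act M a m = act M (SOME b. act M a m = act M b m) m" by (rule someI_ex) blast
    then show ?thesis unfolding f_def by (subst (asm) eq) simp
  qed
  have "module_hom M N f"
  proof (rule module_homI)
    fix x y assume x: "x \<in> carr M" "y \<in> carr M"
    then obtain a b where ab: "x = act M a m" "y = act M b m" using m(2) by blast
    show "f x \<in> carr N" by (simp add: ab f moduleD[OF N] n(1))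
    have "x + y = act M (a + b) m" by (simp add: ab moduleD[OF M] m(1))
    then show "f (x + y) = f x + f y" by (simp only: ab f moduleD(6)[OF N n(1)])
    have "act M r x = act M (r \<odot> a) m" for r by (simp add: ab moduleD[OF M] m(1))
    then show "f (act M r x) = act N r (f x)" for r by (simp only: ab f moduleD(7)[OF N n(1)])
  qed
  moreover have "bij_betw f (carr M) (carr N)"
    unfolding bij_betw_def m(2) n(2)
    by (auto simp: inj_on_def f eq image_image)
  ultimately show ?thesis by (auto simp: isomorphic_def)
qed

end

section \<open>Nakayama algebras have finite representation type\<close>

context fd_algebra_left begin

text \<open>For the optimal generators, \<open>indep\<close> says that M is the direct sum of the H
  m_i, so indecomposability leaves one of them. Zero generators are allowed, which keeps the index
  set fixed while the family is modified.\<close>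

lemma indecomposable_cyclic:
  fixes M :: "('h, 'm::ab_group_add) rep_module"
  assumes es: "sum_list es = 1" "\<And>e. e \<in> set es \<Longrightarrow> e * e = e"
    and left_chain: "\<And>e X Y. e \<in> set es \<Longrightarrow> mul_ideal X \<Longrightarrow> mul_ideal Y \<Longrightarrow>
      X \<subseteq> range (\<lambda>a. a * e) \<Longrightarrow> Y \<subseteq> range (\<lambda>a. a * e) \<Longrightarrow> X \<subseteq> Y \<or> Y \<subseteq> X"
    and right_chain: "\<And>e a b. e \<in> set es \<Longrightarrow> e * a = a \<Longrightarrow> e * b = b \<Longrightarrow>
      range (\<lambda>r. a * r) \<subseteq> range (\<lambda>r. b * r) \<or> range (\<lambda>r. b * r) \<subseteq> range (\<lambda>r. a * r)"
    and M: "module_over (*) M" and fd: "fd_module scale M" and ind: "indecomposable M"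
  shows "\<exists>e\<in>set es. \<exists>m\<in>carr M. act M e m = m \<and> carr M = range (\<lambda>a. act M a m)"
proof -
  note D = moduleD[OF M] and D' = module_more[OF M]
  obtain B where B: "finite B" "B \<subseteq> carr M" "\<And>x. x \<in> carr M \<Longrightarrow> \<exists>c. x = (\<Sum>b\<in>B. act M (scale (c b) 1) b)"
    using fd by (auto simp: fd_module_def)
  \<comment> \<open>The initial generators are e_i b: as the e_i sum to 1, these still generate, and
    each is fixed by its idempotent.\<close>
  define I where "I = B \<times> {..<length es}"
  define er where "er = (\<lambda>(b :: 'm, i). es ! i)"
  have finI: "finite I" using B(1) by (simp add: I_def)
  have er: "er i \<in> set es" "er i * er i = er i" if "i \<in> I" for i
    using that es(2) by (auto simp: I_def er_def)
  have es_act: "x = (\<Sum>i<length es. act M (es ! i) x)" if "x \<in> carr M" for x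
  proof -
    have "x = act M (\<Sum>i<length es. es ! i) x"
      using es(1) D(8)[OF that] by (simp add: sum_list_sum_nth atLeast0LessThan)
    then show ?thesis by (simp only: module_sum(3)[OF M that])
  qed
  define ann where "ann x = {a. act M a x = 0}" for x
  have ann: "mul_ideal (ann x)" if "x \<in> carr M" for x
    using that by (auto simp: mul_ideal_def ann_def D D')
  define good where "good m \<longleftrightarrow> (\<forall>i\<in>I. m i \<in> carr M \<and> act M (er i) (m i) = m i) \<and>
    (\<forall>N. submodule N M \<and> (\<forall>i\<in>I. m i \<in> N) \<longrightarrow> N = carr M)" for m
  have "good (\<lambda>(b, i). act M (es ! i) b)"
    unfolding good_def
  proof (intro conjI allI impI ballI)
    fix p assume p: "p \<in> I"
    then obtain b i where bi: "p = (b, i)" "b \<in> carr M" "i < length es" using B(2) by (auto simp: I_def)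
    show "(case p of (b, i) \<Rightarrow> act M (es ! i) b) \<in> carr M" using bi D(4) by simp
    show "act M (er p) (case p of (b, i) \<Rightarrow> act M (es ! i) b) = (case p of (b, i) \<Rightarrow> act M (es ! i) b)"
      using bi es(2) by (simp add: er_def D(7)[symmetric])
  next
    fix N assume N: "submodule N M \<and> (\<forall>p\<in>I. (case p of (b, i) \<Rightarrow> act M (es ! i) b) \<in> N)"
    then have sN: "submodule N M" by blast
    have "b \<in> N" if "b \<in> B" for b
    proof -
      have "(\<Sum>i<length es. act M (es ! i) b) \<in> N"
        using N that by (intro submodule_more(3)[OF M sN]) (auto simp: I_def)
      then show ?thesis using es_act[of b] B(2) that by auto
    qed
    then have "x \<in> N" if "x \<in> carr M" for x
      using B(3)[OF that] by (auto intro!: submodule_more(3)[OF M sN] submoduleD(4)[OF sN])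
    then show "N = carr M" using submoduleD(1)[OF sN] by blast
  qed
  moreover have "(\<Sum>i\<in>I. dim (ann (m i))) < Suc (card I * dimension)" for m
    using sum_bounded_above[of I "\<lambda>i. dim (ann (m i))" dimension] dim_subset_UNIV by (simp add: less_Suc_eq_le)
  \<comment> \<open>The total dimension of the annihilators makes "as large as possible" precise; it
    is bounded by |I| dim H.\<close>
  ultimately obtain m where m: "good m"
    and max: "\<And>m'. good m' \<Longrightarrow> (\<Sum>i\<in>I. dim (ann (m' i))) \<le> (\<Sum>i\<in>I. dim (ann (m i)))"
    using ex_has_greatest_nat[of good _ "\<lambda>m. \<Sum>i\<in>I. dim (ann (m i))" "Suc (card I * dimension)"] by blast
  have mM: "m i \<in> carr M" and em: "act M (er i) (m i) = m i" if "i \<in> I" for i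
    using m that by (auto simp: good_def)
  have gen: "N = carr M" if "submodule N M" "\<And>i. i \<in> I \<Longrightarrow> m i \<in> N" for N
    using m that by (auto simp: good_def)
  have indep: "act M (a j) (m j) = 0" if sum0: "(\<Sum>i\<in>I. act M (a i) (m i)) = 0" and j: "j \<in> I" for a j
  proof (rule ccontr)
    assume nz: "act M (a j) (m j) \<noteq> 0"
    \<comment> \<open>Multiplication by an f from the list moves all coefficients of the relation
      into f H, where principal right ideals form a chain; f is chosen so that the j-th term
      survives.\<close>
    obtain f where f: "f \<in> set es" "act M f (act M (a j) (m j)) \<noteq> 0"
    proof -
      have "\<exists>i<length es. act M (es ! i) (act M (a j) (m j)) \<noteq> 0"
        using es_act[of "act M (a j) (m j)"] nz D(4)[OF mM[OF j]] by (metis (no_types, lifting) lessThan_iff sum.neutral)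
      then show thesis using that nth_mem by blast
    qed
    define c where "c i = f * a i * er i" for i
    have c_act: "act M (c i) (m i) = act M f (act M (a i) (m i))" if "i \<in> I" for i
      unfolding c_def using that by (simp add: D mM em)
    define K where "K = {i \<in> I. act M (c i) (m i) \<noteq> 0}"
    have jK: "j \<in> K" using f(2) j by (simp add: K_def c_act)
    have "(\<Sum>i\<in>K. act M (c i) (m i)) = (\<Sum>i\<in>I. act M (c i) (m i))"
      unfolding K_def using finI by (intro sum.mono_neutral_left) auto
    also have "\<dots> = act M f (\<Sum>i\<in>I. act M (a i) (m i))"
      by (subst module_sum(2)[OF M]) (simp_all add: c_act D mM)
    finally have sumK: "(\<Sum>i\<in>K. act M (c i) (m i)) = 0" by (simp add: sum0 D')
    have finK: "finite K" using finI by (simp add: K_def)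
    have fc: "f * c i = c i" for i using es(2)[OF f(1)] by (simp add: c_def mult.assoc[symmetric])
    have "\<exists>i\<in>K. \<forall>l\<in>K. range (\<lambda>r. c l * r) \<subseteq> range (\<lambda>r. c i * r)"
      using finK jK right_chain[OF f(1) fc fc] by (intro finite_chain_max) auto
    then obtain i1 where i1: "i1 \<in> K" "\<And>l. l \<in> K \<Longrightarrow> range (\<lambda>r. c l * r) \<subseteq> range (\<lambda>r. c i1 * r)" by blast
    have "\<exists>r. c l = c i1 * r" if "l \<in> K" for l
      using i1(2)[OF that] by (metis mult.right_neutral rangeI subsetD imageE)
    then obtain r where r: "\<And>l. l \<in> K \<Longrightarrow> c l = c i1 * r l" by metis
    have i1I: "i1 \<in> I" using i1(1) by (simp add: K_def)
    \<comment> \<open>r_l is cut down on both sides, so that the new generator is still fixed by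
      \<open>er i1\<close>; the equation c_i1 b_l = c_l survives.\<close>
    define b where "b l = er i1 * r l * er l" for l
    have cb: "c i1 * b l = c l" if "l \<in> K" for l
    proof -
      have "l \<in> I" using that by (simp add: K_def)
      have "c i1 * b l = c i1 * r l * er l"
        using er(2)[OF i1I] by (simp add: b_def c_def mult.assoc[symmetric]) (simp add: mult.assoc)
      also have "\<dots> = c l * er l" using r[OF that] by simp
      also have "\<dots> = c l" using er(2)[OF \<open>l \<in> I\<close>] by (simp add: c_def mult.assoc)
      finally show ?thesis .
    qed
    define s where "s = (\<Sum>l\<in>K - {i1}. act M (b l) (m l))"
    have bM: "act M (b l) (m l) \<in> carr M" if "l \<in> K - {i1}" for l
      using that mM D(4) by (simp add: K_def)
    have sM: "s \<in> carr M" unfolding s_def by (rule module_sum(1)[OF M bM])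
    define m' where "m' = m(i1 := m i1 + s)"
    have m'M: "m' i \<in> carr M" if "i \<in> I" for i using mM[OF that] sM D(2) by (auto simp: m'_def)
    have "good m'"
      unfolding good_def
    proof (intro conjI ballI allI impI)
      fix i assume i: "i \<in> I"
      show "m' i \<in> carr M" by (rule m'M[OF i])
      have "act M (er i1) s = s"
        unfolding s_def
        using er(2)[OF i1I]
        by (subst module_sum(2)[OF M bM])
          (auto intro!: sum.cong simp: b_def K_def mM D(7)[symmetric] mult.assoc[symmetric])
      then show "act M (er i) (m' i) = m' i"
        using i sM mM[OF i] by (auto simp: m'_def D em)
    next
      fix N assume N: "submodule N M \<and> (\<forall>i\<in>I. m' i \<in> N)"
      then have sN: "submodule N M" by blast
      have other: "m i \<in> N" if "i \<in> I" "i \<noteq> i1" for i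
        using N that by (auto simp: m'_def split: if_splits)
      have "s \<in> N" unfolding s_def
        by (rule submodule_more(3)[OF M sN]) (auto simp: K_def intro: submoduleD(4)[OF sN] other)
      moreover have "m i1 + s \<in> N" using N i1I by (auto simp: m'_def)
      ultimately have "m i1 \<in> N" using submodule_more(2)[OF M sN, of "m i1 + s" s] by simp
      then show "N = carr M" using gen[OF sN] other by blast
    qed
    have "act M (c i1) (m' i1) = act M (c i1) (m i1) + act M (c i1) s"
      using sM mM[OF i1I] by (simp add: m'_def D)
    also have "act M (c i1) s = (\<Sum>l\<in>K - {i1}. act M (c l) (m l))"
      unfolding s_def
      by (subst module_sum(2)[OF M bM]) (auto intro!: sum.cong simp: D(7)[symmetric] cb K_def mM)
    also have "act M (c i1) (m i1) + \<dots> = 0"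
      using sumK sum.remove[OF finK i1(1), of "\<lambda>l. act M (c l) (m l)"] by simp
    finally have c0: "act M (c i1) (m' i1) = 0" .
    have cnz: "act M (c i1) (m i1) \<noteq> 0" using i1(1) by (simp add: K_def)
    have em': "act M (er i1) (m' i1) = m' i1" using \<open>good m'\<close> i1I by (auto simp: good_def)
    \<comment> \<open>Annihilators are compared inside H e for e = \<open>er i1\<close>, where left
      ideals form a chain. That c_i1 kills the new generator but not the old one decides the
      direction; as e fixes both generators, the comparison extends to all of H.\<close>
    let ?E = "range (\<lambda>a. a * er i1)"
    have XE: "mul_ideal (ann x \<inter> ?E)" if "x \<in> carr M" for x
      using ann[OF that] mul_ideal_range[of "er i1"] by (auto simp: mul_ideal_def)
    have cE: "c i1 \<in> ?E" by (auto simp: c_def)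
    have "ann (m i1) \<inter> ?E \<subseteq> ann (m' i1) \<inter> ?E"
      using left_chain[OF er(1)[OF i1I] XE[OF mM[OF i1I]] XE[OF m'M[OF i1I]]] c0 cnz cE
      by (auto simp: ann_def)
    moreover have "a * er i1 \<in> ann x \<longleftrightarrow> a \<in> ann x" if "x \<in> carr M" "act M (er i1) x = x" for a x
      using that by (simp add: ann_def D)
    ultimately have "ann (m i1) \<subseteq> ann (m' i1)"
      using mM[OF i1I] m'M[OF i1I] em[OF i1I] em' by blast
    moreover have "ann (m i1) \<noteq> ann (m' i1)" using c0 cnz by (auto simp: ann_def)
    ultimately have "dim (ann (m i1)) < dim (ann (m' i1))"
      using mul_ideal_eqI[OF ann[OF mM[OF i1I]] ann[OF m'M[OF i1I]]] by (meson not_le)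
    then have "(\<Sum>i\<in>I. dim (ann (m i))) < (\<Sum>i\<in>I. dim (ann (m' i)))"
      using i1I finI by (intro sum_strict_mono_ex1) (auto simp: m'_def)
    then show False using max[OF \<open>good m'\<close>] by simp
  qed
  obtain i0 where i0: "i0 \<in> I" "m i0 \<noteq> 0"
  proof (rule ccontr)
    assume "\<not> thesis"
    then have "m i \<in> {0}" if "i \<in> I" for i using that \<open>\<And>i0. i0 \<in> I \<Longrightarrow> m i0 \<noteq> 0 \<Longrightarrow> thesis\<close> by blast
    then have "carr M = {0}" using gen[OF submodule_zero[OF M]] by blast
    then show False using ind by (simp add: indecomposable_iff)
  qed
  define N where "N = range (\<lambda>a. act M a (m i0))"
  define L where "L = range (\<lambda>a. \<Sum>i\<in>I - {i0}. act M (a i) (m i))"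
  have LI: "(\<Sum>i\<in>I - {i0}. act M (a i) (m i)) \<in> L" for a unfolding L_def by (rule rangeI)
  have actM: "act M a (m i) \<in> carr M" if "i \<in> I" for a i using mM[OF that] D(4) by blast
  have N: "submodule N M"
  proof (rule submoduleI)
    show "0 \<in> N" unfolding N_def by (rule range_eqI[of _ _ 0]) (simp add: D' mM i0)
  next
    fix x assume "x \<in> N"
    then obtain a where a: "x = act M a (m i0)" by (auto simp: N_def)
    show "x \<in> carr M" by (simp add: a actM i0)
    show "act M r x \<in> N" for r
      unfolding N_def by (rule range_eqI[of _ _ "r * a"]) (simp add: a D mM i0)
    fix y assume "y \<in> N"
    then obtain b where b: "y = act M b (m i0)" by (auto simp: N_def)
    show "x + y \<in> N"
      unfolding N_def by (rule range_eqI[of _ _ "a + b"]) (simp add: a b D mM i0)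
  qed
  have L: "submodule L M"
  proof (rule submoduleI)
    have "0 = (\<Sum>i\<in>I - {i0}. act M 0 (m i))" by (intro sum.neutral[symmetric]) (simp add: D' mM)
    then show "0 \<in> L" using LI[of "\<lambda>_. 0"] by simp
  next
    fix x assume "x \<in> L"
    then obtain a where a: "x = (\<Sum>i\<in>I - {i0}. act M (a i) (m i))" by (auto simp: L_def)
    show "x \<in> carr M" unfolding a by (rule module_sum(1)[OF M]) (simp add: actM)
    have "act M r x = (\<Sum>i\<in>I - {i0}. act M (r * a i) (m i))" for r
      unfolding a by (subst module_sum(2)[OF M]) (simp_all add: actM D mM)
    then show "act M r x \<in> L" for r using LI[of "\<lambda>i. r * a i"] by simp
    fix y assume "y \<in> L"
    then obtain b where b: "y = (\<Sum>i\<in>I - {i0}. act M (b i) (m i))" by (auto simp: L_def)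
    have "x + y = (\<Sum>i\<in>I - {i0}. act M (a i + b i) (m i))"
      unfolding a b by (simp add: D mM sum.distrib)
    then show "x + y \<in> L" using LI[of "\<lambda>i. a i + b i"] by simp
  qed
  have mL: "m i \<in> L" if "i \<in> I" "i \<noteq> i0" for i
  proof -
    have "(\<Sum>l\<in>I - {i0}. act M (if l = i then 1 else 0) (m l)) = (\<Sum>l\<in>I - {i0}. if l = i then m i else 0)"
      by (intro sum.cong refl) (auto simp: D D' mM)
    then have "m i = (\<Sum>l\<in>I - {i0}. act M (if l = i then 1 else 0) (m l))"
      using that finI by simp
    then show ?thesis using LI[of "\<lambda>l. if l = i then 1 else 0"] by simp
  qed
  have mN: "m i0 \<in> N" unfolding N_def by (rule range_eqI[of _ _ 1]) (simp add: D mM i0)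
  have "direct_sum M N L"
    unfolding direct_sum_def
  proof (intro conjI N L)
    have sub: "submodule {x + y | x y. x \<in> N \<and> y \<in> L} M" by (rule submodule_plus[OF M N L])
    have "m i \<in> {x + y | x y. x \<in> N \<and> y \<in> L}" if "i \<in> I" for i
    proof (cases "i = i0")
      case True
      have "m i = m i0 + 0" using True by simp
      then show ?thesis using mN submoduleD(2)[OF L] by blast
    next
      case False
      have "m i = 0 + m i" by simp
      then show ?thesis using mL[OF that False] submoduleD(2)[OF N] by blast
    qed
    then show "{x + y | x y. x \<in> N \<and> y \<in> L} = carr M" by (rule gen[OF sub])
    show "N \<inter> L = {0}"
    proof (intro equalityI subsetI)
      fix x assume x: "x \<in> N \<inter> L"
      then have "x \<in> N" "x \<in> L" by simp_all
      obtain a where a: "x = act M a (m i0)" using \<open>x \<in> N\<close> unfolding N_def by (rule imageE)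
      obtain b where b: "x = (\<Sum>i\<in>I - {i0}. act M (b i) (m i))" using \<open>x \<in> L\<close> unfolding L_def by (rule imageE)
      let ?d = "\<lambda>i. if i = i0 then a else - b i"
      have "(\<Sum>i\<in>I. act M (?d i) (m i)) = act M a (m i0) + (\<Sum>i\<in>I - {i0}. act M (- b i) (m i))"
        using sum.remove[OF finI i0(1), of "\<lambda>i. act M (?d i) (m i)"]
          sum.cong[OF refl, of "I - {i0}" "\<lambda>i. act M (?d i) (m i)" "\<lambda>i. act M (- b i) (m i)"] by simp
      also have "(\<Sum>i\<in>I - {i0}. act M (- b i) (m i)) = - x"
        unfolding b by (simp add: D' mM sum_negf)
      finally have "act M (?d i0) (m i0) = 0" using indep[OF _ i0(1), of ?d] a by simp
      then show "x \<in> {0}" using a by simp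
    qed (use submoduleD(2)[OF N] submoduleD(2)[OF L] in auto)
  qed
  moreover have "N \<noteq> {0}" using mN i0(2) by blast
  ultimately have "L = {0}" using ind by (auto simp: indecomposable_iff)
  then have "m i \<in> N" if "i \<in> I" for i
    using mN mL[OF that] submoduleD(2)[OF N] by (cases "i = i0") auto
  then have "carr M = N" using gen[OF N] by blast
  then show ?thesis unfolding N_def using er(1)[OF i0(1)] mM[OF i0(1)] em[OF i0(1)] by blast
qed

theorem nakayama_imp_finite_type:
  assumes nak: "nakayama_algebra scale"
  shows "finite_representation_type scale"
proof -
  interpret R: fd_algebra scale Basis "\<lambda>x y. y * x" by (rule op)
  have uniqL: "\<exists>!Ns. composition_series P Ns"
    if "module_over (*) P" "fd_module scale P" "projective (*) P" "indecomposable P"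
    for P :: "('h, nat \<Rightarrow>\<^sub>0 'k) rep_module"
    using nak that unfolding nakayama_algebra_def by blast
  have uniqR: "\<exists>!Ns. composition_series P Ns"
    if "module_over (\<lambda>x y. y * x) P" "fd_module scale P" "projective (\<lambda>x y. y * x) P" "indecomposable P"
    for P :: "('h, nat \<Rightarrow>\<^sub>0 'k) rep_module"
    using nak that unfolding nakayama_algebra_def by blast
  obtain es :: "'h list" where es: "\<And>e. e \<in> set es \<Longrightarrow> primitive_idempotent e" "sum_list es = 1"
    using idempotent_primitive_sum[of 1] by auto
  have idem: "e * e = e" if "e \<in> set es" for e using es(1)[OF that] by (simp add: primitive_idempotent_def)
  have left_chain: "X \<subseteq> Y \<or> Y \<subseteq> X"
    if "e \<in> set es" "mul_ideal X" "mul_ideal Y" "X \<subseteq> range (\<lambda>a. a * e)" "Y \<subseteq> range (\<lambda>a. a * e)" for e X Y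
    by (rule primitive_ideals_chain(1)[OF uniqL es(1)[OF that(1)] that(2-)])
  have right_chain: "range (\<lambda>r. a * r) \<subseteq> range (\<lambda>r. b * r) \<or> range (\<lambda>r. b * r) \<subseteq> range (\<lambda>r. a * r)"
    if "e \<in> set es" "e * a = a" "e * b = b" for e a b
  proof (rule R.primitive_ideals_chain(1)[OF uniqR es(1)[OF that(1)] R.mul_ideal_range R.mul_ideal_range])
    have "a * r = e * (a * r)" "b * r = e * (b * r)" for r using that by (simp_all add: mult.assoc[symmetric])
    then show "range (\<lambda>r. a * r) \<subseteq> range (\<lambda>r. e * r)" "range (\<lambda>r. b * r) \<subseteq> range (\<lambda>r. e * r)" by blast+
  qed
  let ?C = "\<Union>e\<in>set es. {e} \<times> {X. mul_ideal X \<and> X \<subseteq> range (\<lambda>a. a * e)}"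
  \<comment> \<open>The invariant of M: an idempotent e, and the annihilator in H e of a generator m
    = e m. It determines M, because a m = 0 iff a e lies in that ideal, and H e has only finitely
    many left ideals inside.\<close>
  define R where "R c M \<longleftrightarrow> (\<exists>m\<in>carr M. act M (fst c) m = m \<and> carr M = range (\<lambda>a. act M a m) \<and>
      snd c = {a \<in> range (\<lambda>a. a * fst c). act M a m = 0})" for c :: "'h \<times> 'h set" and M :: "('h, nat \<Rightarrow>\<^sub>0 'k) rep_module"
  have modX: "module_over (*) M" if "M \<in> fd_indecomposables scale" for M
    using that by (simp add: fd_indecomposables_def)
  show ?thesis
    unfolding finite_representation_type_def
  proof (rule finite_quotientI[of ?C _ R])
    show "finite ?C"
      using primitive_ideals_chain(2)[OF uniqL es(1)] by auto
  next
    fix M assume MX: "M \<in> fd_indecomposables scale"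
    then have M: "module_over (*) M" "fd_module scale M" "indecomposable M" by (auto simp: fd_indecomposables_def)
    have "\<exists>e\<in>set es. \<exists>m\<in>carr M. act M e m = m \<and> carr M = range (\<lambda>a. act M a m)"
      by (rule indecomposable_cyclic[OF es(2) _ _ _ M])
        (erule idem | (rule left_chain; assumption) | (rule right_chain; assumption))+
    then obtain e m where e: "e \<in> set es" "m \<in> carr M" "act M e m = m" "carr M = range (\<lambda>a. act M a m)"
      by blast
    let ?X = "{a \<in> range (\<lambda>a. a * e). act M a m = 0}"
    have "mul_ideal ?X"
      using mul_ideal_range[of e] e(2) by (auto simp: mul_ideal_def moduleD[OF M(1)] module_more[OF M(1)])
    then have "(e, ?X) \<in> ?C" using e(1) by blast
    moreover have "R (e, ?X) M" unfolding R_def fst_conv snd_conv using e by blast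
    ultimately show "\<exists>c\<in>?C. R c M" by blast
  next
    fix c and M N :: "('h, nat \<Rightarrow>\<^sub>0 'k) rep_module"
    assume "M \<in> fd_indecomposables scale" "N \<in> fd_indecomposables scale" and R: "R c M" "R c N"
    then have M: "module_over (*) M" and N: "module_over (*) N" using modX by auto
    obtain m where m: "m \<in> carr M" "act M (fst c) m = m" "carr M = range (\<lambda>a. act M a m)"
      "snd c = {a \<in> range (\<lambda>a. a * fst c). act M a m = 0}" using R(1) by (auto simp: R_def)
    obtain n where n: "n \<in> carr N" "act N (fst c) n = n" "carr N = range (\<lambda>a. act N a n)"
      "snd c = {a \<in> range (\<lambda>a. a * fst c). act N a n = 0}" using R(2) by (auto simp: R_def)
    show "isomorphic M N"
    proof (rule cyclic_isomorphic[OF M N m(1,3) n(1,3)])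
      fix a
      have "act M a m = 0 \<longleftrightarrow> a * fst c \<in> snd c" using m by (simp add: moduleD[OF M])
      also have "\<dots> \<longleftrightarrow> act N a n = 0" using n by (simp add: moduleD[OF N])
      finally show "act M a m = 0 \<longleftrightarrow> act N a n = 0" .
    qed
  qed (rule isomorphic_trans)
qed

end

section \<open>Counting modules of bounded dimension\<close>

text \<open>Over a finite field, 1 plus the product of all x - a has no root.\<close>

lemma alg_closed_field_infinite: "infinite (UNIV :: 'k::alg_closed_field set)"
proof
  assume fin: "finite (UNIV :: 'k set)"
  define p where "p = (\<Prod>a\<in>(UNIV :: 'k set). [:- a, 1:]) + 1"
  have deg: "degree (\<Prod>a\<in>(UNIV :: 'k set). [:- a, 1:]) = card (UNIV :: 'k set)"
    by (subst degree_prod_eq_sum_degree) (auto simp: fin)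
  have "card (UNIV :: 'k set) > 0" using fin by (simp add: card_gt_0_iff)
  then have "degree p > 0" unfolding p_def by (subst degree_add_eq_left) (simp_all add: deg)
  then obtain x where "poly p x = 0" using alg_closed_imp_poly_has_root by blast
  moreover have "(\<Prod>a\<in>(UNIV :: 'k set). x - a) = 0"
    using fin by (intro prod_zero) auto
  then have "poly p x = 1" by (simp add: p_def poly_prod)
  ultimately show False by simp
qed

lemma finite_representatives:
  assumes "finite C" and ex: "\<And>M. M \<in> X \<Longrightarrow> \<exists>c\<in>C. R c M"
    and eq: "\<And>c M N. M \<in> X \<Longrightarrow> N \<in> X \<Longrightarrow> R c M \<Longrightarrow> R c N \<Longrightarrow> eq M N"
  shows "\<exists>F. finite F \<and> F \<subseteq> X \<and> (\<forall>M\<in>X. \<exists>N\<in>F. eq M N)"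
proof (intro exI[of _ "(\<lambda>c. SOME N. N \<in> X \<and> R c N) ` {c \<in> C. \<exists>N. N \<in> X \<and> R c N}"] conjI ballI subsetI)
  fix N assume "N \<in> (\<lambda>c. SOME N. N \<in> X \<and> R c N) ` {c \<in> C. \<exists>N. N \<in> X \<and> R c N}"
  then obtain c where c: "\<exists>N. N \<in> X \<and> R c N" "N = (SOME N. N \<in> X \<and> R c N)" by blast
  then show "N \<in> X" using someI_ex[OF c(1)] by simp
next
  fix M assume M: "M \<in> X"
  then obtain c where c: "c \<in> C" "R c M" using ex by blast
  have N: "\<exists>N. N \<in> X \<and> R c N" using M c by blast
  then have "eq M (SOME N. N \<in> X \<and> R c N)"
    using someI_ex[OF N] eq[OF M _ c(2)] by blast
  then show "\<exists>N\<in>(\<lambda>c. SOME N. N \<in> X \<and> R c N) ` {c \<in> C. \<exists>N. N \<in> X \<and> R c N}. eq M N"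
    using c N by blast
qed (use assms(1) in simp)

text \<open>If vanishing of g_n is not implied by the earlier functionals, pick z0 in V that they
  kill but g_n does not, and subtract from l the multiple of g_n that agrees with l at z0.\<close>

lemma functional_combination:
  fixes g :: "nat \<Rightarrow> 'h::ab_group_add \<Rightarrow> 'k::field"
  assumes V: "module.subspace scale V" and vs: "vector_space scale"
    and g: "\<And>j. functional_on scale (g j)"
  shows "functional_on scale l \<Longrightarrow> (\<And>z. z \<in> V \<Longrightarrow> (\<And>j. j < n \<Longrightarrow> g j z = 0) \<Longrightarrow> l z = 0) \<Longrightarrow>
    \<exists>c. \<forall>z\<in>V. l z = (\<Sum>j<n. c j * g j z)"
proof (induction n arbitrary: l)
  case (Suc n)
  interpret vector_space scale by (rule vs)
  note gD = functionalD[OF g] and lD = functionalD[OF Suc.prems(1)]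
  show ?case
  proof (cases "\<forall>z\<in>V. (\<forall>j<n. g j z = 0) \<longrightarrow> g n z = 0")
    case True
    then have "l z = 0" if "z \<in> V" "\<And>j. j < n \<Longrightarrow> g j z = 0" for z
      using Suc.prems(2)[OF that(1)] that by (auto simp: less_Suc_eq)
    then obtain c where c: "\<forall>z\<in>V. l z = (\<Sum>j<n. c j * g j z)" using Suc.IH[OF Suc.prems(1)] by blast
    have "(\<Sum>j<Suc n. (c(n := 0)) j * g j z) = (\<Sum>j<n. c j * g j z)" for z by simp
    then show ?thesis using c by (intro exI[of _ "c(n := 0)"]) simp
  next
    case False
    then obtain z0 where z0: "z0 \<in> V" "\<And>j. j < n \<Longrightarrow> g j z0 = 0" "g n z0 \<noteq> 0" by blast
    define k where "k = l z0 / g n z0"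
    let ?l = "\<lambda>z. l z - k * g n z"
    have "functional_on scale ?l"
      using Suc.prems(1) g[of n] by (simp add: Vector_Spaces.linear_iff algebra_simps)
    moreover have "?l z = 0" if z: "z \<in> V" "\<And>j. j < n \<Longrightarrow> g j z = 0" for z
    proof -
      let ?z = "z - scale (g n z / g n z0) z0"
      have "l ?z = 0"
        using z z0 by (intro Suc.prems(2) subspace_diff[OF V] subspace_scale[OF V]) (auto simp: gD less_Suc_eq)
      then show ?thesis by (simp add: lD k_def)
    qed
    ultimately obtain c where c: "\<forall>z\<in>V. ?l z = (\<Sum>j<n. c j * g j z)" using Suc.IH[of ?l] by blast
    have "l z = (\<Sum>j<n. c j * g j z) + k * g n z" if "z \<in> V" for z
      using c that by (metis diff_add_cancel)
    then show ?thesis by (intro exI[of _ "c(n := k)"]) simp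
  qed
qed auto

lemma prod_polys:
  assumes "finite V" "T \<subseteq> V"
  shows "(\<lambda>a. \<Prod>v\<in>T. w a v) \<in> polys V w 1"
proof -
  have "(\<lambda>a. \<Prod>v\<in>V. w a v ^ (if v \<in> T then 1 else 0)) \<in> polys V w 1"
    unfolding polys_def by (intro fun_space.span_base monomials_memI) auto
  moreover have "(\<Prod>v\<in>V. w a v ^ (if v \<in> T then 1 else 0)) = (\<Prod>v\<in>T. w a v)" for a
    using assms by (intro prod.mono_neutral_cong_right) auto
  ultimately show ?thesis by simp
qed

section \<open>Direct summands\<close>

context fd_algebra begin

text \<open>The components p(b) in N of generators b of M span N: for x in N the same coefficients
  work, as the discrepancy lies in N and in L.\<close>

lemma direct_summand_fd:
  assumes M: "module_over mul M" and fd: "fd_module scale M" and ds: "direct_sum M N L"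
  shows "fd_module scale (M\<lparr>carr := N\<rparr>)"
proof -
  have N: "submodule N M" and L: "submodule L M" and int: "N \<inter> L = {0}"
    and sum: "{x + y | x y. x \<in> N \<and> y \<in> L} = carr M" using ds by (auto simp: direct_sum_def)
  note D = moduleD[OF M] module_more[OF M] and ND = submoduleD[OF N] and LD = submoduleD[OF L]
  obtain B where B: "finite B" "B \<subseteq> carr M" "\<And>x. x \<in> carr M \<Longrightarrow> \<exists>c. x = (\<Sum>b\<in>B. act M (scale (c b) 1) b)"
    using fd by (auto simp: fd_module_def)
  have "\<forall>b\<in>B. \<exists>x. x \<in> N \<and> b - x \<in> L"
  proof
    fix b assume "b \<in> B"
    then obtain x y where "b = x + y" "x \<in> N" "y \<in> L" using B(2) sum by blast
    then show "\<exists>x. x \<in> N \<and> b - x \<in> L" by (intro exI[of _ x]) simp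
  qed
  then obtain p where p: "\<And>b. b \<in> B \<Longrightarrow> p b \<in> N" "\<And>b. b \<in> B \<Longrightarrow> b - p b \<in> L" by metis
  show ?thesis
  proof (rule fd_moduleI[OF submodule_more(4)[OF M N] B(1), of p])
    fix x assume "x \<in> carr (M\<lparr>carr := N\<rparr>)"
    then have x: "x \<in> N" by simp
    obtain c where c: "x = (\<Sum>b\<in>B. act M (scale (c b) 1) b)" using B(3) ND(1)[OF x] by blast
    let ?x = "\<Sum>b\<in>B. act M (scale (c b) 1) (p b)"
    have "x - ?x = (\<Sum>b\<in>B. act M (scale (c b) 1) (b - p b))"
      unfolding c sum_subtractf[symmetric] using B(2) p(1) ND(1) by (intro sum.cong refl) (auto simp: D)
    also have "\<dots> \<in> L" by (rule submodule_more(3)[OF M L]) (auto intro: LD p)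
    finally have "x - ?x \<in> L" .
    moreover have "?x \<in> N" by (rule submodule_more(3)[OF M N]) (auto intro: ND p)
    then have "x - ?x \<in> N" by (rule submodule_more(2)[OF M N x])
    ultimately have "x - ?x \<in> N \<inter> L" by (rule IntI[rotated])
    then have "x = ?x" unfolding int by simp
    then show "\<exists>c. x = (\<Sum>b\<in>B. act (M\<lparr>carr := N\<rparr>) (scale (c b) 1) (p b))" by (intro exI[of _ c]) simp
  qed (use p in simp)
qed

lemma direct_sum_swap: "direct_sum M N L \<Longrightarrow> direct_sum M L N"
proof -
  have "{x + y | x y. x \<in> L \<and> y \<in> N} \<subseteq> {x + y | x y. x \<in> N \<and> y \<in> L}" for N L :: "'b::ab_group_add set"
    using add.commute by blast
  then have "{x + y | x y. x \<in> L \<and> y \<in> N} = {x + y | x y. x \<in> N \<and> y \<in> L}" for N L :: "'b set"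
    by (intro equalityI)
  then show "direct_sum M N L \<Longrightarrow> direct_sum M L N"
    by (simp add: direct_sum_def Int_commute)
qed

lemma direct_sum_isomorphic:
  assumes M: "module_over mul M" and M': "module_over mul M'"
    and ds: "direct_sum M N L" and ds': "direct_sum M' N' L'"
    and iN: "isomorphic (M\<lparr>carr := N\<rparr>) (M'\<lparr>carr := N'\<rparr>)" and iL: "isomorphic (M\<lparr>carr := L\<rparr>) (M'\<lparr>carr := L'\<rparr>)"
  shows "isomorphic M M'"
proof -
  have N: "submodule N M" and L: "submodule L M" and int: "N \<inter> L = {0}"
    and sum: "{x + y | x y. x \<in> N \<and> y \<in> L} = carr M" using ds by (auto simp: direct_sum_def)
  have N': "submodule N' M'" and L': "submodule L' M'" and int': "N' \<inter> L' = {0}"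
    and sum': "{x + y | x y. x \<in> N' \<and> y \<in> L'} = carr M'" using ds' by (auto simp: direct_sum_def)
  obtain f where f: "module_hom (M\<lparr>carr := N\<rparr>) (M'\<lparr>carr := N'\<rparr>) f" "bij_betw f N N'"
    using iN by (auto simp: isomorphic_def)
  obtain g where g: "module_hom (M\<lparr>carr := L\<rparr>) (M'\<lparr>carr := L'\<rparr>) g" "bij_betw g L L'"
    using iL by (auto simp: isomorphic_def)
  have fD: "x \<in> N \<Longrightarrow> f x \<in> N'" "x \<in> N \<Longrightarrow> y \<in> N \<Longrightarrow> f (x + y) = f x + f y" "x \<in> N \<Longrightarrow> f (act M r x) = act M' r (f x)"
    for x y r using module_homD[OF f(1)] by auto
  have gD: "x \<in> L \<Longrightarrow> g x \<in> L'" "x \<in> L \<Longrightarrow> y \<in> L \<Longrightarrow> g (x + y) = g x + g y" "x \<in> L \<Longrightarrow> g (act M r x) = act M' r (g x)"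
    for x y r using module_homD[OF g(1)] by auto
  note ND = submoduleD[OF N] submodule_more[OF M N] and LD = submoduleD[OF L] submodule_more[OF M L]
    and N'D = submoduleD[OF N'] submodule_more[OF M' N'] and L'D = submoduleD[OF L'] submodule_more[OF M' L']
  define p where "p z = (SOME x. x \<in> N \<and> z - x \<in> L)" for z
  have p: "p (x + y) = x" if "x \<in> N" "y \<in> L" for x y
  proof -
    have "\<exists>x'. x' \<in> N \<and> x + y - x' \<in> L" using that by (intro exI[of _ x]) simp
    from someI_ex[OF this] have px: "p (x + y) \<in> N" "x + y - p (x + y) \<in> L" by (simp_all add: p_def)
    have "(x + y - p (x + y)) - y \<in> L" by (rule LD(6)[OF px(2) that(2)])
    then have "x - p (x + y) \<in> L" by (simp add: algebra_simps)
    moreover have "x - p (x + y) \<in> N" by (rule ND(6)[OF that(1) px(1)])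
    ultimately have "x - p (x + y) \<in> N \<inter> L" by (rule IntI[rotated])
    then show ?thesis by (simp add: int)
  qed
  define h where "h z = f (p z) + g (z - p z)" for z
  have h: "h (x + y) = f x + g y" if "x \<in> N" "y \<in> L" for x y using p[OF that] by (simp add: h_def)
  have carrM: "\<exists>x y. z = x + y \<and> x \<in> N \<and> y \<in> L" if "z \<in> carr M" for z using that sum by blast
  have "module_hom M M' h"
  proof (rule module_homI)
    fix z assume "z \<in> carr M"
    then obtain x y where z: "z = x + y" "x \<in> N" "y \<in> L" using carrM by blast
    then show "h z \<in> carr M'" using h fD gD N'D L'D moduleD(2)[OF M'] by simp
    show "h (act M r z) = act M' r (h z)" for r
      using z h[of "act M r x" "act M r y"] h[of x y]
      by (simp add: moduleD[OF M] moduleD[OF M'] ND LD N'D L'D fD gD)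
    fix z' assume "z' \<in> carr M"
    then obtain x' y' where z': "z' = x' + y'" "x' \<in> N" "y' \<in> L" using carrM by blast
    have "z + z' = (x + x') + (y + y')" using z z' by simp
    then have "h (z + z') = f (x + x') + g (y + y')" using h[OF ND(3)[OF z(2) z'(2)] LD(3)[OF z(3) z'(3)]] by simp
    then show "h (z + z') = h z + h z'" using z z' by (simp add: fD gD h)
  qed
  moreover have "bij_betw h (carr M) (carr M')"
  proof (rule bij_betw_imageI)
    show "inj_on h (carr M)"
    proof (rule inj_onI)
      fix z z' assume zz: "z \<in> carr M" "z' \<in> carr M" "h z = h z'"
      obtain x y where z: "z = x + y" "x \<in> N" "y \<in> L" using carrM[OF zz(1)] by blast
      obtain x' y' where z': "z' = x' + y'" "x' \<in> N" "y' \<in> L" using carrM[OF zz(2)] by blast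
      have "f x + g y = f x' + g y'" using zz(3) z z' h by simp
      then have eq: "f x - f x' = g y' - g y" by (simp add: algebra_simps)
      have "f x - f x' \<in> N'" using z z' fD N'D by simp
      moreover have "g y' - g y \<in> L'" using z z' gD L'D by simp
      ultimately have "f x - f x' \<in> N' \<inter> L'" using eq by simp
      then have "f x = f x'" "g y = g y'" using int' eq by auto
      then have "x = x'" "y = y'" using f(2) g(2) z z' by (auto simp: bij_betw_def inj_on_def)
      then show "z = z'" using z z' by simp
    qed
    show "h ` carr M = carr M'"
    proof (intro equalityI subsetI)
      fix w assume "w \<in> carr M'"
      then obtain x' y' where w: "w = x' + y'" "x' \<in> N'" "y' \<in> L'" using sum' by blast
      then obtain x y where "x' = f x" "y' = g y" "x \<in> N" "y \<in> L"
        using f(2) g(2) by (auto simp: bij_betw_def)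
      then have "w = h (x + y)" "x + y \<in> carr M"
        using w h moduleD(2)[OF M submoduleD(1)[OF N] submoduleD(1)[OF L]] by auto
      then show "w \<in> h ` carr M" by blast
    qed (use module_homD(1)[OF \<open>module_hom M M' h\<close>] in auto)
  qed
  ultimately show ?thesis by (auto simp: isomorphic_def)
qed

end

section \<open>Finitely many modules of bounded measure\<close>

context fd_algebra_left begin

text \<open>Stands in for a dimension below d, for any ambient group: \<mu> restricts to submodules
  and drops by at least 1 on a proper one.\<close>

definition measured_modules :: "nat \<Rightarrow> ('h, 'm::ab_group_add) rep_module set" where
  "measured_modules d = {M. module_over (*) M \<and> fd_module scale M \<and>
     (\<exists>\<mu>::'m set \<Rightarrow> nat. \<mu> (carr M) < d \<and>
       (\<forall>N L. submodule N M \<and> submodule L M \<and> N \<subset> L \<longrightarrow> \<mu> N < \<mu> L))}"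

lemma indecomposable_representatives:
  assumes "finite_representation_type scale"
  obtains F where "finite F" "F \<subseteq> fd_indecomposables scale"
    "\<And>M. M \<in> fd_indecomposables scale \<Longrightarrow> \<exists>N\<in>F. isomorphic M N"
proof -
  let ?X = "fd_indecomposables scale" and ?r = "{(M, N) \<in> fd_indecomposables scale \<times> fd_indecomposables scale. isomorphic M N}"
  have fin: "finite (?X // ?r)" using assms by (simp add: finite_representation_type_def)
  have mod: "module_over (*) M" if "M \<in> ?X" for M using that by (simp add: fd_indecomposables_def)
  have "\<exists>F. finite F \<and> F \<subseteq> ?X \<and> (\<forall>M\<in>?X. \<exists>N\<in>F. isomorphic M N)"
  proof (rule finite_representatives[OF fin, of _ "\<lambda>Q M. Q \<in> ?X // ?r \<and> M \<in> Q"])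
    fix M assume M: "M \<in> ?X"
    then have "M \<in> ?r `` {M}" using isomorphic_refl by auto
    then show "\<exists>Q\<in>?X // ?r. Q \<in> ?X // ?r \<and> M \<in> Q" using quotientI[OF M] by blast
  next
    fix Q M N assume MN: "M \<in> ?X" "N \<in> ?X" "Q \<in> ?X // ?r \<and> M \<in> Q" "Q \<in> ?X // ?r \<and> N \<in> Q"
    then obtain A where A: "Q = ?r `` {A}" by (auto elim: quotientE)
    then have "A \<in> ?X" "isomorphic A M" "isomorphic A N" using MN by auto
    then show "isomorphic M N" using isomorphic_sym[OF mod] isomorphic_trans by blast
  qed
  then obtain F where F: "finite F" "F \<subseteq> ?X" "\<forall>M\<in>?X. \<exists>N\<in>F. isomorphic M N" by blast
  show thesis by (rule that[OF F(1,2)]) (use F(3) in blast)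
qed

text \<open>Induction on d with a finite set of codes: M is zero, or isomorphic to one of finitely
  many indecomposables, or the sum of two summands of smaller measure, each with a representative.
  Modules sharing a code are isomorphic.\<close>

lemma measured_modules_representatives:
  assumes fin: "finite_representation_type scale"
  shows "\<exists>F :: ('h, 'm::ab_group_add) rep_module set. finite F \<and> F \<subseteq> measured_modules d \<and>
    (\<forall>M\<in>(measured_modules d :: ('h, 'm) rep_module set). \<exists>N\<in>F. isomorphic M N)"
proof (induction d)
  case 0
  show ?case by (intro exI[of _ "{}"]) (auto simp: measured_modules_def)
next
  case (Suc d)
  then obtain F :: "('h, 'm) rep_module set" where F: "finite F" "F \<subseteq> measured_modules d"
    "\<forall>M\<in>(measured_modules d :: ('h, 'm) rep_module set). \<exists>N\<in>F. isomorphic M N" by blast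
  obtain E where E: "finite E" "E \<subseteq> fd_indecomposables scale"
    "\<And>M. M \<in> fd_indecomposables scale \<Longrightarrow> \<exists>N\<in>E. isomorphic M N"
    by (rule indecomposable_representatives[OF fin], rule that)
  let ?C = "insert (Inl None) (Inl ` Some ` E) \<union> Inr ` (F \<times> F)"
  define R where "R c M = (case c of Inl None \<Rightarrow> carr M = {0} | Inl (Some U) \<Rightarrow> U \<in> E \<and> isomorphic M U |
      Inr (A, B) \<Rightarrow> A \<in> F \<and> B \<in> F \<and> (\<exists>N L. direct_sum M N L \<and> isomorphic (M\<lparr>carr := N\<rparr>) A \<and> isomorphic (M\<lparr>carr := L\<rparr>) B))"
    for c and M :: "('h, 'm) rep_module"
  have modE: "module_over (*) U" if "U \<in> E" for U using that E(2) by (auto simp: fd_indecomposables_def)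
  have modF: "module_over (*) A" if "A \<in> F" for A using that F(2) by (auto simp: measured_modules_def)
  show ?case
  proof (rule finite_representatives[of ?C _ R])
    show "finite ?C" using F(1) E(1) by simp
  next
    fix M :: "('h, 'm) rep_module" assume MX: "M \<in> measured_modules (Suc d)"
    then have M: "module_over (*) M" "fd_module scale M" by (auto simp: measured_modules_def)
    obtain \<mu> :: "'m set \<Rightarrow> nat" where \<mu>: "\<mu> (carr M) < Suc d"
      "\<And>N L. submodule N M \<Longrightarrow> submodule L M \<Longrightarrow> N \<subset> L \<Longrightarrow> \<mu> N < \<mu> L"
      using MX by (auto simp: measured_modules_def)
    consider "carr M = {0}" | "indecomposable M" | N L where "direct_sum M N L" "N \<noteq> {0}" "L \<noteq> {0}"
      by (auto simp: indecomposable_iff)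
    then show "\<exists>c\<in>?C. R c M"
    proof cases
      case 1
      then have "R (Inl None) M" by (simp add: R_def)
      then show ?thesis by blast
    next
      case 2
      obtain U :: "('h, nat \<Rightarrow>\<^sub>0 'k) rep_module" where U: "module_over (*) U" "fd_module scale U" "isomorphic M U"
        using fd_module_in_universe[OF k_algebra_axioms mul M] by blast
      then have "U \<in> fd_indecomposables scale"
        using indecomposable_iso[OF M(1) U(1,3) 2] by (simp add: fd_indecomposables_def)
      then obtain U' where U': "U' \<in> E" "isomorphic U U'" using E(3) by blast
      then have "R (Inl (Some U')) M" using isomorphic_trans[OF U(3)] by (simp add: R_def)
      then show ?thesis using U'(1) by blast
    next
      case (3 N L)
      have small: "\<exists>A\<in>F. isomorphic (M\<lparr>carr := N\<rparr>) A" if ds: "direct_sum M N L" and L: "L \<noteq> {0}" for N L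
      proof -
        have sub: "submodule N M" "submodule L M" and int: "N \<inter> L = {0}" using ds by (auto simp: direct_sum_def)
        have "N \<noteq> carr M"
        proof
          assume "N = carr M"
          then have "L = N \<inter> L" using submoduleD(1)[OF sub(2)] by blast
          then show False using int L by simp
        qed
        then have "\<mu> N < \<mu> (carr M)"
          using submoduleD(1)[OF sub(1)] by (intro \<mu>(2) sub submodule_self[OF M(1)]) blast
        then have "\<mu> N < d" using \<mu>(1) by simp
        moreover have "\<mu> A < \<mu> B" if "submodule A (M\<lparr>carr := N\<rparr>)" "submodule B (M\<lparr>carr := N\<rparr>)" "A \<subset> B" for A B
          using that submoduleD(1)[OF sub(1)] by (intro \<mu>(2)) (auto simp: submodule_def)
        ultimately have "M\<lparr>carr := N\<rparr> \<in> measured_modules d"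
          using submodule_more(4)[OF M(1) sub(1)] direct_summand_fd[OF M ds]
          by (auto simp: measured_modules_def intro!: exI[of _ \<mu>])
        with F(3) show ?thesis by (rule bspec)
      qed
      obtain A where A: "A \<in> F" "isomorphic (M\<lparr>carr := N\<rparr>) A" using small[OF 3(1,3)] by blast
      obtain B where B: "B \<in> F" "isomorphic (M\<lparr>carr := L\<rparr>) B"
        using small[OF direct_sum_swap[OF 3(1)] 3(2)] by blast
      have "R (Inr (A, B)) M" using A B 3(1) by (auto simp: R_def)
      then show ?thesis using A(1) B(1) by blast
    qed
  next
    fix c and M N :: "('h, 'm) rep_module"
    assume "M \<in> measured_modules (Suc d)" "N \<in> measured_modules (Suc d)" and R: "R c M" "R c N"
    then have M: "module_over (*) M" and N: "module_over (*) N" by (auto simp: measured_modules_def)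
    consider "c = Inl None" | U where "c = Inl (Some U)" | A B where "c = Inr (A, B)"
      by (metis obj_sumE option.exhaust surj_pair)
    then show "isomorphic M N"
    proof cases
      case 1
      then have "carr M = {0}" "carr N = {0}" using R by (simp_all add: R_def)
      then have "module_hom M N (\<lambda>x. 0)" "bij_betw (\<lambda>x. 0) (carr M) (carr N)"
        by (auto simp: module_hom_def module_more[OF N] bij_betw_def)
      then show ?thesis by (auto simp: isomorphic_def)
    next
      case (2 U)
      then show ?thesis
        using R isomorphic_trans isomorphic_sym[OF N] by (auto simp: R_def)
    next
      case (3 A B)
      obtain N1 L1 where 1: "direct_sum M N1 L1" "isomorphic (M\<lparr>carr := N1\<rparr>) A" "isomorphic (M\<lparr>carr := L1\<rparr>) B"
        using R(1) 3 by (auto simp: R_def)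
      obtain N2 L2 where 2: "direct_sum N N2 L2" "isomorphic (N\<lparr>carr := N2\<rparr>) A" "isomorphic (N\<lparr>carr := L2\<rparr>) B"
        using R(2) 3 by (auto simp: R_def)
      have sub: "submodule N2 N" "submodule L2 N" using 2(1) by (auto simp: direct_sum_def)
      have "isomorphic A (N\<lparr>carr := N2\<rparr>)" "isomorphic B (N\<lparr>carr := L2\<rparr>)"
        using isomorphic_sym[OF submodule_more(4)[OF N sub(1)] 2(2)]
          isomorphic_sym[OF submodule_more(4)[OF N sub(2)] 2(3)] .
      then show ?thesis
        using direct_sum_isomorphic[OF M N 1(1) 2(1)] isomorphic_trans 1(2,3) by blast
    qed
  qed
qed

end

section \<open>Infinite representation type\<close>

context fd_algebra_left begin

text \<open>The left submodule H \<psi> of the dual of the right regular module.\<close>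

definition translate_module :: "('h \<Rightarrow> 'k) \<Rightarrow> ('h, 'h \<Rightarrow> 'k) rep_module" where
  "translate_module \<psi> = \<lparr>carr = range (\<lambda>h x. \<psi> (x * h)), act = (\<lambda>r f x. f (x * r))\<rparr>"

lemma translate_module:
  assumes \<psi>: "functional_on scale \<psi>"
  shows "module_over (*) (translate_module \<psi>)"
proof -
  note simps = functionalD[OF \<psi>]
  have I: "(\<lambda>x. \<psi> (x * h)) \<in> range (\<lambda>h x. \<psi> (x * h))" for h by (rule rangeI)
  show ?thesis
    unfolding module_over_def translate_module_def
  proof (simp, intro conjI allI)
    show "0 \<in> range (\<lambda>h x. \<psi> (x * h))" using I[of 0] by (simp add: simps zero_fun_def)
    show "(\<lambda>x. \<psi> (x * h)) + (\<lambda>x. \<psi> (x * h')) \<in> range (\<lambda>h x. \<psi> (x * h))" for h h'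
      using I[of "h + h'"] by (simp add: simps distrib_left plus_fun_def)
    show "- (\<lambda>x. \<psi> (x * h)) \<in> range (\<lambda>h x. \<psi> (x * h))" for h
      using I[of "- h"] by (simp add: simps fun_Compl_def)
    show "(\<lambda>x. \<psi> (x * r * h)) \<in> range (\<lambda>h x. \<psi> (x * h))" for r h
      using I[of "r * h"] by (simp add: mult.assoc)
  qed (simp_all add: simps fun_eq_iff algebra_simps)
qed

text \<open>The bound is uniform in \<psi>, so over an algebra of finite type all these modules fall
  into finitely many isomorphism classes.\<close>

lemma translate_module_measured:
  assumes \<psi>: "functional_on scale \<psi>"
  shows "translate_module \<psi> \<in> measured_modules (Suc (card Basis))"
proof -
  note M = translate_module[OF \<psi>]
  let ?g = "\<lambda>b x. \<psi> (x * b)"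
  have g: "?g b \<in> carr (translate_module \<psi>)" for b by (simp add: translate_module_def)
  have sp: "\<exists>c. f = (\<Sum>b\<in>Basis. act (translate_module \<psi>) (scale (c b) 1) (?g b))"
    if "f \<in> carr (translate_module \<psi>)" for f
  proof -
    obtain h where h: "f = (\<lambda>x. \<psi> (x * h))" using \<open>f \<in> _\<close> by (auto simp: translate_module_def)
    have "h = (\<Sum>b\<in>Basis. scale (representation Basis h b) b)"
      using sum_representation_eq[OF independent_Basis _ finite_Basis, of h] span_Basis by simp
    then have "f x = \<psi> (x * (\<Sum>b\<in>Basis. scale (representation Basis h b) b))" for x using h by simp
    then have "f = (\<Sum>b\<in>Basis. act (translate_module \<psi>) (scale (representation Basis h b) 1) (?g b))"
      by (simp add: fun_eq_iff sum_fun_apply translate_module_def sum_distrib_left functionalD[OF \<psi>] mul_scale)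
    then show ?thesis by (rule exI[of _ "representation Basis h"])
  qed
  have fin: "finite (?g ` Basis)" using finite_Basis by simp
  have sub: "?g ` Basis \<subseteq> carr (translate_module \<psi>)" using g by blast
  have "\<exists>c. f = (\<Sum>b\<in>?g ` Basis. act (translate_module \<psi>) (scale (c b) 1) b)"
    if f: "f \<in> carr (translate_module \<psi>)" for f
  proof -
    obtain c where "f = (\<Sum>b\<in>Basis. act (translate_module \<psi>) (scale (c b) 1) (?g b))" using sp[OF f] by blast
    then show ?thesis by (rule spanning_image[OF M finite_Basis g])
  qed
  from submodule_measure[OF M fin sub this]
  obtain \<mu> :: "('h \<Rightarrow> 'k) set \<Rightarrow> nat"
    where \<mu>: "\<forall>N L. submodule N (translate_module \<psi>) \<and> submodule L (translate_module \<psi>) \<and> N \<subset> L \<longrightarrow> \<mu> N < \<mu> L"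
      "\<forall>N. \<mu> N \<le> card (?g ` Basis)" by blast
  have "\<mu> (carr (translate_module \<psi>)) < Suc (card Basis)"
    using \<mu>(2) card_image_le[OF finite_Basis, of ?g] by (meson le_imp_less_Suc le_trans)
  then show ?thesis
    unfolding measured_modules_def using M fd_moduleI[OF M finite_Basis g sp] \<mu>(1) by blast
qed

text \<open>An isomorphism of the modules generated by \<open>\<phi>\<close> and \<open>\<psi>\<close> turns \<open>\<phi>\<close> into a matrix coefficient
  \<open>x \<mapsto> \<psi> (b x g)\<close> on \<open>J\<close>, and there \<open>b\<close> and \<open>g\<close> only matter modulo \<open>J\<close> as \<open>\<psi>\<close> vanishes on \<open>J\<^sup>2\<close>.\<close>

lemma isomorphic_translates:
  fixes J :: "'h set" and e :: "nat \<Rightarrow> 'h"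
  assumes \<phi>: "functional_on scale \<phi>" and \<psi>: "functional_on scale \<psi>"
    and J: "two_sided_ideal J" and e: "\<And>x. \<exists>c. x - (\<Sum>j<n. scale (c j) (e j)) \<in> J"
    and \<psi>J: "\<And>a b. a \<in> J \<Longrightarrow> b \<in> J \<Longrightarrow> \<psi> (a * b) = 0"
    and iso: "isomorphic (translate_module \<phi>) (translate_module \<psi>)"
  shows "\<exists>\<beta> \<gamma>. \<forall>z\<in>J. \<phi> z = (\<Sum>j<n. \<Sum>l<n. \<beta> j * \<gamma> l * \<psi> (e j * z * e l))"
proof -
  note \<psi>s = functionalD[OF \<psi>]
  have JD: "x * r \<in> J" "r * x \<in> J" if "x \<in> J" for x r
    using J that by (auto simp: two_sided_ideal_def left_ideal_def)
  have Jsub: "subspace J"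
    using J by (intro mul_ideal_subspace) (simp add: mul_ideal_left_ideal two_sided_ideal_def)
  obtain f where f: "module_hom (translate_module \<phi>) (translate_module \<psi>) f"
    "bij_betw f (carr (translate_module \<phi>)) (carr (translate_module \<psi>))"
    using iso by (auto simp: isomorphic_def)
  have \<phi>carr: "(\<lambda>x. \<phi> (x * h)) \<in> carr (translate_module \<phi>)" for h by (simp add: translate_module_def)
  have "f (\<lambda>x. \<phi> (x * 1)) \<in> carr (translate_module \<psi>)" by (rule module_homD(1)[OF f(1) \<phi>carr])
  then obtain g where g: "f (\<lambda>x. \<phi> (x * 1)) = (\<lambda>x. \<psi> (x * g))" by (auto simp: translate_module_def)
  have fz: "f (\<lambda>x. \<phi> (x * z)) = (\<lambda>x. \<psi> (x * (z * g)))" for z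
    using module_homD(3)[OF f(1) \<phi>carr[of 1], of z] g by (simp add: translate_module_def mult.assoc)
  \<comment> \<open>If the n values \<psi>(e_j z g) vanish for a z in J, then so does \<psi>(x z g)
    for all x, as \<psi> kills J^2; injectivity of f returns \<phi>(z) = 0. Hence \<phi> is a
    combination of these n functionals on J.\<close>
  have zero: "\<phi> z = 0" if z: "z \<in> J" and ez: "\<And>j. j < n \<Longrightarrow> \<psi> (e j * (z * g)) = 0" for z
  proof -
    have "\<psi> (x * (z * g)) = 0" for x
    proof -
      obtain c where c: "x - (\<Sum>j<n. scale (c j) (e j)) \<in> J" using e by blast
      have "\<psi> ((x - (\<Sum>j<n. scale (c j) (e j))) * (z * g)) = 0"
        by (rule \<psi>J[OF c JD(1)[OF z]])
      moreover have "\<psi> ((\<Sum>j<n. scale (c j) (e j)) * (z * g)) = 0"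
        by (simp add: sum_distrib_right \<psi>s mul_scale ez)
      ultimately show ?thesis by (simp add: left_diff_distrib \<psi>s)
    qed
    then have "f (\<lambda>x. \<phi> (x * z)) = f (\<lambda>x. \<phi> (x * 0))" unfolding fz by (simp add: \<psi>s)
    from inj_onD[OF bij_betw_imp_inj_on[OF f(2)] this \<phi>carr \<phi>carr]
    have "(\<lambda>x. \<phi> (x * z)) = (\<lambda>x. \<phi> (x * 0))" .
    then have "\<phi> (1 * z) = \<phi> (1 * 0)" by (rule fun_cong)
    then show ?thesis by (simp add: functionalD[OF \<phi>])
  qed
  have lin: "functional_on scale (\<lambda>z. \<psi> (e j * (z * g)))" for j
    by (simp add: Vector_Spaces.linear_iff vector_space_axioms vector_space_field \<psi>s
        distrib_left distrib_right mul_scale)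
  have "\<exists>\<beta>. \<forall>z\<in>J. \<phi> z = (\<Sum>j<n. \<beta> j * \<psi> (e j * (z * g)))"
    by (rule functional_combination[OF Jsub vector_space_axioms lin \<phi>]) (erule zero)
  then obtain \<beta> where \<beta>: "\<forall>z\<in>J. \<phi> z = (\<Sum>j<n. \<beta> j * \<psi> (e j * (z * g)))" by (rule exE)
  \<comment> \<open>Coordinates of g modulo J; the remainder contributes a product of two elements
    of J, which \<psi> kills.\<close>
  obtain \<gamma> where \<gamma>: "g - (\<Sum>l<n. scale (\<gamma> l) (e l)) \<in> J" using e by blast
  have "\<psi> (e j * (z * g)) = (\<Sum>l<n. \<gamma> l * \<psi> (e j * z * e l))" if z: "z \<in> J" for z j
  proof -
    have "\<psi> ((e j * z) * (g - (\<Sum>l<n. scale (\<gamma> l) (e l)))) = 0"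
      by (rule \<psi>J[OF JD(2)[OF z] \<gamma>])
    then show ?thesis
      by (simp add: right_diff_distrib \<psi>s sum_distrib_left mul_scale mult.assoc)
  qed
  then have "\<phi> z = (\<Sum>j<n. \<Sum>l<n. \<beta> j * \<gamma> l * \<psi> (e j * z * e l))" if "z \<in> J" for z
    using bspec[OF \<beta> that] that by (simp add: sum_distrib_left mult.assoc)
  then show ?thesis by blast
qed

theorem infinite_type:
  fixes J :: "'h set" and e :: "nat \<Rightarrow> 'h" and y :: "nat \<Rightarrow> 'h" and \<phi> :: "nat \<Rightarrow> 'h \<Rightarrow> 'k"
  assumes inf: "infinite (UNIV :: 'k set)" and n: "n > 0"
    and J: "two_sided_ideal J" and e: "\<And>x. \<exists>c. x - (\<Sum>j<n. scale (c j) (e j)) \<in> J"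
    and \<phi>: "\<And>i. i < 2 * n \<Longrightarrow> functional_on scale (\<phi> i)"
    and \<phi>J: "\<And>i a b. i < 2 * n \<Longrightarrow> a \<in> J \<Longrightarrow> b \<in> J \<Longrightarrow> \<phi> i (a * b) = 0"
    and y: "\<And>i. i < 2 * n \<Longrightarrow> y i \<in> J"
    and dual: "\<And>i j. i < 2 * n \<Longrightarrow> j < 2 * n \<Longrightarrow> \<phi> i (y j) = (if i = j then 1 else 0)"
  shows "\<not> finite_representation_type scale"
proof
  assume frt: "finite_representation_type scale"
  define N where "N = 2 * n"
  \<comment> \<open>The least D that \<open>curve_not_covered\<close> accepts. \<Phi> t runs through
    the sparse curve, whose coordinates t^(D^i) are its values at the y_i.\<close>
  define D where "D = Suc (N ^ (N - 1))"
  define \<Phi> where "\<Phi> t x = (\<Sum>i<N. t ^ (D ^ i) * \<phi> i x)" for t x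
  have \<phi>s: "\<phi> i (x + z) = \<phi> i x + \<phi> i z" "\<phi> i (scale c x) = c * \<phi> i x" if "i < N" for i x z c
    using functionalD[OF \<phi>] that by (simp_all add: N_def)
  have \<Phi>: "functional_on scale (\<Phi> t)" for t
    by (simp add: Vector_Spaces.linear_iff vector_space_axioms vector_space_field \<Phi>_def \<phi>s
        distrib_left sum.distrib sum_distrib_left mult.left_commute)
  have \<Phi>J: "\<Phi> t (a * b) = 0" if "a \<in> J" "b \<in> J" for t a b
    using that \<phi>J by (simp add: \<Phi>_def N_def)
  have \<Phi>y: "\<Phi> t (y i) = t ^ (D ^ i)" if "i < N" for t i
  proof -
    have "\<Phi> t (y i) = (\<Sum>j<N. if j = i then t ^ (D ^ j) else 0)"
      unfolding \<Phi>_def using that dual by (intro sum.cong) (auto simp: N_def)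
    then show ?thesis using that by simp
  qed
  obtain F :: "('h, 'h \<Rightarrow> 'k) rep_module set" where F: "finite F"
    "\<forall>M\<in>(measured_modules (Suc (card Basis)) :: ('h, 'h \<Rightarrow> 'k) rep_module set). \<exists>X\<in>F. isomorphic M X"
    using measured_modules_representatives[OF frt] by blast
  \<comment> \<open>t = 0 is left out so that \<Phi> t takes the nonzero value t at
    \<open>y 0\<close>, which forces some \<open>\<gamma> t l\<close> to be nonzero.\<close>
  have "infinite (UNIV - {0 :: 'k})" using inf by simp
  moreover have "\<forall>t\<in>UNIV - {0}. \<exists>X\<in>F. isomorphic (translate_module (\<Phi> t)) X"
    using F(2) translate_module_measured[OF \<Phi>] by blast
  ultimately obtain X :: "('h, 'h \<Rightarrow> 'k) rep_module"
    where X: "infinite {t \<in> UNIV - {0}. isomorphic (translate_module (\<Phi> t)) X}"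
    using pigeonhole_infinite_rel[OF _ F(1), of "UNIV - {0}" "\<lambda>t X. isomorphic (translate_module (\<Phi> t)) X"] by blast
  define T where "T = {t \<in> UNIV - {0}. isomorphic (translate_module (\<Phi> t)) X}"
  have "T \<noteq> {}" using X unfolding T_def by (metis finite.emptyI)
  then obtain t0 where t0: "t0 \<in> T" by blast
  have "\<exists>\<beta> \<gamma>. \<forall>z\<in>J. \<Phi> t z = (\<Sum>j<n. \<Sum>l<n. \<beta> j * \<gamma> l * \<Phi> t0 (e j * z * e l))" if t: "t \<in> T" for t
  proof (rule isomorphic_translates[OF \<Phi> \<Phi> J e \<Phi>J])
    show "isomorphic (translate_module (\<Phi> t)) (translate_module (\<Phi> t0))"
      using t t0 isomorphic_trans isomorphic_sym[OF translate_module[OF \<Phi>]] unfolding T_def by blast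
  qed
  then have "\<forall>t\<in>T. \<exists>\<beta> \<gamma>. \<forall>z\<in>J. \<Phi> t z = (\<Sum>j<n. \<Sum>l<n. \<beta> j * \<gamma> l * \<Phi> t0 (e j * z * e l))" ..
  from bchoice[OF this] obtain \<beta> where
    "\<forall>t\<in>T. \<exists>\<gamma>. \<forall>z\<in>J. \<Phi> t z = (\<Sum>j<n. \<Sum>l<n. \<beta> t j * \<gamma> l * \<Phi> t0 (e j * z * e l))" ..
  from bchoice[OF this] obtain \<gamma> where
    "\<forall>t\<in>T. \<forall>z\<in>J. \<Phi> t z = (\<Sum>j<n. \<Sum>l<n. \<beta> t j * \<gamma> t l * \<Phi> t0 (e j * z * e l))" ..
  then have coef: "\<Phi> t z = (\<Sum>j<n. \<Sum>l<n. \<beta> t j * \<gamma> t l * \<Phi> t0 (e j * z * e l))"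
    if "t \<in> T" "z \<in> J" for t z using that by simp
  have "\<exists>l\<in>{..<n}. \<gamma> t l \<noteq> 0" if t: "t \<in> T" for t
  proof (rule ccontr)
    assume "\<not> ?thesis"
    then have "\<Phi> t (y 0) = 0" using coef[OF t y[of 0]] n by simp
    then show False using \<Phi>y[of 0 t] n t by (simp add: N_def T_def)
  qed
  \<comment> \<open>One index l0 works for infinitely many t, which permits a common normalisation
    by \<open>\<gamma> t l0\<close>.\<close>
  then obtain l0 where l0: "l0 < n" "infinite {t \<in> T. \<gamma> t l0 \<noteq> 0}"
    using pigeonhole_infinite_rel[of T "{..<n}" "\<lambda>t l. \<gamma> t l \<noteq> 0"] X unfolding T_def by auto
  obtain \<tau> :: "nat \<Rightarrow> 'k" where \<tau>: "inj \<tau>" "range \<tau> \<subseteq> {t \<in> T. \<gamma> t l0 \<noteq> 0}"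
    using infinite_countable_subset[OF l0(2)] by blast
  \<comment> \<open>\<beta>_j \<gamma>_l is the product of the normalised factors \<beta>_j
    \<gamma>_l0 and \<gamma>_l / \<gamma>_l0. The variable with index n + l0 is constantly 1 and is
    left out of \<open>V\<close>, so 2 n - 1 variables remain.\<close>
  define w where "w a v = (if v < n then \<beta> (\<tau> a) v * \<gamma> (\<tau> a) l0 else \<gamma> (\<tau> a) (v - n) / \<gamma> (\<tau> a) l0)" for a v
  define V where "V = {..<2 * n} - {n + l0}"
  have V: "finite V" "card V < N" using l0(1) by (simp_all add: V_def N_def)
  have mono: "(\<lambda>a. \<beta> (\<tau> a) j * \<gamma> (\<tau> a) l) \<in> polys V w 1" if jl: "j < n" "l < n" for j l
  proof -
    have nz: "\<gamma> (\<tau> a) l0 \<noteq> 0" for a using \<tau>(2) by blast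
    let ?S = "{j, n + l} - {n + l0}"
    have "(\<Prod>v\<in>?S. w a v) = \<beta> (\<tau> a) j * \<gamma> (\<tau> a) l" for a
    proof (cases "l = l0")
      case True
      then have "?S = {j}" using jl by auto
      then show ?thesis using jl True by (simp add: w_def)
    next
      case False
      then have "?S = {j, n + l}" using jl by auto
      then show ?thesis using jl nz by (simp add: w_def)
    qed
    moreover have "(\<lambda>a. \<Prod>v\<in>?S. w a v) \<in> polys V w 1"
      using jl by (intro prod_polys V(1)) (auto simp: V_def)
    ultimately show ?thesis by simp
  qed
  have "(\<lambda>a. \<tau> a ^ (D ^ i)) \<in> polys V w 1" if i: "i < N" for i
  proof -
    have "\<tau> a ^ (D ^ i) = (\<Sum>j<n. \<Sum>l<n. \<Phi> t0 (e j * y i * e l) * (\<beta> (\<tau> a) j * \<gamma> (\<tau> a) l))" for a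
    proof -
      have "\<tau> a \<in> T" using \<tau>(2) by blast
      then show ?thesis using coef[of "\<tau> a" "y i"] y i \<Phi>y[OF i, of "\<tau> a"] by (simp add: N_def mult_ac)
    qed
    then show ?thesis using mono by (auto intro!: polys_sum polys_scale)
  qed
  then show False
    by (rule curve_not_covered[OF \<tau>(1) V, of D, rotated]) (simp_all add: D_def)
qed

end

theorem theorem5p8:
  fixes scale :: "'k::alg_closed_field \<Rightarrow> 'h::ring_1 \<Rightarrow> 'h"
    and \<Delta> :: "'h \<Rightarrow> (('h \<times> 'h) \<Rightarrow>\<^sub>0 'k) set"
    and \<epsilon> :: "'h \<Rightarrow> 'k"
    and S :: "'h \<Rightarrow> 'h"
  assumes "hopf_algebra scale \<Delta> \<epsilon> S"
    and "finite_dimensional scale"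
    and "chevalley_property \<Delta> \<epsilon> S"
  shows "finite_representation_type scale \<longleftrightarrow> nakayama_algebra scale"
proof -
  interpret hopf_algebra scale \<Delta> \<epsilon> S by (rule assms(1))
  obtain Basis where fd: "finite_dimensional_vector_space scale Basis"
    using assms(2) by (auto simp: finite_dimensional_def)
  interpret fd: finite_dimensional_vector_space scale Basis by (rule fd)
  interpret L: fd_algebra_left scale Basis by unfold_locales simp
  let ?J = "nil_radical :: 'h set"
  have ideal: "two_sided_ideal ?J"
    using L.mul_ideal_nil_radical nil_radical_mult_right
    by (auto simp: two_sided_ideal_def L.mul_ideal_left_ideal)
  show ?thesis
  proof
    assume frt: "finite_representation_type scale"
    from hopf_radical_cases[OF assms(1) fd assms(3)]
    obtain v :: 'h where v: "range (\<lambda>a. a * v) = ?J" "range (\<lambda>a. v * a) = ?J"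
    proof (elim disjE exE conjE)
      fix n :: nat and e y :: "nat \<Rightarrow> 'h" and \<phi> :: "nat \<Rightarrow> 'h \<Rightarrow> 'k"
      assume "n > 0" "\<forall>x. \<exists>c. x - (\<Sum>j<n. scale (c j) (e j)) \<in> ?J"
        "\<forall>i<2 * n. functional_on scale (\<phi> i) \<and> y i \<in> ?J \<and> (\<forall>a\<in>?J. \<forall>b\<in>?J. \<phi> i (a * b) = 0) \<and>
          (\<forall>j<2 * n. \<phi> i (y j) = (if i = j then 1 else 0))"
      then have "\<not> finite_representation_type scale"
        by (intro L.infinite_type[OF alg_closed_field_infinite _ ideal, of n e \<phi> y]) auto
      then show thesis using frt by simp
    qed
    show "nakayama_algebra scale"
      unfolding nakayama_algebra_def
    proof (intro ballI allI impI, elim conjE)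
      fix mul and P :: "('h, nat \<Rightarrow>\<^sub>0 'k) rep_module"
      assume mul: "mul \<in> {(*), \<lambda>x y. y * x}"
        and P: "module_over mul P" "fd_module scale P" "projective mul P" "indecomposable P"
      interpret A: fd_algebra scale Basis mul by unfold_locales (rule mul)
      have "range (\<lambda>a. mul a v) = ?J" "range (\<lambda>a. mul v a) = ?J" using mul v by auto
      then show "\<exists>!Ns. composition_series P Ns" using P by (rule A.normal_generator_uniserial)
    qed
  qed (rule L.nakayama_imp_finite_type)
qed

end
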